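(* For every integer $p \geq 1$, there exists a pair $\mathcal{B}=\{B_0,B_1\}$ of real square matrices of dimension $2^p(2^{p+1}-1)$ such that: (i) if $x \in \Sigma_2^\omega$ is very weakly extremal for $\mathcal{B}$, then \[P(x,n) \geq \left(\left\lfloor \frac{n}{2^p}\right\rfloor+1\right)^p > 2^{-p^2}n^p\] for every integer $n \geq 1$; (ii) there exists $z \in \Sigma_2^\omega$ which is strongly extremal for $\mathcal{B}$ and satisfies $P(z,n) \leq 2^p\left(\left\lceil \frac{n}{2^p}\right\rceil +2\right)^p$ for every integer $n\ge 1$.
   Context: For an integer $m\ge 1$, $\Sigma_m=\{0,1,\ldots,m-1\}$ and $\Sigma_m^\omega$ is the set of infinite sequences $x=x_1x_2\cdots$ with $x_i\in\Sigma_m$. A subword of $x$ of length $n$ is a word $x_{k+1}x_{k+2}\cdots x_{k+n}$ for some $k\ge 0$; the subword complexity $P(x,n)$ is the number of distinct subwords of $x$ of length $n$. For a finite set $\mathcal{A}=\{A_0,\ldots,A_{m-1}\}$ of $d\times d$ real matrices, its joint spectral radius is $\varrho(\mathcal{A})=\lim_{n\to\infty}\max\{\|A_{i_1}\cdots A_{i_n}\|^{1/n}: i_j\in\Sigma_m\}$, where $\|\cdot\|$ is the Euclidean operator norm. A sequence $x\in\Sigma_m^\omega$ is strongly extremal for $\mathcal{A}$ if there exists $\delta>0$ with $\|A_{x_n}\cdots A_{x_1}\|\ge \delta\varrho(\mathcal{A})^n$ for all $n\ge1$; it is very weakly extremal for $\mathcal{A}$ if $\limsup_{n\to\infty}\|A_{x_n}\cdots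 A_{x_1}\|^{1/n}=\varrho(\mathcal{A})$. *)

theory Defs
  imports "Jordan_Normal_Form.Matrix" "HOL-Library.Liminf_Limsup" "HOL-Library.Extended_Real"
begin

text \<open>Sequences in Sigma_m^omega are functions x :: nat => nat, with entries x 1, x 2, ...
  (the value x 0 is ignored); x is in Sigma_m^omega iff x i < m for all i >= 1.\<close>

definition in_shift :: "nat \<Rightarrow> (nat \<Rightarrow> nat) \<Rightarrow> bool" where
  "in_shift m x \<longleftrightarrow> (\<forall>i\<ge>1. x i < m)"

definition subword :: "(nat \<Rightarrow> nat) \<Rightarrow> nat \<Rightarrow> nat \<Rightarrow> nat list" where
  "subword x k n = map (\<lambda>i. x (k + 1 + i)) [0..<n]"

definition complexity :: "(nat \<Rightarrow> nat) \<Rightarrow> nat \<Rightarrow> nat" where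
  "complexity x n = card {subword x k n | k. True}"

definition vec_norm :: "real vec \<Rightarrow> real" where
  "vec_norm v = sqrt (\<Sum>i<dim_vec v. (v $ i)\<^sup>2)"

definition op_norm :: "real mat \<Rightarrow> real" where
  "op_norm A = Sup {vec_norm (A *\<^sub>v v) | v. dim_vec v = dim_col A \<and> vec_norm v \<le> 1}"

fun word_prod :: "nat \<Rightarrow> (nat \<Rightarrow> real mat) \<Rightarrow> nat list \<Rightarrow> real mat" where
  "word_prod d A [] = 1\<^sub>m d"
| "word_prod d A (i # w) = A i * word_prod d A w"

definition seq_prod :: "nat \<Rightarrow> (nat \<Rightarrow> real mat) \<Rightarrow> (nat \<Rightarrow> nat) \<Rightarrow> nat \<Rightarrow> real mat" where
  "seq_prod d A x n = word_prod d A (rev (map x [1..<n+1]))"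

definition jsr :: "nat \<Rightarrow> nat \<Rightarrow> (nat \<Rightarrow> real mat) \<Rightarrow> real" where
  "jsr d m A = lim (\<lambda>n. Max {root n (op_norm (word_prod d A w)) | w.
       length w = n \<and> set w \<subseteq> {..<m}})"

definition strongly_extremal :: "nat \<Rightarrow> nat \<Rightarrow> (nat \<Rightarrow> real mat) \<Rightarrow> (nat \<Rightarrow> nat) \<Rightarrow> bool" where
  "strongly_extremal d m A x \<longleftrightarrow>
     (\<exists>\<delta>>0. \<forall>n\<ge>1. op_norm (seq_prod d A x n) \<ge> \<delta> * jsr d m A ^ n)"

definition very_weakly_extremal :: "nat \<Rightarrow> nat \<Rightarrow> (nat \<Rightarrow> real mat) \<Rightarrow> (nat \<Rightarrow> nat) \<Rightarrow> bool" where
  "very_weakly_extremal d m A x \<longleftrightarrow>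
     limsup (\<lambda>n. ereal (root n (op_norm (seq_prod d A x n)))) = ereal (jsr d m A)"

end

theory Submission
  imports "HOL-Analysis.Kronecker_Approximation_Theorem" "HOL-Analysis.Lipschitz" "HOL-Analysis.L2_Norm" Defs
begin

text \<open>Consider the pair \<open>A\<^sub>0 = [[2,3],[1,2]]\<close>, \<open>A\<^sub>1 = a [[2,1],[3,2]]\<close> with \<open>a > 0\<close>. Both images of the
  quadrant are separated cones, and the images under the transposed matrices are separated in the opposite
  order. Hence for a Barabanov function \<open>h\<close> the directions at which \<open>0\<close> (resp. \<open>1\<close>) is an optimal next
  letter form complementary intervals meeting in at most one ray, and no two optimal words can contain
  \<open>0w0\<close> and \<open>1w1\<close> with the same \<open>w\<close>. So all optimal words are balanced, with a common frequency of ones,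
  which depends continuously on \<open>a\<close> and takes every value in \<open>(0,1)\<close>.

  Choose \<open>p\<close> parameters whose frequencies are rationally independent together with \<open>1\<close>, form the \<open>2^p\<close>
  tensor products, and code them by two block matrices. A very weakly extremal sequence loses so little of
  \<open>h\<close> on average that it contains arbitrarily long words all of whose \<open>p\<close> coordinates are optimal at once;
  by Kronecker's theorem such words contain \<open>(n+1)^p\<close> factors of length \<open>n\<close>.\<close>

text \<open>The dimension \<open>2^p * (2^(p+1) - 1)\<close> is made of \<open>2^p\<close> tensor
  coordinates for each of the \<open>2 * 2^p - 1\<close> states of a decoder. As only two matrices
  are allowed, a symbol is spelled with \<open>2^p\<close> letters; this is why the bounds contain
  \<open>n / 2^p\<close>. Very weak extremality excludes only exponential loss, so the given
  sequence need not be balanced or have a frequency. Compactness is therefore used twice: over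
  directions, to give every non-optimal word a uniform loss factor below 1, and over words (Koenig),
  to pass from long optimal factors to an infinite sequence whose coordinates have exact
  frequencies. The factors of that sequence all occur in the decoded one, so it suffices to count
  them. Continuity of the frequency follows from the same loss factor and not from a formula: a word
  optimal for a nearby parameter loses too little to be non-optimal in every block. Two features of
  the matrices matter throughout: the determinants 1 and \<open>a^2\<close> are positive, so words
  keep the order of directions, and all entries are positive, so one letter makes all directions
  comparable up to a constant.\<close>

section \<open>Limit superior of bounded real sequences\<close>

definition real_limsup :: "(nat \<Rightarrow> real) \<Rightarrow> real" where
  "real_limsup f = Inf {c. \<forall>\<^sub>F n in sequentially. f n \<le> c}"

lemma
  assumes "\<And>n. l \<le> f n" "\<And>n. f n \<le> u"
  shows real_limsup_ge: "l \<le> real_limsup f"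
    and real_limsup_le: "real_limsup f \<le> u"
    and real_limsup_eventually: "e > 0 \<Longrightarrow> \<forall>\<^sub>F n in sequentially. f n < real_limsup f + e"
    and real_limsup_frequently: "e > 0 \<Longrightarrow> \<exists>\<^sub>F n in sequentially. f n > real_limsup f - e"
proof -
  let ?C = "{c. \<forall>\<^sub>F n in sequentially. f n \<le> c}"
  have u: "u \<in> ?C" using assms(2) by simp
  have l: "l \<le> c" if "c \<in> ?C" for c
  proof -
    from that obtain n where "f n \<le> c" by (auto simp: eventually_sequentially)
    with assms(1)[of n] show ?thesis by linarith
  qed
  have bdd: "bdd_below ?C" using l by (rule bdd_belowI)
  show "l \<le> real_limsup f" unfolding real_limsup_def using u l by (intro cInf_greatest) auto
  show "real_limsup f \<le> u" unfolding real_limsup_def using u bdd by (intro cInf_lower)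
  show "\<forall>\<^sub>F n in sequentially. f n < real_limsup f + e" if "e > 0"
  proof -
    have "\<exists>c\<in>?C. c < real_limsup f + e"
      using u bdd that unfolding real_limsup_def
      by (intro iffD1[OF cInf_less_iff]) auto
    then obtain c where "\<forall>\<^sub>F n in sequentially. f n \<le> c" "c < real_limsup f + e" by auto
    thus ?thesis by (auto elim: eventually_mono)
  qed
  show "\<exists>\<^sub>F n in sequentially. f n > real_limsup f - e" if "e > 0"
  proof (rule ccontr)
    assume "\<not> ?thesis"
    hence "real_limsup f - e \<in> ?C" by (simp add: frequently_def not_less)
    hence "real_limsup f \<le> real_limsup f - e"
      using bdd unfolding real_limsup_def by (intro cInf_lower) auto
    with that show False by simp
  qed
qed

lemma real_limsup_eqI:
  assumes "\<And>n. l \<le> f n" "\<And>n. f n \<le> u"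
    and ev: "\<And>e. e > 0 \<Longrightarrow> \<forall>\<^sub>F n in sequentially. f n < x + e"
    and fr: "\<And>e. e > 0 \<Longrightarrow> \<exists>\<^sub>F n in sequentially. f n > x - e"
  shows "real_limsup f = x"
proof (rule ccontr)
  assume "real_limsup f \<noteq> x"
  define e where "e = \<bar>real_limsup f - x\<bar> / 2"
  have e: "e > 0" using \<open>real_limsup f \<noteq> x\<close> by (simp add: e_def)
  have "\<exists>\<^sub>F n in sequentially. f n > real_limsup f - e \<and> f n < x + e"
    by (intro frequently_eventually_frequently real_limsup_frequently[OF assms(1,2) e] ev[OF e])
  then obtain n where 1: "f n < x + e" "f n > real_limsup f - e"
    by (metis (mono_tags, lifting) frequently_ex)
  have "\<exists>\<^sub>F n in sequentially. f n > x - e \<and> f n < real_limsup f + e"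
    by (intro frequently_eventually_frequently fr[OF e] real_limsup_eventually[OF assms(1,2) e])
  then obtain n' where 2: "f n' < real_limsup f + e" "f n' > x - e"
    by (metis (mono_tags, lifting) frequently_ex)
  from 1 2 show False unfolding e_def by (auto simp: abs_if field_simps split: if_splits)
qed

lemma real_limsup_mono:
  assumes "\<And>n. l \<le> f n" "\<And>n. f n \<le> g n" "\<And>n. g n \<le> u"
  shows "real_limsup f \<le> real_limsup g"
proof (rule field_le_epsilon)
  fix e :: real assume e: "e > 0"
  have 1: "l \<le> g n" "f n \<le> u" for n using assms order_trans by blast+
  have "\<exists>\<^sub>F n in sequentially. f n > real_limsup f - e/2"
    using assms 1 e by (intro real_limsup_frequently[of l _ u]) auto
  moreover have "\<forall>\<^sub>F n in sequentially. g n < real_limsup g + e/2"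
    using assms 1 e by (intro real_limsup_eventually[of l _ u]) auto
  ultimately have "\<exists>\<^sub>F n in sequentially. f n > real_limsup f - e/2 \<and> g n < real_limsup g + e/2"
    by (rule frequently_eventually_frequently)
  then obtain n where "f n > real_limsup f - e/2" "g n < real_limsup g + e/2"
    by (metis (mono_tags, lifting) frequently_ex)
  with assms(2)[of n] show "real_limsup f \<le> real_limsup g + e" by (auto simp: field_simps)
qed

lemma real_limsup_add_le:
  assumes "\<And>n. l \<le> f n" "\<And>n. f n \<le> u" "\<And>n. l \<le> g n" "\<And>n. g n \<le> u"
  shows "real_limsup (\<lambda>n. f n + g n) \<le> real_limsup f + real_limsup g"
proof (rule field_le_epsilon)
  fix e :: real assume e: "e > 0"
  have 1: "l + l \<le> f n + g n" "f n + g n \<le> u + u" for n using assms add_mono by blast+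
  have "\<exists>\<^sub>F n in sequentially. f n + g n > real_limsup (\<lambda>n. f n + g n) - e/3"
    using 1 e by (intro real_limsup_frequently[of "l+l" _ "u+u"]) auto
  moreover have "\<forall>\<^sub>F n in sequentially. f n < real_limsup f + e/3 \<and> g n < real_limsup g + e/3"
    using assms e by (intro eventually_conj real_limsup_eventually[of l _ u]) auto
  ultimately have "\<exists>\<^sub>F n in sequentially. f n + g n > real_limsup (\<lambda>n. f n + g n) - e/3 \<and>
      f n < real_limsup f + e/3 \<and> g n < real_limsup g + e/3"
    by (rule frequently_eventually_frequently)
  then obtain n where "f n + g n > real_limsup (\<lambda>n. f n + g n) - e/3"
      "f n < real_limsup f + e/3" "g n < real_limsup g + e/3"
    by (metis (mono_tags, lifting) frequently_ex)
  thus "real_limsup (\<lambda>n. f n + g n) \<le> real_limsup f + real_limsup g + e" by (auto simp: field_simps)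
qed

lemma real_limsup_cmult:
  assumes "\<And>n. l \<le> f n" "\<And>n. f n \<le> u" "c > 0"
  shows "real_limsup (\<lambda>n. c * f n) = c * real_limsup f"
proof (rule real_limsup_eqI[of "c*l" _ "c*u"])
  fix e :: real assume "e > 0"
  hence e: "e / c > 0" using assms by simp
  from real_limsup_eventually[OF assms(1,2) e] show "\<forall>\<^sub>F n in sequentially. c * f n < c * real_limsup f + e"
    by (rule eventually_mono) (use assms in \<open>simp add: field_simps\<close>)
  from real_limsup_frequently[OF assms(1,2) e] show "\<exists>\<^sub>F n in sequentially. c * f n > c * real_limsup f - e"
    by (rule frequently_elim1) (use assms in \<open>simp add: field_simps\<close>)
qed (use assms in auto)

lemma real_limsup_Suc: "real_limsup (\<lambda>n. f (Suc n)) = real_limsup f"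
  unfolding real_limsup_def by (simp add: eventually_sequentially_Suc[of "\<lambda>n. f n \<le> _"])

text \<open>A limsup commutes with the maximum of two sequences, a liminf does not. This is why
  \<open>barabanov\<close> is a limsup: the recursion \<open>peak_Suc\<close> becomes the exact
  equation \<open>barabanov_max\<close>.\<close>

lemma real_limsup_max:
  assumes "\<And>n. l \<le> f n" "\<And>n. f n \<le> u" "\<And>n. l \<le> g n" "\<And>n. g n \<le> u"
  shows "real_limsup (\<lambda>n. max (f n) (g n)) = max (real_limsup f) (real_limsup g)"
proof (rule antisym)
  have 1: "l \<le> max (f n) (g n)" "max (f n) (g n) \<le> u" for n
    using assms(1)[of n] assms(2)[of n] assms(4)[of n] by auto
  show "max (real_limsup f) (real_limsup g) \<le> real_limsup (\<lambda>n. max (f n) (g n))"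
    by (intro max.boundedI real_limsup_mono[of l _ _ u]) (use assms 1 in auto)
  show "real_limsup (\<lambda>n. max (f n) (g n)) \<le> max (real_limsup f) (real_limsup g)"
  proof (rule field_le_epsilon)
    fix e :: real assume e: "e > 0"
    have "\<exists>\<^sub>F n in sequentially. max (f n) (g n) > real_limsup (\<lambda>n. max (f n) (g n)) - e/2"
      using 1 e by (intro real_limsup_frequently[of l _ u]) auto
    moreover have "\<forall>\<^sub>F n in sequentially. f n < real_limsup f + e/2 \<and> g n < real_limsup g + e/2"
      using assms e by (intro eventually_conj real_limsup_eventually[of l _ u]) auto
    ultimately have "\<exists>\<^sub>F n in sequentially. max (f n) (g n) > real_limsup (\<lambda>n. max (f n) (g n)) - e/2 \<and>
        f n < real_limsup f + e/2 \<and> g n < real_limsup g + e/2"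
      by (rule frequently_eventually_frequently)
    then obtain n where "max (f n) (g n) > real_limsup (\<lambda>n. max (f n) (g n)) - e/2"
        "f n < real_limsup f + e/2" "g n < real_limsup g + e/2"
      by (metis (mono_tags, lifting) frequently_ex)
    thus "real_limsup (\<lambda>n. max (f n) (g n)) \<le> max (real_limsup f) (real_limsup g) + e"
      by (auto simp: field_simps max_def split: if_splits)
  qed
qed

section \<open>Growth and a Barabanov function of a pair of 2 by 2 matrices\<close>

definition act :: "real \<Rightarrow> bool \<Rightarrow> real \<times> real \<Rightarrow> real \<times> real" where
  "act a b v = (if b then (a * (2 * fst v + snd v), a * (3 * fst v + 2 * snd v))
     else (2 * fst v + 3 * snd v, fst v + 2 * snd v))"

definition orb :: "real \<Rightarrow> bool list \<Rightarrow> real \<times> real \<Rightarrow> real \<times> real" where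
  "orb a w v = fold (act a) w v"

definition mass :: "real \<times> real \<Rightarrow> real" where
  "mass v = fst v + snd v"

definition quad :: "(real \<times> real) set" where
  "quad = {v. 0 \<le> fst v \<and> 0 \<le> snd v}"

definition det2 :: "real \<times> real \<Rightarrow> real \<times> real \<Rightarrow> real" where
  "det2 u v = fst u * snd v - snd u * fst v"

text \<open>The sum of the four entries of the matrix product along \<open>w\<close>; for
  \<open>a > 0\<close> these are nonnegative, so it is comparable to any norm.\<close>

definition weight :: "real \<Rightarrow> bool list \<Rightarrow> real" where
  "weight a w = mass (orb a w (1, 1))"

definition peak :: "real \<Rightarrow> nat \<Rightarrow> real \<times> real \<Rightarrow> real" where
  "peak a n v = Max ((\<lambda>w. mass (orb a w v)) ` {w. length w = n})"

text \<open>The joint spectral radius of the pair, in the infimum form that Fekete's lemma gives for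
  a submultiplicative sequence; the exponential makes positivity immediate.\<close>

definition growth :: "real \<Rightarrow> real" where
  "growth a = exp (INF k\<in>{1::nat..}. ln (peak a k (1, 1)) / k)"

definition barabanov :: "real \<Rightarrow> real \<times> real \<Rightarrow> real" where
  "barabanov a v = real_limsup (\<lambda>n. peak a n v / growth a ^ n)"

lemma orb_simps [simp]:
  "orb a [] v = v" "orb a (b # w) v = orb a w (act a b v)"
  "orb a (u @ w) v = orb a w (orb a u v)"
  by (simp_all add: orb_def)

lemma act_add: "act a b (u + v) = act a b u + act a b v"
  by (simp add: act_def algebra_simps)

lemma act_scale: "act a b (c *\<^sub>R v) = c *\<^sub>R act a b v"
  by (simp add: act_def algebra_simps)

lemma orb_add: "orb a w (u + v) = orb a w u + orb a w v"
  by (induction w arbitrary: u v) (simp_all add: act_add)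

lemma orb_scale: "orb a w (c *\<^sub>R v) = c *\<^sub>R orb a w v"
  by (induction w arbitrary: v) (simp_all add: act_scale)

lemma mass_add: "mass (u + v) = mass u + mass v"
  by (simp add: mass_def)

lemma mass_scale: "mass (c *\<^sub>R v) = c * mass v"
  by (simp add: mass_def algebra_simps)

lemma mass_nonneg: "v \<in> quad \<Longrightarrow> 0 \<le> mass v"
  by (simp add: mass_def quad_def)

lemma det2_act: "det2 (act a b u) (act a b v) = (if b then a\<^sup>2 else 1) * det2 u v"
  by (simp add: det2_def act_def algebra_simps power2_eq_square)

lemma ones_quad [simp]: "(1, 1) \<in> quad" "mass (1, 1) = 2"
  by (simp_all add: quad_def mass_def)

lemma quad_add: "u \<in> quad \<Longrightarrow> v \<in> quad \<Longrightarrow> u + v \<in> quad"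
  by (simp add: quad_def)

lemma quad_scale: "v \<in> quad \<Longrightarrow> 0 \<le> c \<Longrightarrow> c *\<^sub>R v \<in> quad"
  by (simp add: quad_def)

lemma finite_bool_lists [simp]: "finite {w :: bool list. length w = n}"
  using finite_lists_length_eq[of "UNIV :: bool set" n] by simp

context
  fixes a :: real
  assumes a: "a > 0"
begin

lemma act_quad: "v \<in> quad \<Longrightarrow> act a b v \<in> quad"
  using a by (simp add: act_def quad_def)

lemma orb_quad: "v \<in> quad \<Longrightarrow> orb a w v \<in> quad"
  by (induction w arbitrary: v) (simp_all add: act_quad)

lemma mass_act_pos: "v \<in> quad \<Longrightarrow> mass v > 0 \<Longrightarrow> mass (act a b v) > 0"
proof -
  assume v: "v \<in> quad" "mass v > 0"
  have "mass (act a b v) \<ge> (if b then a else 1) * (3 * mass v)"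
    using v a by (auto simp: act_def mass_def quad_def algebra_simps)
  moreover have "(if b then a else 1) * (3 * mass v) > 0" using v a by simp
  ultimately show ?thesis by linarith
qed

lemma mass_orb_pos: "v \<in> quad \<Longrightarrow> mass v > 0 \<Longrightarrow> mass (orb a w v) > 0"
  by (induction w arbitrary: v) (simp_all add: act_quad mass_act_pos)

lemma weight_pos: "weight a w > 0"
  unfolding weight_def by (rule mass_orb_pos) simp_all

lemma mass_orb_mono:
  assumes "v - u \<in> quad"
  shows "mass (orb a w u) \<le> mass (orb a w v)"
proof -
  have "mass (orb a w v) = mass (orb a w u) + mass (orb a w (v - u))"
    by (metis add_diff_cancel_left' diff_add_cancel add.commute mass_add orb_add)
  thus ?thesis using mass_nonneg[OF orb_quad[OF assms, of w]] by simp
qed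

lemma mass_orb_le: 
  assumes "v \<in> quad" shows "mass (orb a w v) \<le> mass v * weight a w"
proof -
  have "mass v *\<^sub>R (1, 1) - v \<in> quad" using assms by (simp add: quad_def mass_def)
  from mass_orb_mono[OF this, of w] show ?thesis
    by (simp only: orb_scale mass_scale weight_def)
qed

text \<open>One letter already mixes: with \<open>c = 1\<close> or \<open>c = a\<close>, all entries
  of its matrix are at least \<open>c\<close> and all row sums at most \<open>5 * c\<close>. So the
  image of \<open>v\<close> dominates \<open>c * mass v\<close> times \<open>(1, 1)\<close>, while
  the image of \<open>(1, 1)\<close> lies below \<open>5 * c\<close> times \<open>(1, 1)\<close>.
  This is the origin of the constants 5.\<close>

lemma mass_orb_ge:
  assumes v: "v \<in> quad" shows "mass v * weight a w \<le> 5 * mass (orb a w v)"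
proof (cases w)
  case Nil
  thus ?thesis using mass_nonneg[OF v] by (simp add: weight_def)
next
  case (Cons b u)
  define c where "c = (if b then a else 1)"
  have c: "c > 0" using a by (simp add: c_def)
  have m: "mass v \<ge> 0" by (rule mass_nonneg[OF v])
  have "(5 * c) *\<^sub>R (1, 1) - act a b (1, 1) \<in> quad"
    using a by (simp add: quad_def act_def c_def)
  from mass_orb_mono[OF this, of u] have "weight a w \<le> 5 * c * weight a u"
    by (simp only: orb_scale mass_scale weight_def Cons orb_simps)
  hence "mass v * weight a w \<le> mass v * (5 * c * weight a u)" by (intro mult_left_mono m)
  also have "\<dots> = 5 * mass (orb a u ((c * mass v) *\<^sub>R (1, 1)))"
    by (simp only: orb_scale mass_scale weight_def) simp
  also have "act a b v - (c * mass v) *\<^sub>R (1, 1) \<in> quad"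
    using a v by (auto simp: quad_def act_def c_def mass_def algebra_simps)
  hence "mass (orb a u ((c * mass v) *\<^sub>R (1, 1))) \<le> mass (orb a u (act a b v))"
    by (rule mass_orb_mono)
  finally show ?thesis by (simp add: Cons)
qed

lemma weight_append_le: "weight a (u @ w) \<le> weight a u * weight a w"
  using mass_orb_le[OF orb_quad, of "(1,1)" w u] by (simp add: weight_def)

lemma weight_append_ge: "weight a u * weight a w \<le> 5 * weight a (u @ w)"
  using mass_orb_ge[OF orb_quad, of "(1,1)" u w] by (simp add: weight_def)

lemma peak_ge: "length w = n \<Longrightarrow> mass (orb a w v) \<le> peak a n v"
  unfolding peak_def by (intro Max_ge) auto

lemma peak_attained: "\<exists>w. length w = n \<and> peak a n v = mass (orb a w v)"
proof -
  have "peak a n v \<in> (\<lambda>w. mass (orb a w v)) ` {w. length w = n}"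
    unfolding peak_def by (intro Max_in) (auto intro: exI[of _ "replicate n True"])
  thus ?thesis by auto
qed

lemma peak_0 [simp]: "peak a 0 v = mass v"
  by (simp add: peak_def)

lemma peak_Suc: "peak a (Suc n) v = max (peak a n (act a True v)) (peak a n (act a False v))"
proof (rule antisym)
  obtain w where w: "length w = Suc n" "peak a (Suc n) v = mass (orb a w v)"
    using peak_attained by blast
  then obtain b u where "w = b # u" "length u = n" by (cases w) auto
  thus "peak a (Suc n) v \<le> max (peak a n (act a True v)) (peak a n (act a False v))"
    using w peak_ge[of u n "act a b v"] by (cases b) auto
  have "peak a n (act a b v) \<le> peak a (Suc n) v" for b
  proof -
    obtain u where "length u = n" "peak a n (act a b v) = mass (orb a u (act a b v))"
      using peak_attained by blast
    thus ?thesis using peak_ge[of "b # u" "Suc n" v] by simp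
  qed
  thus "max (peak a n (act a True v)) (peak a n (act a False v)) \<le> peak a (Suc n) v" by simp
qed

lemma weight_le_peak: "weight a w \<le> peak a (length w) (1, 1)"
  unfolding weight_def by (rule peak_ge) simp

lemma peak_ones_attained: "\<exists>w. length w = n \<and> peak a n (1, 1) = weight a w"
  unfolding weight_def by (rule peak_attained)

lemma peak_ones_pos: "peak a n (1, 1) > 0"
  using weight_pos peak_ones_attained[of n] by metis

lemma peak_add_le: "peak a (m + n) (1, 1) \<le> peak a m (1, 1) * peak a n (1, 1)"
proof -
  obtain w where w: "length w = m + n" "peak a (m + n) (1, 1) = weight a w"
    using peak_ones_attained by blast
  have "weight a w = weight a (take m w @ drop m w)" by simp
  also have "\<dots> \<le> weight a (take m w) * weight a (drop m w)" by (rule weight_append_le)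
  also have "\<dots> \<le> peak a m (1, 1) * peak a n (1, 1)"
    using weight_le_peak[of "take m w"] weight_le_peak[of "drop m w"] w
    by (intro mult_mono) (auto intro: less_imp_le[OF weight_pos] less_imp_le[OF peak_ones_pos])
  finally show ?thesis using w by simp
qed

lemma peak_add_ge: "peak a m (1, 1) * peak a n (1, 1) \<le> 5 * peak a (m + n) (1, 1)"
proof -
  obtain u w where "length u = m" "peak a m (1, 1) = weight a u"
     "length w = n" "peak a n (1, 1) = weight a w"
    using peak_ones_attained by metis
  thus ?thesis using weight_append_ge[of u w] weight_le_peak[of "u @ w"] by simp
qed

lemma peak_mult_le: "k > 0 \<Longrightarrow> peak a (n * k) (1, 1) \<le> peak a n (1, 1) ^ k"
proof (induction k)
  case (Suc k)
  show ?case
  proof (cases "k = 0")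
    case False
    have "peak a (n * Suc k) (1, 1) \<le> peak a n (1, 1) * peak a (n * k) (1, 1)"
      using peak_add_le[of n "n * k"] by simp
    also have "\<dots> \<le> peak a n (1, 1) * peak a n (1, 1) ^ k"
      using Suc False by (intro mult_left_mono less_imp_le[OF peak_ones_pos]) auto
    finally show ?thesis by simp
  qed simp
qed simp

lemma peak_mult_ge: "peak a n (1, 1) ^ k \<le> 5 ^ k * peak a (n * k) (1, 1)"
proof (induction k)
  case (Suc k)
  have "peak a n (1, 1) ^ Suc k \<le> peak a n (1, 1) * (5 ^ k * peak a (n * k) (1, 1))"
    using mult_left_mono[OF Suc less_imp_le[OF peak_ones_pos[of n]]] by simp
  also have "\<dots> = 5 ^ k * (peak a n (1, 1) * peak a (n * k) (1, 1))" by simp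
  also have "\<dots> \<le> 5 ^ k * (5 * peak a (n * Suc k) (1, 1))"
    using peak_add_ge[of n "n * k"] by (intro mult_left_mono) auto
  finally show ?case by simp
qed simp

text \<open>Words of length \<open>n * k\<close> are read as \<open>k\<close> blocks of length
  \<open>n\<close> and as \<open>n\<close> blocks of length \<open>k\<close>. The result bounds the
  infimum in \<open>growth\<close> from below.\<close>

lemma ln_peak_compare:
  assumes "n \<ge> 1" "k \<ge> (1::nat)"
  shows "(ln (peak a n (1, 1)) - ln 5) / n \<le> ln (peak a k (1, 1)) / k"
proof -
  have "peak a n (1, 1) ^ k \<le> 5 ^ k * peak a (n * k) (1, 1)" by (rule peak_mult_ge)
  also have "\<dots> \<le> 5 ^ k * peak a k (1, 1) ^ n"
    using peak_mult_le[of n k] assms by (intro mult_left_mono) (auto simp: mult.commute)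
  finally have "ln (peak a n (1, 1) ^ k) \<le> ln (5 ^ k * peak a k (1, 1) ^ n)"
    using peak_ones_pos by (subst ln_le_cancel_iff) auto
  also have "\<dots> = k * ln 5 + n * ln (peak a k (1, 1))"
    using peak_ones_pos[of k] by (subst ln_mult) (auto simp: ln_realpow)
  finally have "k * ln (peak a n (1, 1)) \<le> k * ln 5 + n * ln (peak a k (1, 1))"
    using peak_ones_pos[of n] by (simp add: ln_realpow)
  thus ?thesis using assms by (simp add: field_simps)
qed

text \<open>The infimum lies at most \<open>ln 5 / n\<close> below the \<open>n\<close>-th term,
  because \<open>peak\<close> is multiplicative up to the factor 5. So no subexponential factor
  remains, and for nonzero \<open>v\<close> in \<open>quad\<close> the quotients defining
  \<open>barabanov\<close> stay bounded and away from 0.\<close>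

lemma growth_bounds:
  shows "growth a ^ n \<le> peak a n (1, 1)" and "peak a n (1, 1) \<le> 5 * growth a ^ n"
proof -
  let ?f = "\<lambda>k::nat. ln (peak a k (1, 1)) / k"
  have "growth a ^ n \<le> peak a n (1, 1) \<and> peak a n (1, 1) \<le> 5 * growth a ^ n"
  proof (cases "n = 0")
    case False
    have bdd: "bdd_below (?f ` {1..})"
      using ln_peak_compare[of 1] by (intro bdd_belowI[of _ "(ln (peak a 1 (1, 1)) - ln 5) / 1"]) auto
    have 1: "(INF k\<in>{1..}. ?f k) \<le> ?f n"
      using False by (intro cINF_lower bdd) auto
    have 2: "(ln (peak a n (1, 1)) - ln 5) / n \<le> (INF k\<in>{1..}. ?f k)"
      using False ln_peak_compare[of n] by (intro cINF_greatest) auto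
    define g where "g = (INF k\<in>{1..}. ?f k)"
    have g: "growth a ^ n = exp (n * g)"
      by (simp add: growth_def g_def exp_of_nat_mult)
    have "n * g \<le> ln (peak a n (1, 1))" "ln (peak a n (1, 1)) \<le> ln 5 + n * g"
      using 1 2 False unfolding g_def[symmetric] by (auto simp: field_simps)
    hence "exp (n * g) \<le> exp (ln (peak a n (1, 1)))" "exp (ln (peak a n (1, 1))) \<le> exp (ln 5 + n * g)"
      by simp_all
    thus ?thesis using peak_ones_pos[of n] by (simp add: g exp_add)
  qed simp
  thus "growth a ^ n \<le> peak a n (1, 1)" "peak a n (1, 1) \<le> 5 * growth a ^ n" by auto
qed

lemma growth_pos: "growth a > 0"
  by (simp add: growth_def)

lemma weight_le_growth: "weight a w \<le> 5 * growth a ^ length w"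
  using weight_le_peak growth_bounds(2) order_trans by blast

lemma peak_le: assumes "v \<in> quad" shows "peak a n v \<le> mass v * peak a n (1, 1)"
proof -
  obtain w where w: "length w = n" "peak a n v = mass (orb a w v)" using peak_attained by blast
  have "mass (orb a w v) \<le> mass v * weight a w" by (rule mass_orb_le[OF assms])
  also have "\<dots> \<le> mass v * peak a n (1, 1)"
    using weight_le_peak[of w] w by (intro mult_left_mono mass_nonneg assms) auto
  finally show ?thesis using w by simp
qed

lemma peak_ge_ones: assumes "v \<in> quad" shows "mass v * peak a n (1, 1) \<le> 5 * peak a n v"
proof -
  obtain w where w: "length w = n" "peak a n (1, 1) = weight a w" using peak_ones_attained by blast
  show ?thesis using mass_orb_ge[OF assms, of w] peak_ge[OF w(1), of v] w by simp
qed

lemma peak_growth_bounds: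
  assumes "v \<in> quad"
  shows "mass v / 5 \<le> peak a n v / growth a ^ n" "peak a n v / growth a ^ n \<le> 5 * mass v"
proof -
  have g: "growth a ^ n > 0" using growth_pos by simp
  have "mass v * growth a ^ n \<le> mass v * peak a n (1, 1)"
    using growth_bounds(1) mass_nonneg[OF assms] by (rule mult_left_mono)
  thus "mass v / 5 \<le> peak a n v / growth a ^ n" 
    using peak_ge_ones[OF assms, of n] g by (simp add: field_simps)
  have "mass v * peak a n (1, 1) \<le> mass v * (5 * growth a ^ n)"
    using growth_bounds(2) mass_nonneg[OF assms] by (rule mult_left_mono)
  thus "peak a n v / growth a ^ n \<le> 5 * mass v" 
    using peak_le[OF assms, of n] g by (simp add: field_simps)
qed

lemma barabanov_bounds:
  assumes "v \<in> quad"
  shows "mass v / 5 \<le> barabanov a v" "barabanov a v \<le> 5 * mass v"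
  unfolding barabanov_def
  using real_limsup_ge[OF peak_growth_bounds[OF assms]] real_limsup_le[OF peak_growth_bounds[OF assms]]
  by auto

lemma barabanov_pos: "v \<in> quad \<Longrightarrow> mass v > 0 \<Longrightarrow> barabanov a v > 0"
  using barabanov_bounds(1)[of v] by simp

lemma barabanov_max:
  assumes "v \<in> quad"
  shows "growth a * barabanov a v = max (barabanov a (act a True v)) (barabanov a (act a False v))"
proof -
  let ?f = "\<lambda>n. peak a n v / growth a ^ n"
  let ?t = "\<lambda>b n. peak a n (act a b v) / growth a ^ n"
  define u where "u = 5 * mass (act a True v) + 5 * mass (act a False v)"
  have 1: "0 \<le> ?t b n" "?t b n \<le> u" for b n
    using peak_growth_bounds[OF act_quad[OF assms, of b], of n]
      mass_nonneg[OF act_quad[OF assms, of True]] mass_nonneg[OF act_quad[OF assms, of False]]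
    by (cases b; simp add: u_def; linarith)+
  have "growth a * real_limsup ?f = real_limsup (\<lambda>n. growth a * ?f n)"
    by (rule real_limsup_cmult[symmetric, OF peak_growth_bounds[OF assms] growth_pos])
  also have "\<dots> = real_limsup (\<lambda>n. growth a * ?f (Suc n))"
    by (rule real_limsup_Suc[symmetric])
  also have "(\<lambda>n. growth a * ?f (Suc n)) = (\<lambda>n. max (?t True n) (?t False n))"
    using growth_pos by (auto simp: peak_Suc fun_eq_iff max_def divide_right_mono field_simps)
  also have "real_limsup \<dots> = max (real_limsup (?t True)) (real_limsup (?t False))"
    by (rule real_limsup_max[OF 1 1])
  finally show ?thesis by (simp add: barabanov_def)
qed

lemma barabanov_act_le: "v \<in> quad \<Longrightarrow> barabanov a (act a b v) \<le> growth a * barabanov a v"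
  by (cases b) (simp_all add: barabanov_max)

lemma barabanov_act_eq: "v \<in> quad \<Longrightarrow> \<exists>b. barabanov a (act a b v) = growth a * barabanov a v"
  by (metis barabanov_max max_def)

lemma barabanov_orb_le:
  "v \<in> quad \<Longrightarrow> barabanov a (orb a w v) \<le> growth a ^ length w * barabanov a v"
proof (induction w arbitrary: v)
  case (Cons b w)
  have "barabanov a (orb a (b # w) v) \<le> growth a ^ length w * barabanov a (act a b v)"
    using Cons act_quad by simp
  also have "\<dots> \<le> growth a ^ length w * (growth a * barabanov a v)"
    using Cons growth_pos by (intro mult_left_mono barabanov_act_le) auto
  finally show ?case by (simp add: mult_ac)
qed simp

lemma peak_mono: 
  assumes "v - u \<in> quad" shows "peak a n u \<le> peak a n v"
  using mass_orb_mono[OF assms] peak_attained[of n u] peak_ge[of _ n v] by (metis order_trans)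

lemma peak_scale: assumes "c \<ge> 0" shows "peak a n (c *\<^sub>R v) = c * peak a n v"
proof (rule antisym)
  show "peak a n (c *\<^sub>R v) \<le> c * peak a n v"
    using peak_attained[of n "c *\<^sub>R v"] peak_ge[of _ n v] assms
    by (auto simp: orb_scale mass_scale intro!: mult_left_mono)
  show "c * peak a n v \<le> peak a n (c *\<^sub>R v)"
    using peak_attained[of n v] peak_ge[of _ n "c *\<^sub>R v"]
    by (auto simp: orb_scale mass_scale)
qed

lemma peak_subadd: "peak a n (u + v) \<le> peak a n u + peak a n v"
  using peak_attained[of n "u + v"] peak_ge[of _ n v] peak_ge[of _ n u]
  by (auto simp: orb_add mass_add intro!: add_mono)

lemma barabanov_mono:
  assumes "v - u \<in> quad" "u \<in> quad" shows "barabanov a u \<le> barabanov a v"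
proof -
  have v: "v \<in> quad" using quad_add[OF assms] by simp
  show ?thesis unfolding barabanov_def
  proof (rule real_limsup_mono)
    show "0 \<le> peak a n u / growth a ^ n" for n
      using peak_growth_bounds(1)[OF assms(2), of n] mass_nonneg[OF assms(2)] by linarith
    show "peak a n u / growth a ^ n \<le> peak a n v / growth a ^ n" for n
      using peak_mono[OF assms(1)] growth_pos by (simp add: divide_right_mono)
  qed (rule peak_growth_bounds(2)[OF v])
qed

lemma barabanov_scale:
  assumes "c > 0" "v \<in> quad" shows "barabanov a (c *\<^sub>R v) = c * barabanov a v"
  unfolding barabanov_def using assms real_limsup_cmult[OF peak_growth_bounds[OF assms(2)] assms(1)]
  by (simp add: peak_scale)

lemma barabanov_subadd:
  assumes "u \<in> quad" "v \<in> quad" shows "barabanov a (u + v) \<le> barabanov a u + barabanov a v"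
proof -
  have uv: "u + v \<in> quad" using assms by (rule quad_add)
  have nn: "mass u \<ge> 0" "mass v \<ge> 0" using assms mass_nonneg by auto
  define l where "l = 5 * mass u + 5 * mass v"
  have b: "0 \<le> peak a n u / growth a ^ n" "peak a n u / growth a ^ n \<le> l" 
    "0 \<le> peak a n v / growth a ^ n" "peak a n v / growth a ^ n \<le> l" for n
    using peak_growth_bounds[OF assms(1), of n] peak_growth_bounds[OF assms(2), of n] nn
    by (simp_all add: l_def)
  have "barabanov a (u + v) \<le> real_limsup (\<lambda>n. peak a n u / growth a ^ n + peak a n v / growth a ^ n)"
    unfolding barabanov_def
  proof (rule real_limsup_mono)
    show "peak a n (u + v) / growth a ^ n \<le> peak a n u / growth a ^ n + peak a n v / growth a ^ n" for n
      using peak_subadd[of n u v] growth_pos by (simp add: divide_right_mono flip: add_divide_distrib)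
    show "peak a n u / growth a ^ n + peak a n v / growth a ^ n \<le> l + l" for n
      using b add_mono by blast
  qed (rule peak_growth_bounds(1)[OF uv])
  also have "\<dots> \<le> barabanov a u + barabanov a v"
    unfolding barabanov_def by (rule real_limsup_add_le[OF b])
  finally show ?thesis .
qed

end

section \<open>Balanced languages\<close>

abbreviation ones_count :: "bool list \<Rightarrow> nat" where
  "ones_count w \<equiv> count_list w True"

definition factor_closed :: "'a list set \<Rightarrow> bool" where
  "factor_closed L \<longleftrightarrow> (\<forall>u w z. u @ w @ z \<in> L \<longrightarrow> w \<in> L)"

definition crossing_free :: "bool list set \<Rightarrow> bool" where
  "crossing_free L \<longleftrightarrow> (\<forall>w. \<not> (False # w @ [False] \<in> L \<and> True # w @ [True] \<in> L))"

lemma factor_closedD: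
  assumes "factor_closed L" "u @ w @ z \<in> L"
  shows "w \<in> L"
  using assms unfolding factor_closed_def by blast

lemma factor_closed_takeD: "factor_closed L \<Longrightarrow> w \<in> L \<Longrightarrow> take n w \<in> L"
  using factor_closedD[of L "[]" "take n w" "drop n w"] by simp

lemma factor_closed_dropD: "factor_closed L \<Longrightarrow> w \<in> L \<Longrightarrow> drop n w \<in> L"
  using factor_closedD[of L "take n w" "drop n w" "[]"] by simp

text \<open>In a shortest counterexample \<open>u\<close> starts with 1 and \<open>v\<close> with 0.
  At their next difference, 1 against 0 would complete a forbidden pair \<open>1z1\<close>,
  \<open>0z0\<close>; 0 against 1 cancels the initial excess, so that the remaining suffixes form a
  shorter counterexample.\<close>

lemma crossing_free_balanced:
  assumes "factor_closed L" "crossing_free L" "u \<in> L" "v \<in> L" "length u = length v"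
  shows "ones_count u \<le> ones_count v + 1"
  using assms(3-)
proof (induction "length u" arbitrary: u v rule: less_induct)
  case less
  show ?case
  proof (rule ccontr)
    assume c: "\<not> ?thesis"
    then obtain x u' where u: "u = x # u'" by (cases u) auto
    with less.prems obtain y v' where v: "v = y # v'" by (cases v) auto
    have "u' \<in> L" "v' \<in> L"
      using factor_closed_dropD[OF assms(1) less.prems(1), of 1]
        factor_closed_dropD[OF assms(1) less.prems(2), of 1] by (simp_all add: u v)
    hence "ones_count u' \<le> ones_count v' + 1" using less u v by simp
    with c u v have xy: "x" "\<not> y" by (auto split: if_splits)
    have "u' \<noteq> v'" using c u v xy by auto
    moreover have "length u' = length v'" using less.prems u v by simp
    ultimately obtain z p u'' q v'' where pq: "p \<noteq> q" "u' = z @ [p] @ u''" "v' = z @ [q] @ v''"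
      using same_length_different[of u' v'] by blast
    show False
    proof (cases p)
      case True
      have "True # z @ [True] \<in> L" "False # z @ [False] \<in> L"
        using factor_closedD[OF assms(1), of "[]" "True # z @ [True]" u'']
          factor_closedD[OF assms(1), of "[]" "False # z @ [False]" v'']
          less.prems True pq u v xy by simp_all
      thus False using assms(2) by (auto simp: crossing_free_def)
    next
      case False
      have "u'' \<in> L" "v'' \<in> L"
        using factor_closedD[OF assms(1), of "x # z @ [p]" u'' "[]"]
          factor_closedD[OF assms(1), of "y # z @ [q]" v'' "[]"] less.prems pq u v by simp_all
      hence "ones_count u'' \<le> ones_count v'' + 1"
        using less.prems pq u v by (intro less.hyps) simp_all
      thus False using c u v pq xy False by simp
    qed
  qed
qed

lemma balanced_block_count:
  assumes "factor_closed L" "\<And>u v. u \<in> L \<Longrightarrow> v \<in> L \<Longrightarrow> length u = length v \<Longrightarrow> ones_count u \<le> ones_count v + 1"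
    and "w \<in> L" "x \<in> L" "length x = k * length w"
  shows "ones_count x \<le> k * (ones_count w + 1) \<and> k * ones_count w \<le> ones_count x + k"
  using assms(4,5)
proof (induction k arbitrary: x)
  case (Suc k)
  let ?n = "length w"
  have L: "take ?n x \<in> L" "drop ?n x \<in> L"
    using factor_closed_takeD factor_closed_dropD assms(1) Suc.prems by blast+
  have "ones_count x = ones_count (take ?n x) + ones_count (drop ?n x)"
    by (metis append_take_drop_id count_list_append)
  moreover have "ones_count (take ?n x) \<le> ones_count w + 1" "ones_count w \<le> ones_count (take ?n x) + 1"
    using assms(2)[OF L(1) assms(3)] assms(2)[OF assms(3) L(1)] Suc.prems by simp_all
  moreover have "ones_count (drop ?n x) \<le> k * (ones_count w + 1) \<and>
    k * ones_count w \<le> ones_count (drop ?n x) + k"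
    using Suc.IH[OF L(2)] Suc.prems by simp
  ultimately show ?case by simp
qed simp

text \<open>A word of length \<open>length u * length w\<close>, cut into blocks of either length,
  shows that no lower estimate \<open>(ones_count u - 1) / length u\<close> exceeds an upper
  estimate \<open>(ones_count w + 1) / length w\<close>. Any number separating the two families
  works; the infimum of the upper ones is taken.\<close>

lemma balanced_frequency:
  assumes "factor_closed L" and bal: "\<And>u v. u \<in> L \<Longrightarrow> v \<in> L \<Longrightarrow> length u = length v \<Longrightarrow> ones_count u \<le> ones_count v + 1"
    and ex: "\<And>n. \<exists>w\<in>L. length w = n"
  shows "\<exists>g::real. \<forall>w\<in>L. \<bar>real (ones_count w) - g * length w\<bar> \<le> 1"
proof -
  let ?f = "\<lambda>w. (real (ones_count w) + 1) / length w"
  let ?M = "L - {[]}"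
  have cmp: "(real (ones_count u) - 1) / length u \<le> ?f w" if "u \<in> ?M" "w \<in> ?M" for u w
  proof -
    obtain x where x: "x \<in> L" "length x = length u * length w" using ex by blast
    have 1: "ones_count x \<le> length u * (ones_count w + 1)"
      by (rule conjunct1[OF balanced_block_count[OF assms(1) bal]]) (use that x in auto)
    have 2: "length w * ones_count u \<le> ones_count x + length w"
      by (rule conjunct2[OF balanced_block_count[OF assms(1) bal]]) (use that x in auto)
    have "length w * ones_count u \<le> length u * (ones_count w + 1) + length w"
      using 1 2 by linarith
    hence "real (length w * ones_count u) \<le> real (length u * (ones_count w + 1) + length w)"
      by (rule of_nat_mono)
    thus ?thesis using that by (simp add: field_simps)
  qed
  obtain w1 where w1: "w1 \<in> L" "length w1 = 1" using ex by blast
  hence w1': "w1 \<in> ?M" by auto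
  have bdd: "bdd_below (?f ` ?M)" using cmp[OF w1'] by (intro bdd_belowI2)
  define g where "g = (INF w\<in>?M. ?f w)"
  have "\<bar>real (ones_count w) - g * length w\<bar> \<le> 1" if w: "w \<in> L" for w
  proof (cases "w = []")
    case False
    have "g \<le> ?f w" unfolding g_def using w False bdd by (intro cINF_lower) auto
    moreover have "(real (ones_count w) - 1) / length w \<le> g"
      unfolding g_def using w1' w False by (intro cINF_greatest cmp) auto
    ultimately show ?thesis using False by (simp add: field_simps abs_le_iff)
  qed simp
  thus ?thesis by blast
qed

text \<open>The count grows by the number of words that can be continued by both letters. Two such
  words of equal length would have a longest common suffix, preceded by different letters
  \<open>p\<close> and \<open>q\<close>; continuing each word by its own letter gives a forbidden
  pair. So each length adds at most one.\<close>

lemma crossing_free_complexity: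
  assumes "factor_closed L" "crossing_free L" "\<And>k n. map x [k..<k+n] \<in> L"
  shows "card (range (\<lambda>k. map x [k..<k+n])) \<le> n + 1"
proof (induction n)
  case (Suc n)
  let ?F = "\<lambda>n. range (\<lambda>k. map x [k..<k+n])"
  have fin: "finite (?F n)" for n
    by (rule finite_subset[OF _ finite_bool_lists[of n]]) auto
  define E where "E b = {w \<in> ?F n. w @ [b] \<in> ?F (Suc n)}" for b
  have finE: "finite (E b)" for b using fin by (simp add: E_def)
  have "?F (Suc n) \<subseteq> (\<lambda>w. w @ [True]) ` E True \<union> (\<lambda>w. w @ [False]) ` E False"
  proof
    fix u assume "u \<in> ?F (Suc n)"
    then obtain k where k: "u = map x [k..<k + Suc n]" by blast
    hence "u = map x [k..<k+n] @ [x (k + n)]" by simp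
    hence "map x [k..<k+n] \<in> E (x (k + n))" using k by (auto simp: E_def)
    thus "u \<in> (\<lambda>w. w @ [True]) ` E True \<union> (\<lambda>w. w @ [False]) ` E False"
      using k by (cases "x (k+n)") auto
  qed
  hence "card (?F (Suc n)) \<le> card ((\<lambda>w. w @ [True]) ` E True \<union> (\<lambda>w. w @ [False]) ` E False)"
    by (intro card_mono) (auto simp: finE)
  also have "\<dots> \<le> card (E True) + card (E False)"
    by (intro order_trans[OF card_Un_le] add_mono card_image_le finE)
  also have "\<dots> = card (E True \<union> E False) + card (E True \<inter> E False)"
    by (rule card_Un_Int[OF finE finE])
  also have "card (E True \<union> E False) \<le> card (?F n)"
    by (intro card_mono fin) (auto simp: E_def)
  also have "card (E True \<inter> E False) \<le> 1"
  proof (rule ccontr)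
    assume "\<not> ?thesis"
    then obtain u v where uv: "u \<in> E True \<inter> E False" "v \<in> E True \<inter> E False" "u \<noteq> v"
      by (metis card_le_Suc0_iff_eq One_nat_def finE finite_Int)
    have "length u = length v" using uv by (auto simp: E_def)
    hence "rev u \<noteq> rev v" "length (rev u) = length (rev v)" using uv by auto
    then obtain z p u' q v' where pq: "p \<noteq> q" "rev u = z @ [p] @ u'" "rev v = z @ [q] @ v'"
      using same_length_different[of "rev u" "rev v"] by blast
    have *: "u = rev u' @ [p] @ rev z" "v = rev v' @ [q] @ rev z"
      using arg_cong[OF pq(2), of rev] arg_cong[OF pq(3), of rev] by simp_all
    have EL: "w @ [b] \<in> L" if "w \<in> E b" for w b
    proof -
      from that obtain k where "w @ [b] = map x [k..<k + Suc n]" unfolding E_def by blast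
      thus ?thesis using assms(3)[of k "Suc n"] by simp
    qed
    have 1: "u @ [p] \<in> L" "v @ [q] \<in> L"
      using EL[of u p] EL[of v q] uv(1,2) by (cases p; cases q; simp)+
    have "p # rev z @ [p] \<in> L" "q # rev z @ [q] \<in> L"
      using factor_closedD[OF assms(1), of "rev u'" "p # rev z @ [p]" "[]"]
        factor_closedD[OF assms(1), of "rev v'" "q # rev z @ [q]" "[]"] 1 by (simp_all add: *)
    thus False using assms(2) pq(1) by (cases p; cases q) (auto simp: crossing_free_def)
  qed
  finally show ?case using Suc by simp
qed simp

section \<open>Optimal words are balanced\<close>

fun calibrated :: "real \<Rightarrow> real \<times> real \<Rightarrow> bool list \<Rightarrow> bool" where
  "calibrated a v [] \<longleftrightarrow> True"
| "calibrated a v (b # w) \<longleftrightarrow>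
     barabanov a (act a b v) = growth a * barabanov a v \<and> calibrated a (act a b v) w"

text \<open>The start vector is left free, so that a factor of a member, started at the vector
  reached before it, is again a member.\<close>

definition lang :: "real \<Rightarrow> bool list set" where
  "lang a = {w. \<exists>v\<in>quad. mass v > 0 \<and> calibrated a v w}"

lemma mass_orb_linear:
  "mass (orb a w v) = fst v * mass (orb a w (1, 0)) + snd v * mass (orb a w (0, 1))"
proof -
  have "v = fst v *\<^sub>R (1, 0) + snd v *\<^sub>R (0, 1)" by (simp add: prod_eq_iff)
  thus ?thesis by (metis mass_add mass_scale orb_add orb_scale)
qed

text \<open>\<open>f u * g v - f v * g u\<close> is \<open>det2 v u\<close> times a determinant
  formed from the two functionals, which expands with the coefficients \<open>4a\<close>,
  \<open>5a\<close>, \<open>3a\<close>, \<open>4a\<close>. All are at least \<open>3a\<close>, so it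
  is at least \<open>3 * a * (c1 + c2) * (d1 + d2)\<close>, and this product in turn controls
  \<open>f v * g u\<close>.\<close>

lemma functional_crossing:
  fixes a c1 c2 d1 d2 :: real
  defines "f \<equiv> \<lambda>v. fst (act a False v) * c1 + snd (act a False v) * c2"
    and "g \<equiv> \<lambda>v. fst (act a True v) * d1 + snd (act a True v) * d2"
  assumes a: "a > 0" and c: "c1 \<ge> 0" "c2 \<ge> 0" "d1 \<ge> 0" "d2 \<ge> 0"
    and v: "v \<in> quad" "mass v > 0" and u: "u \<in> quad" "mass u > 0" and det: "det2 v u \<ge> 0"
  shows "f v * g u * (1 + 3 * a * det2 v u / (mass (act a False v) * mass (act a True u))) \<le> f u * g v"
proof -
  let ?M = "mass (act a False v) * mass (act a True u)"
  have M: "?M > 0" using mass_act_pos[OF a] u v by simp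
  have q: "act a False v \<in> quad" "act a True u \<in> quad" using act_quad[OF a] u v by auto
  have f: "f v \<le> (c1 + c2) * mass (act a False v)" "0 \<le> f v"
    using q c by (auto simp: f_def mass_def quad_def algebra_simps)
  have g: "g u \<le> (d1 + d2) * mass (act a True u)" "0 \<le> g u"
    using q c by (auto simp: g_def mass_def quad_def algebra_simps)
  have "f v * g u \<le> ((c1 + c2) * mass (act a False v)) * ((d1 + d2) * mass (act a True u))"
    by (intro mult_mono) (use f g in auto)
  hence fg: "f v * g u / ?M \<le> (c1 + c2) * (d1 + d2)" using M by (simp add: field_simps)
  have "f u * g v - f v * g u = a * (4*c1*d1 + 5*c1*d2 + 3*c2*d1 + 4*c2*d2) * det2 v u"
    by (simp add: f_def g_def act_def det2_def algebra_simps)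
  moreover have "a * (3 * ((c1 + c2) * (d1 + d2))) * det2 v u \<le> a * (4*c1*d1 + 5*c1*d2 + 3*c2*d1 + 4*c2*d2) * det2 v u"
    by (intro mult_right_mono mult_left_mono) (use a c det in \<open>auto simp: algebra_simps\<close>)
  moreover have "a * 3 * (f v * g u / ?M) * det2 v u \<le> a * 3 * ((c1 + c2) * (d1 + d2)) * det2 v u"
    by (intro mult_right_mono mult_left_mono fg) (use a det in auto)
  ultimately show ?thesis by (simp add: field_simps)
qed

context
  fixes a :: real
  assumes a: "a > 0"
begin

text \<open>Near-optimal functionals \<open>f\<close> after \<open>A\<^sub>0 v\<close> and \<open>g\<close> after \<open>A\<^sub>1 u\<close> satisfy \<open>f v * g u \<ge> f u * g v\<close> up to \<open>e\<close>, whereas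
  the difference of the two sides is the product of two determinants, of which the one of \<open>f\<close> and \<open>g\<close> is
  negative.\<close>

lemma single_crossing:
  assumes v: "v \<in> quad" "mass v > 0" and u: "u \<in> quad" "mass u > 0"
    and cv: "barabanov a (act a False v) = growth a * barabanov a v"
    and cu: "barabanov a (act a True u) = growth a * barabanov a u"
  shows "det2 v u \<le> 0"
proof (rule ccontr)
  assume "\<not> ?thesis"
  hence det: "det2 v u > 0" by simp
  \<comment> \<open>The relative gain depends on \<open>v\<close> and \<open>u\<close> only, whereas
    the words behind the functionals change with \<open>e\<close>; therefore it survives the limit
    \<open>e\<close> to 0.\<close>
  define K where "K = 3 * a * det2 v u / (mass (act a False v) * mass (act a True u))"
  have K: "K > 0" using det a mass_act_pos[OF a] u v by (simp add: K_def)
  define h0 where "h0 = barabanov a (act a False v)"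
  define k1 where "k1 = barabanov a (act a True u)"
  have pos: "h0 > 0" "k1 > 0" unfolding h0_def k1_def
    using barabanov_pos[OF a] act_quad[OF a] mass_act_pos[OF a] u v by auto
  have "(h0 - e) * (k1 - e) * (1 + K) \<le> (h0 + e) * (k1 + e)" if e: "0 < e" "e < min h0 k1" for e
  proof -
    let ?p = "\<lambda>n v. peak a n v / growth a ^ n"
    have gp: "growth a ^ n > 0" for n using growth_pos[OF a] by simp
    have ev: "\<forall>\<^sub>F n in sequentially. ?p n (act a b w) < barabanov a (act a b w) + e" if "w \<in> quad" for b w
      unfolding barabanov_def
      by (rule real_limsup_eventually[OF peak_growth_bounds[OF a act_quad[OF a that]] e(1)])
    have fr: "\<exists>\<^sub>F n in sequentially. ?p n (act a b w) > barabanov a (act a b w) - e" if "w \<in> quad" for b w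
      unfolding barabanov_def
      by (rule real_limsup_frequently[OF peak_growth_bounds[OF a act_quad[OF a that]] e(1)])
    \<comment> \<open>At one common length the limsup is nearly reached at \<open>v\<close>, which
      happens infinitely often, and hardly exceeded at \<open>u\<close>, which holds eventually.
      With the roles exchanged another length \<open>m\<close> may be needed.\<close>
    obtain n where n: "?p n (act a False v) > h0 - e" 
      "?p n (act a False u) < barabanov a (act a False u) + e"
      using frequently_ex[OF frequently_eventually_frequently[OF fr[OF v(1)] ev[OF u(1)]]]
      unfolding h0_def by blast
    obtain m where m: "?p m (act a True u) > k1 - e" 
      "?p m (act a True v) < barabanov a (act a True v) + e"
      using frequently_ex[OF frequently_eventually_frequently[OF fr[OF u(1)] ev[OF v(1)]]]
      unfolding k1_def by blast
    obtain w where w: "length w = n" "peak a n (act a False v) = mass (orb a w (act a False v))"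
      using peak_attained[OF a] by blast
    obtain z where z: "length z = m" "peak a m (act a True u) = mass (orb a z (act a True u))"
      using peak_attained[OF a] by blast
    define f where "f x = mass (orb a w (act a False x)) / growth a ^ n" for x
    define g where "g x = mass (orb a z (act a True x)) / growth a ^ m" for x
    have nn: "mass (orb a w x) \<ge> 0" if "x \<in> quad" for w x
      using mass_nonneg orb_quad[OF a that] by blast
    have ff: "f x = fst (act a False x) * (mass (orb a w (1, 0)) / growth a ^ n)
        + snd (act a False x) * (mass (orb a w (0, 1)) / growth a ^ n)" for x
      unfolding f_def by (subst mass_orb_linear) (simp add: add_divide_distrib)
    have gg: "g x = fst (act a True x) * (mass (orb a z (1, 0)) / growth a ^ m)
        + snd (act a True x) * (mass (orb a z (0, 1)) / growth a ^ m)" for x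
      unfolding g_def by (subst mass_orb_linear) (simp add: add_divide_distrib)
    have "f v * g u * (1 + K) \<le> f u * g v"
      unfolding ff gg K_def
      by (intro functional_crossing a v u less_imp_le[OF det] divide_nonneg_nonneg nn less_imp_le[OF gp])
        (simp_all add: quad_def)
    moreover have "(h0 - e) * (k1 - e) * (1 + K) \<le> f v * g u * (1 + K)"
    proof (intro mult_right_mono mult_mono)
      show "h0 - e \<le> f v" "k1 - e \<le> g u" using n(1) m(1) w z by (simp_all add: f_def g_def)
      thus "0 \<le> f v" using e by linarith
    qed (use e K in auto)
    moreover have "f u * g v \<le> (k1 + e) * (h0 + e)"
    proof (rule mult_mono)
      have "f u \<le> ?p n (act a False u)"
        unfolding f_def using peak_ge[OF a w(1)] gp by (simp add: divide_right_mono less_imp_le)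
      also have "\<dots> \<le> barabanov a (act a False u) + e" using n by simp
      also have "barabanov a (act a False u) \<le> k1"
        unfolding k1_def cu by (rule barabanov_act_le[OF a u(1)])
      finally show "f u \<le> k1 + e" by simp
      have "g v \<le> ?p m (act a True v)"
        unfolding g_def using peak_ge[OF a z(1)] gp by (simp add: divide_right_mono less_imp_le)
      also have "\<dots> \<le> barabanov a (act a True v) + e" using m by simp
      also have "barabanov a (act a True v) \<le> h0"
        unfolding h0_def cv by (rule barabanov_act_le[OF a v(1)])
      finally show "g v \<le> h0 + e" by simp
      show "0 \<le> g v" unfolding g_def using nn act_quad[OF a v(1)] gp
        by (intro divide_nonneg_nonneg) (auto intro: less_imp_le)
    qed (use pos e in auto)
    ultimately show ?thesis by (simp add: mult.commute)
  qed
  hence ev: "\<forall>\<^sub>F e in at_right 0. (h0 - e) * (k1 - e) * (1 + K) \<le> (h0 + e) * (k1 + e)"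
    using pos unfolding eventually_at_right_field by (intro exI[of _ "min h0 k1"]) auto
  have "(h0 - 0) * (k1 - 0) * (1 + K) \<le> (h0 + 0) * (k1 + 0)"
    by (rule tendsto_le[OF _ _ _ ev]; (intro tendsto_intros)?; simp)
  moreover have "h0 * k1 * K > 0" using pos K by simp
  ultimately show False by (simp add: algebra_simps)
qed

lemma calibrated_append:
  "calibrated a v (u @ w) \<longleftrightarrow> calibrated a v u \<and> calibrated a (orb a u v) w"
  by (induction u arbitrary: v) simp_all

lemma lang_factor_closed: "factor_closed (lang a)"
  unfolding factor_closed_def
proof (intro allI impI)
  fix u w z assume "u @ w @ z \<in> lang a"
  then obtain v where v: "v \<in> quad" "mass v > 0" "calibrated a v (u @ w @ z)" by (auto simp: lang_def)
  hence "orb a u v \<in> quad" "mass (orb a u v) > 0" "calibrated a (orb a u v) w"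
    using orb_quad[OF a] mass_orb_pos[OF a] by (auto simp: calibrated_append)
  thus "w \<in> lang a" by (auto simp: lang_def)
qed

text \<open>Both letters have positive determinant, 1 and \<open>a^2\<close>, so no word reverses
  the order of two directions.\<close>

lemma det2_orb: "\<exists>c>0. \<forall>u v. det2 (orb a w u) (orb a w v) = c * det2 u v"
proof (induction w)
  case (Cons b w)
  then obtain c where c: "c > 0" "\<And>u v. det2 (orb a w u) (orb a w v) = c * det2 u v" by blast
  define d where "d = (if b then a\<^sup>2 else 1)"
  have "d > 0" using a by (simp add: d_def)
  hence "c * d > 0" using c by simp
  moreover have "det2 (orb a (b # w) u) (orb a (b # w) v) = (c * d) * det2 u v" for u v
    by (simp add: c(2) det2_act d_def)
  ultimately show ?case by blast
qed (auto intro: exI[of _ 1])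

lemma det2_act_False_True:
  assumes v: "v \<in> quad" "mass v > 0" and u: "u \<in> quad" "mass u > 0"
  shows "det2 (act a False v) (act a True u) > 0"
proof -
  have "det2 (act a False v) (act a True u) =
    a * (mass v * mass u * 3 + (fst v * fst u + 2 * snd v * fst u + snd v * snd u))"
    by (simp add: det2_def act_def mass_def algebra_simps)
  also have "\<dots> > 0"
    using a v u by (intro mult_pos_pos add_pos_nonneg) (auto simp: quad_def)
  finally show ?thesis .
qed

text \<open>The first letters 0 and 1 put the two vectors into separated cones, and the common word
  \<open>w\<close> keeps their order; in that order \<open>single_crossing\<close> forbids 0 to be
  optimal at the first vector and 1 at the second.\<close>

lemma lang_crossing_free: "crossing_free (lang a)"
  unfolding crossing_free_def
proof (intro allI notI, elim conjE)
  fix w assume "False # w @ [False] \<in> lang a" "True # w @ [True] \<in> lang a"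
  then obtain v u where v: "v \<in> quad" "mass v > 0" "calibrated a v (False # w @ [False])"
    and u: "u \<in> quad" "mass u > 0" "calibrated a u (True # w @ [True])" by (auto simp: lang_def)
  define v' where "v' = orb a w (act a False v)"
  define u' where "u' = orb a w (act a True u)"
  have q: "v' \<in> quad" "mass v' > 0" "u' \<in> quad" "mass u' > 0"
    unfolding v'_def u'_def
    using orb_quad[OF a] mass_orb_pos[OF a] act_quad[OF a] mass_act_pos[OF a] u v by auto
  have "det2 v' u' \<le> 0"
    by (rule single_crossing) (use q u v in \<open>auto simp: calibrated_append v'_def u'_def\<close>)
  moreover obtain c where "c > 0" "det2 v' u' = c * det2 (act a False v) (act a True u)"
    unfolding v'_def u'_def using det2_orb[of w] by blast
  ultimately show False using det2_act_False_True[OF v(1,2) u(1,2)]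
    by (simp add: mult_le_0_iff)
qed

lemma calibrated_barabanov:
  "calibrated a v w \<Longrightarrow> barabanov a (orb a w v) = growth a ^ length w * barabanov a v"
  by (induction w arbitrary: v) auto

lemma barabanov_calibrated:
  assumes "v \<in> quad" "growth a ^ length w * barabanov a v \<le> barabanov a (orb a w v)"
  shows "calibrated a v w"
  using assms
proof (induction w arbitrary: v)
  case (Cons b w)
  let ?u = "act a b v"
  have u: "?u \<in> quad" by (rule act_quad[OF a Cons.prems(1)])
  have 1: "barabanov a ?u \<le> growth a * barabanov a v"
    by (rule barabanov_act_le[OF a Cons.prems(1)])
  have 2: "barabanov a (orb a w ?u) \<le> growth a ^ length w * barabanov a ?u"
    by (rule barabanov_orb_le[OF a u])
  have gp: "growth a ^ length w > 0" using growth_pos[OF a] by simp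
  have 3: "growth a ^ length w * (growth a * barabanov a v) \<le> barabanov a (orb a w ?u)"
    using Cons.prems by (simp add: mult_ac)
  with 2 have "growth a ^ length w * (growth a * barabanov a v) \<le> growth a ^ length w * barabanov a ?u"
    by linarith
  hence "barabanov a ?u = growth a * barabanov a v" using 1 gp by simp
  thus ?case using Cons.IH[OF u] 3 by simp
qed simp

lemma calibrated_sequence: "\<exists>x :: nat \<Rightarrow> bool. \<forall>n. calibrated a (1, 1) (map x [0..<n])"
proof -
  define c where "c v = (SOME b. barabanov a (act a b v) = growth a * barabanov a v)" for v
  have c: "barabanov a (act a (c v) v) = growth a * barabanov a v" if "v \<in> quad" for v
    unfolding c_def by (rule someI_ex) (rule barabanov_act_eq[OF a that])
  define s where "s n = ((\<lambda>v. act a (c v) v) ^^ n) (1, 1)" for n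
  have s: "s n \<in> quad" for n
    by (induction n) (simp_all add: s_def act_quad[OF a])
  have "calibrated a (1, 1) (map (\<lambda>n. c (s n)) [0..<n]) \<and> orb a (map (\<lambda>n. c (s n)) [0..<n]) (1, 1) = s n" for n
  proof (induction n)
    case (Suc n)
    thus ?case using c[OF s[of n]] by (simp add: calibrated_append) (simp add: s_def)
  qed (simp add: s_def)
  thus ?thesis by blast
qed

lemma calibrated_sequence_lang:
  assumes "\<And>n. calibrated a (1, 1) (map x [0..<n])"
  shows "map x [k..<k+n] \<in> lang a"
proof -
  have "map x [0..<k] @ map x [k..<k+n] @ [] \<in> lang a"
    using assms[of "k + n"] unfolding lang_def by (simp flip: map_append upt_add_eq_append) (auto intro!: bexI[of _ "(1,1)"])
  thus ?thesis by (rule factor_closedD[OF lang_factor_closed])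
qed

lemma lang_length: "\<exists>w\<in>lang a. length w = n"
proof -
  obtain x where "\<forall>n. calibrated a (1, 1) (map x [0..<n])" using calibrated_sequence by blast
  hence "map x [0..<0+n] \<in> lang a" by (intro calibrated_sequence_lang) blast
  thus ?thesis by (intro bexI) auto
qed

text \<open>Along a calibrated word \<open>barabanov\<close> grows by exactly
  \<open>growth a\<close> per letter; replacing it by \<open>mass\<close> costs a factor 5 at either
  end.\<close>

lemma lang_weight:
  assumes "w \<in> lang a" shows "growth a ^ length w \<le> 25 * weight a w"
proof -
  from assms obtain v where v: "v \<in> quad" "mass v > 0" "calibrated a v w" by (auto simp: lang_def)
  have "growth a ^ length w * (mass v / 5) \<le> growth a ^ length w * barabanov a v"
    using barabanov_bounds(1)[OF a v(1)] growth_pos[OF a] by simp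
  also have "\<dots> = barabanov a (orb a w v)" using calibrated_barabanov[OF v(3)] by simp
  also have "\<dots> \<le> 5 * mass (orb a w v)" by (rule barabanov_bounds(2)[OF a orb_quad[OF a v(1)]])
  also have "mass (orb a w v) \<le> mass v * weight a w" by (rule mass_orb_le[OF a v(1)])
  finally show ?thesis using v(2) by (simp add: field_simps)
qed

end

text \<open>For \<open>a > 0\<close> the number is determined uniquely: \<open>lang a\<close> has
  words of every length, while the error stays at most 1.\<close>

definition freq :: "real \<Rightarrow> real" where
  "freq a = (SOME g::real. \<forall>w\<in>lang a. \<bar>real (ones_count w) - g * length w\<bar> \<le> 1)"

lemma lang_freq:
  assumes "a > 0" "w \<in> lang a"
  shows "\<bar>real (ones_count w) - freq a * length w\<bar> \<le> 1"
proof -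
  have "\<exists>g::real. \<forall>w\<in>lang a. \<bar>real (ones_count w) - g * length w\<bar> \<le> 1"
    using lang_factor_closed[OF assms(1)] lang_crossing_free[OF assms(1)] lang_length[OF assms(1)]
    by (intro balanced_frequency crossing_free_balanced)
  from someI_ex[OF this] show ?thesis using assms(2) unfolding freq_def by blast
qed

section \<open>Continuity of the frequency\<close>

context
  fixes a :: real
  assumes a: "a > 0"
begin

lemma barabanov_diff_le:
  assumes "u \<in> quad" "v \<in> quad"
  shows "\<bar>barabanov a u - barabanov a v\<bar> \<le> 10 * dist u v"
proof -
  have *: "barabanov a u \<le> barabanov a v + 10 * dist u v" if uv: "u \<in> quad" "v \<in> quad" for u v
  proof (cases "u = v")
    case False
    define d where "d = dist u v"
    have d: "d > 0" using False by (simp add: d_def)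
    have "\<bar>fst u - fst v\<bar> \<le> d" "\<bar>snd u - snd v\<bar> \<le> d"
      using dist_fst_le[of u v] dist_snd_le[of u v] by (auto simp: d_def dist_real_def)
    hence "v + d *\<^sub>R (1, 1) - u \<in> quad" by (simp add: quad_def abs_le_iff)
    hence "barabanov a u \<le> barabanov a (v + d *\<^sub>R (1, 1))" using uv by (intro barabanov_mono a)
    also have "\<dots> \<le> barabanov a v + barabanov a (d *\<^sub>R (1, 1))"
      by (intro barabanov_subadd a uv quad_scale less_imp_le[OF d]) simp
    also have "barabanov a (d *\<^sub>R (1, 1)) = d * barabanov a (1, 1)"
      by (intro barabanov_scale a d) simp
    also have "\<dots> \<le> d * 10"
      using barabanov_bounds(2)[OF a, of "(1, 1)"] d by (intro mult_left_mono) auto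
    finally show ?thesis by (simp add: d_def mult.commute)
  qed simp
  from *[OF assms] *[OF assms(2,1)] show ?thesis by (simp add: dist_commute abs_le_iff)
qed

lemma continuous_on_barabanov: "continuous_on quad (barabanov a)"
proof -
  have "lipschitz_on 10 quad (barabanov a)"
    using barabanov_diff_le by (intro lipschitz_onI) (simp_all add: dist_real_def)
  thus ?thesis by (rule lipschitz_on_continuous_on)
qed

lemma continuous_on_orb: "continuous_on S (orb a w)"
proof -
  have "linear (orb a w)" by (intro linearI orb_add orb_scale)
  thus ?thesis by (simp add: linear_continuous_on linear_conv_bounded_linear)
qed

text \<open>A word outside \<open>lang a\<close> loses strictly from every direction. By homogeneity
  the ratio depends only on the direction; being continuous on the compact segment of vectors of
  mass 1, it attains a maximum, which is below 1.\<close>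

lemma uncalibrated_word_gap:
  assumes "w \<notin> lang a"
  shows "\<exists>\<theta><1. \<forall>v\<in>quad. mass v > 0 \<longrightarrow> barabanov a (orb a w v) \<le> \<theta> * growth a ^ length w * barabanov a v"
proof -
  let ?f = "\<lambda>v. barabanov a (orb a w v) / (growth a ^ length w * barabanov a v)"
  define K where "K = (\<lambda>t::real. (1 - t, t)) ` {0..1}"
  have K: "v \<in> quad" "mass v = 1" if "v \<in> K" for v
    using that by (auto simp: K_def quad_def mass_def)
  have gp: "growth a ^ length w > 0" using growth_pos[OF a] by simp
  have "compact K" unfolding K_def by (intro compact_continuous_image continuous_intros) auto
  moreover have "K \<noteq> {}" by (simp add: K_def)
  moreover have "continuous_on K ?f"
  proof (intro continuous_on_divide continuous_on_mult continuous_on_const)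
    show "continuous_on K (barabanov a)"
      using continuous_on_barabanov by (rule continuous_on_subset) (use K in blast)
    show "continuous_on K (\<lambda>v. barabanov a (orb a w v))"
      by (rule continuous_on_compose2[OF continuous_on_barabanov continuous_on_orb])
        (use K orb_quad[OF a] in blast)
    show "\<forall>v\<in>K. growth a ^ length w * barabanov a v \<noteq> 0"
    proof
      fix v assume "v \<in> K"
      hence "barabanov a v > 0" using K by (intro barabanov_pos[OF a]) auto
      thus "growth a ^ length w * barabanov a v \<noteq> 0" using gp by (metis mult_pos_pos less_irrefl)
    qed
  qed
  ultimately obtain v0 where v0: "v0 \<in> K" "\<And>v. v \<in> K \<Longrightarrow> ?f v \<le> ?f v0"
    using continuous_attains_sup[of K ?f] by blast
  have q0: "v0 \<in> quad" "mass v0 > 0" using K[OF v0(1)] by simp_all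
  have "\<not> calibrated a v0 w" using assms q0 by (auto simp: lang_def)
  hence "barabanov a (orb a w v0) < growth a ^ length w * barabanov a v0"
    using barabanov_calibrated[OF a q0(1), of w] by (meson not_le)
  define m where "m = ?f v0"
  have "m < 1" unfolding m_def using \<open>barabanov a (orb a w v0) < _\<close> barabanov_pos[OF a q0] gp by (simp add: pos_divide_less_eq)
  moreover have "barabanov a (orb a w v) \<le> m * growth a ^ length w * barabanov a v"
    if v: "v \<in> quad" "mass v > 0" for v
  proof -
    define u where "u = (1 / mass v) *\<^sub>R v"
    have uK: "u \<in> K" unfolding K_def
      by (rule image_eqI[of _ _ "snd v / mass v"])
        (use v in \<open>auto simp: u_def prod_eq_iff mass_def quad_def field_simps\<close>)
    have vu: "v = mass v *\<^sub>R u" using v by (simp add: u_def)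
    have uq: "u \<in> quad" using K[OF uK] by simp
    have "?f u \<le> m" unfolding m_def by (rule v0(2)[OF uK])
    moreover have "growth a ^ length w * barabanov a u > 0"
      using gp barabanov_pos[OF a uq] K[OF uK] by simp
    ultimately have "barabanov a (orb a w u) \<le> m * (growth a ^ length w * barabanov a u)"
      by (simp add: pos_divide_le_eq)
    hence "mass v * barabanov a (orb a w u) \<le> mass v * (m * (growth a ^ length w * barabanov a u))"
      using v by (intro mult_left_mono) auto
    moreover have "barabanov a v = mass v * barabanov a u"
      by (subst vu, rule barabanov_scale[OF a v(2) uq])
    moreover have "barabanov a (orb a w v) = mass v * barabanov a (orb a w u)"
      by (subst vu, subst orb_scale, rule barabanov_scale[OF a v(2) orb_quad[OF a uq]])
    ultimately show ?thesis by (simp add: mult_ac)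
  qed
  ultimately show ?thesis by blast
qed

lemma uncalibrated_gap:
  "\<exists>\<theta>. 0 < \<theta> \<and> \<theta> < 1 \<and> (\<forall>w v. length w = l \<longrightarrow> w \<notin> lang a \<longrightarrow> v \<in> quad \<longrightarrow> mass v > 0 \<longrightarrow>
     barabanov a (orb a w v) \<le> \<theta> * growth a ^ l * barabanov a v)"
proof -
  define W where "W = {w. length w = l \<and> w \<notin> lang a}"
  have fin: "finite W" unfolding W_def by (rule finite_subset[OF _ finite_bool_lists[of l]]) auto
  have "\<forall>w\<in>W. \<exists>\<theta><1. \<forall>v\<in>quad. mass v > 0 \<longrightarrow> barabanov a (orb a w v) \<le> \<theta> * growth a ^ l * barabanov a v"
    using uncalibrated_word_gap by (auto simp: W_def)
  then obtain t where t: "\<And>w. w \<in> W \<Longrightarrow> t w < 1"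
    "\<And>w v. w \<in> W \<Longrightarrow> v \<in> quad \<Longrightarrow> mass v > 0 \<Longrightarrow> barabanov a (orb a w v) \<le> t w * growth a ^ l * barabanov a v"
    using bchoice[of W "\<lambda>w \<theta>. \<theta> < 1 \<and> (\<forall>v\<in>quad. mass v > 0 \<longrightarrow> barabanov a (orb a w v) \<le> \<theta> * growth a ^ l * barabanov a v)"]
    by blast
  \<comment> \<open>The extra element \<open>1/2\<close> keeps the maximum defined and positive,
    also when every word of length \<open>l\<close> is optimal.\<close>
  define \<theta> where "\<theta> = Max (insert (1/2) (t ` W))"
  have "\<theta> < 1" unfolding \<theta>_def using fin t(1) by (subst Max_less_iff) auto
  moreover have "\<theta> \<ge> 1/2" unfolding \<theta>_def using fin by (intro Max_ge) auto
  moreover have "barabanov a (orb a w v) \<le> \<theta> * growth a ^ l * barabanov a v"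
    if "length w = l" "w \<notin> lang a" "v \<in> quad" "mass v > 0" for w v
  proof -
    have w: "w \<in> W" using that by (simp add: W_def)
    have "t w \<le> \<theta>" unfolding \<theta>_def using fin w by (intro Max_ge) auto
    hence "t w * (growth a ^ l * barabanov a v) \<le> \<theta> * (growth a ^ l * barabanov a v)"
      using barabanov_pos[OF a that(3,4)] growth_pos[OF a] by (intro mult_right_mono) auto
    with t(2)[OF w that(3,4)] show ?thesis by (simp add: mult.assoc)
  qed
  ultimately show ?thesis by (intro exI[of _ \<theta>]) auto
qed

text \<open>Every block outside \<open>lang a\<close> costs a factor \<open>\<theta>\<close> of
  \<open>barabanov\<close>, and no other block gains beyond the growth rate. The factor 50 comes
  from \<open>barabanov_bounds\<close>: 10 at the start vector \<open>(1, 1)\<close> and 5 at the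
  end.\<close>

lemma uncalibrated_blocks:
  "\<exists>\<theta>. 0 < \<theta> \<and> \<theta> < 1 \<and> (\<forall>x N. weight a (map x [0..<N*l]) \<le>
     50 * \<theta> ^ card {k. k < N \<and> map x [k*l..<k*l+l] \<notin> lang a} * growth a ^ (N * l))"
proof -
  obtain \<theta> where \<theta>: "0 < \<theta>" "\<theta> < 1" and gap: "\<And>w v. length w = l \<Longrightarrow> w \<notin> lang a \<Longrightarrow> v \<in> quad \<Longrightarrow> mass v > 0 \<Longrightarrow>
     barabanov a (orb a w v) \<le> \<theta> * growth a ^ l * barabanov a v"
    using uncalibrated_gap[of l] by blast
  have gp: "growth a ^ n > 0" for n using growth_pos[OF a] by simp
  have "weight a (map x [0..<N*l]) \<le>
     50 * \<theta> ^ card {k. k < N \<and> map x [k*l..<k*l+l] \<notin> lang a} * growth a ^ (N * l)" for x N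
  proof -
    let ?bad = "\<lambda>k. map x [k*l..<k*l+l] \<notin> lang a"
    have "barabanov a (orb a (map x [0..<N*l]) (1, 1)) \<le>
      \<theta> ^ card {k. k < N \<and> ?bad k} * growth a ^ (N * l) * barabanov a (1, 1)"
    proof (induction N)
      case (Suc N)
      let ?v = "orb a (map x [0..<N*l]) (1, 1)" and ?w = "map x [N*l..<N*l+l]"
      let ?c = "card {k. k < N \<and> ?bad k}"
      have v: "?v \<in> quad" "mass ?v > 0" using orb_quad[OF a] mass_orb_pos[OF a] by auto
      have "[0..<Suc N * l] = [0..<N*l] @ [N*l..<N*l+l]"
        using upt_add_eq_append[of 0 "N*l" l] by (simp add: add.commute)
      hence split: "orb a (map x [0..<Suc N * l]) (1, 1) = orb a ?w ?v" by simp
      show ?case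
      proof (cases "?bad N")
        case True
        have "{k. k < Suc N \<and> ?bad k} = insert N {k. k < N \<and> ?bad k}" using True by (auto simp: less_Suc_eq)
        hence c: "card {k. k < Suc N \<and> ?bad k} = Suc ?c" by simp
        have "barabanov a (orb a ?w ?v) \<le> \<theta> * growth a ^ l * barabanov a ?v"
          by (rule gap) (use True v in auto)
        also have "\<dots> \<le> \<theta> * growth a ^ l * (\<theta> ^ ?c * growth a ^ (N * l) * barabanov a (1, 1))"
          using \<theta> gp by (intro mult_left_mono Suc) (auto intro!: mult_nonneg_nonneg less_imp_le[OF gp])
        finally show ?thesis unfolding split c by (simp add: power_add mult_ac)
      next
        case False
        have c: "{k. k < Suc N \<and> ?bad k} = {k. k < N \<and> ?bad k}" using False by (auto simp: less_Suc_eq)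
        have "barabanov a (orb a ?w ?v) \<le> growth a ^ l * barabanov a ?v"
          using barabanov_orb_le[OF a v(1), of ?w] by simp
        also have "\<dots> \<le> growth a ^ l * (\<theta> ^ ?c * growth a ^ (N * l) * barabanov a (1, 1))"
          by (intro mult_left_mono Suc less_imp_le[OF gp])
        finally show ?thesis unfolding split c by (simp add: power_add mult_ac)
      qed
    qed simp
    moreover have "weight a (map x [0..<N*l]) / 5 \<le> barabanov a (orb a (map x [0..<N*l]) (1, 1))"
      unfolding weight_def by (intro barabanov_bounds(1)[OF a] orb_quad[OF a]) simp
    moreover have "\<theta> ^ card {k. k < N \<and> ?bad k} * growth a ^ (N * l) * barabanov a (1, 1)
       \<le> \<theta> ^ card {k. k < N \<and> ?bad k} * growth a ^ (N * l) * 10"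
      using barabanov_bounds(2)[OF a, of "(1, 1)"] \<theta> gp
      by (intro mult_left_mono mult_nonneg_nonneg) (auto intro: less_imp_le)
    ultimately show ?thesis by linarith
  qed
  thus ?thesis using \<theta> by blast
qed

end

section \<open>Dependence on the parameter\<close>

lemma orb_scaling: "orb a w v = a ^ ones_count w *\<^sub>R orb 1 w v"
proof (induction w arbitrary: v)
  case (Cons b w)
  have "act a b v = (if b then a else 1) *\<^sub>R act 1 b v" by (simp add: act_def)
  thus ?case by (simp add: Cons orb_scale)
qed simp

lemma weight_scaling: "weight a w = a ^ ones_count w * weight 1 w"
  by (simp add: weight_def orb_scaling[of a] mass_scale)

text \<open>The parameter enters only through the power \<open>a ^ ones_count w\<close>, and the
  exponent is at most the length; the minimum is the one of the two ratios that is at most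
  1.\<close>

lemma weight_compare:
  assumes "a > 0" "b > 0"
  shows "min (a / b) (b / a) ^ length w * weight a w \<le> weight b w"
proof -
  let ?r = "min (a / b) (b / a)" and ?c = "ones_count w"
  have r: "0 \<le> ?r" using assms by simp
  have r1: "?r \<le> 1" using assms by (cases "a \<le> b") (auto simp: min_le_iff_disj)
  have "?r ^ length w \<le> ?r ^ ?c" by (rule power_decreasing[OF count_le_length r r1])
  also have "\<dots> \<le> (b / a) ^ ?c" by (rule power_mono) (use r in auto)
  finally have "?r ^ length w * (a ^ ?c * weight 1 w) \<le> (b / a) ^ ?c * (a ^ ?c * weight 1 w)"
    using assms weight_pos[of 1 w] by (intro mult_right_mono) auto
  also have "\<dots> = b ^ ?c * weight 1 w" using assms by (simp add: power_divide)
  finally show ?thesis by (simp add: weight_scaling[of a] weight_scaling[of b])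
qed

lemma power_le_const_imp_le_one:
  fixes q :: real
  assumes "\<And>n. q ^ n \<le> C"
  shows "q \<le> 1"
proof (rule ccontr)
  assume "\<not> ?thesis"
  then obtain n where "C < q ^ n" using real_arch_pow[of q C] by auto
  with assms[of n] show False by simp
qed

lemma growth_compare:
  assumes "a > 0" "b > 0"
  shows "min (a / b) (b / a) * growth a \<le> growth b"
proof -
  let ?r = "min (a / b) (b / a)"
  have r: "0 \<le> ?r" using assms by auto
  have "(?r * growth a / growth b) ^ n \<le> 5" for n
  proof -
    obtain w where w: "length w = n" "peak a n (1, 1) = weight a w"
      using peak_ones_attained[OF assms(1)] by blast
    have "(?r * growth a) ^ n = ?r ^ n * growth a ^ n" by (rule power_mult_distrib)
    also have "\<dots> \<le> ?r ^ n * weight a w"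
      using growth_bounds(1)[OF assms(1), of n] r w by (intro mult_left_mono) auto
    also have "\<dots> \<le> weight b w" using weight_compare[OF assms, of w] w by simp
    also have "\<dots> \<le> 5 * growth b ^ n" using weight_le_growth[OF assms(2), of w] w by simp
    finally show ?thesis using growth_pos[OF assms(2)] by (simp add: power_divide pos_divide_le_eq)
  qed
  hence "?r * growth a / growth b \<le> 1" by (rule power_le_const_imp_le_one)
  thus ?thesis using growth_pos[OF assms(2)] by (simp add: pos_divide_le_eq)
qed

text \<open>For \<open>b\<close> close to \<open>a\<close>, a \<open>b\<close>-optimal word of
  length \<open>N * l\<close> falls short of \<open>growth a ^ (N * l)\<close> by less than a fixed
  factor. If all its \<open>N\<close> blocks were non-optimal for \<open>a\<close>, the loss would
  be larger. So some block lies in both languages; its number of ones is within 1 of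
  \<open>freq a * l\<close> and of \<open>freq b * l\<close>, and the frequencies differ by at most
  \<open>2 / l\<close>.\<close>

lemma isCont_freq:
  assumes a: "a > 0"
  shows "isCont freq a"
  unfolding isCont_def tendsto_iff
proof (intro allI impI)
  fix e :: real assume e: "e > 0"
  obtain l :: nat where l: "l > 2 / e" "l > 0"
    using reals_Archimedean2[of "max 1 (2/e)"] by (auto simp: max_def split: if_splits)
  obtain \<theta> where \<theta>: "0 < \<theta>" "\<theta> < 1" and bad: "\<And>x N. weight a (map x [0..<N*l]) \<le>
     50 * \<theta> ^ card {k. k < N \<and> map x [k*l..<k*l+l] \<notin> lang a} * growth a ^ (N * l)"
    using uncalibrated_blocks[OF a, of l] by blast
  \<comment> \<open>\<open>2500 = 50 * 50\<close>: one 50 is the constant in \<open>bad\<close>, the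
    other the shortfall \<open>2 * 25\<close> allowed to a \<open>b\<close>-optimal word.\<close>
  obtain N where N: "\<theta> ^ N < 1 / 2500" using real_arch_pow_inv[of "1/2500" \<theta>] \<theta> by auto
  let ?r = "\<lambda>b. min (a / b) (b / a)"
  \<comment> \<open>The exponent is doubled because the ratio is paid twice per letter, once for the
    growth rates and once for the weights.\<close>
  have "((\<lambda>b. ?r b ^ (2 * (N * l))) \<longlongrightarrow> ?r a ^ (2 * (N * l))) (at a)"
    using a by (intro tendsto_intros) auto
  moreover have "?r a ^ (2 * (N * l)) > 1/2" using a by simp
  ultimately have "\<forall>\<^sub>F b in at a. ?r b ^ (2 * (N * l)) > 1/2" by (rule order_tendstoD)
  moreover have "\<forall>\<^sub>F b in at a. b > 0"
    using order_tendstoD(1)[OF tendsto_ident_at a] .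
  ultimately show "\<forall>\<^sub>F b in at a. dist (freq b) (freq a) < e"
  proof eventually_elim
    case (elim b)
    note b = \<open>b > 0\<close>
    obtain x where x: "\<And>n. calibrated b (1, 1) (map x [0..<n])" using calibrated_sequence[OF b] by blast
    have L: "map x [k..<k+n] \<in> lang b" for k n by (rule calibrated_sequence_lang[OF b x])
    let ?w = "map x [0..<N*l]" and ?n = "N * l"
    have r: "?r b \<ge> 0" using a b by simp
    have gp: "growth a ^ ?n > 0" using growth_pos[OF a] by simp
    have "(?r b * growth a) ^ ?n \<le> growth b ^ ?n"
      using growth_compare[OF a b] growth_pos[OF a] r by (intro power_mono) auto
    also have "\<dots> \<le> 25 * weight b ?w" using lang_weight[OF b L[of 0 "N*l"]] by simp
    finally have "?r b ^ ?n * (?r b * growth a) ^ ?n \<le> ?r b ^ ?n * (25 * weight b ?w)"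
      using r by (intro mult_left_mono) auto
    also have "\<dots> = 25 * (min (b / a) (a / b) ^ ?n * weight b ?w)" by (simp add: min.commute)
    also have "\<dots> \<le> 25 * weight a ?w" using weight_compare[OF b a, of ?w] by simp
    also have "?r b ^ ?n * (?r b * growth a) ^ ?n = ?r b ^ (2 * ?n) * growth a ^ ?n"
      by (simp add: power_mult_distrib mult_2 power_add)
    finally have "?r b ^ (2 * ?n) * growth a ^ ?n \<le> 25 * weight a ?w" .
    moreover have "1/2 * growth a ^ ?n < ?r b ^ (2 * ?n) * growth a ^ ?n"
      using elim gp by (intro mult_strict_right_mono)
    ultimately have lower: "growth a ^ ?n < 50 * weight a ?w" by linarith
    have "\<exists>k<N. map x [k*l..<k*l+l] \<in> lang a"
    proof (rule ccontr)
      assume "\<not> ?thesis"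
      hence "{k. k < N \<and> map x [k*l..<k*l+l] \<notin> lang a} = {..<N}" by auto
      with bad[of x N] have "weight a ?w \<le> 50 * \<theta> ^ N * growth a ^ ?n" by simp
      moreover have "\<theta> ^ N * growth a ^ ?n < 1 / 2500 * growth a ^ ?n"
        using N gp by (intro mult_strict_right_mono)
      ultimately show False using lower by simp
    qed
    then obtain k where k: "map x [k*l..<k*l+l] \<in> lang a" by blast
    have "\<bar>freq b * l - freq a * l\<bar> \<le> 2"
      using lang_freq[OF a k] lang_freq[OF b L[of "k*l" l]] by simp
    hence "\<bar>freq b - freq a\<bar> * l \<le> 2"
      by (metis abs_mult abs_of_nat left_diff_distrib)
    moreover have "2 < e * l" using l e by (simp add: field_simps)
    ultimately have "\<bar>freq b - freq a\<bar> * l < e * l" by linarith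
    thus ?case using l by (simp add: dist_real_def)
  qed
qed

section \<open>Range of the frequency\<close>

lemma weight_ge_power:
  assumes "a > 0" shows "2 * a ^ ones_count w \<le> weight a w"
proof -
  have "orb 1 w v - v \<in> quad" if "v \<in> quad" for v
    using that
  proof (induction w arbitrary: v)
    case (Cons b w)
    have 1: "act 1 b v \<in> quad" by (rule act_quad) (use Cons in auto)
    have "act 1 b v - v \<in> quad" using Cons.prems by (auto simp: act_def quad_def)
    from quad_add[OF this Cons.IH[OF 1]] show ?case by (simp add: algebra_simps)
  qed (simp add: quad_def)
  from mass_nonneg[OF this[of "(1, 1)"]] have "weight 1 w \<ge> 2"
    by (simp add: weight_def mass_def)
  thus ?thesis using assms by (simp add: weight_scaling[of a] mult.commute)
qed

lemma ones_count_replicate: "ones_count (replicate n b) = (if b then n else 0)"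
  by (induction n) auto

lemma growth_ge:
  assumes "a > 0" shows "growth a \<ge> max 1 a"
proof -
  have *: "c \<le> growth a" if "c = (if b then a else 1)" for b c
  proof -
    have "(c / growth a) ^ n \<le> 5" for n
    proof -
      have "2 * c ^ n \<le> weight a (replicate n b)"
        using weight_ge_power[OF assms, of "replicate n b"] that
        by (cases b) (simp_all add: ones_count_replicate)
      also have "\<dots> \<le> 5 * growth a ^ n"
        using weight_le_growth[OF assms, of "replicate n b"] by simp
      finally have "2 * c ^ n \<le> 5 * growth a ^ n" .
      moreover have "0 \<le> c ^ n" using that assms by simp
      ultimately have "c ^ n \<le> 5 * growth a ^ n" by linarith
      thus ?thesis using growth_pos[OF assms] by (simp add: power_divide pos_divide_le_eq)
    qed
    hence "c / growth a \<le> 1" by (rule power_le_const_imp_le_one)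
    thus ?thesis using growth_pos[OF assms] by (simp add: pos_divide_le_eq)
  qed
  show ?thesis using *[of a True] *[of 1 False] by simp
qed

text \<open>An \<open>a\<close>-optimal word of length \<open>n\<close> is evaluated at parameter 1.
  Its weight changes exactly by \<open>a ^ ones_count w\<close>, with about
  \<open>freq a * n\<close> ones, and at parameter 1 it is at most \<open>5 * growth 1 ^ n\<close>.
  The constant is \<open>125 = 25 * 5\<close>.\<close>

lemma freq_growth_bound:
  assumes a: "a > 0"
  shows "ln (growth a) \<le> ln (growth 1) + freq a * ln a"
proof (rule ccontr)
  define x where "x = ln (growth a) - ln (growth 1) - freq a * ln a"
  assume "\<not> ?thesis"
  hence "x > 0" by (simp add: x_def)
  then obtain n :: nat where n: "n * x > ln 125 + \<bar>ln a\<bar>" using reals_Archimedean3 by blast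
  obtain w where w: "w \<in> lang a" "length w = n" using lang_length[OF a] by blast
  let ?c = "ones_count w"
  have pos: "growth a ^ n > 0" "growth 1 ^ n > 0" "a ^ ?c > 0"
    using growth_pos[of 1] growth_pos[OF a] a by simp_all
  have "growth a ^ n \<le> 25 * (a ^ ?c * weight 1 w)"
    using lang_weight[OF a w(1)] w(2) weight_scaling[of a w] by simp
  also have "\<dots> \<le> 25 * (a ^ ?c * (5 * growth 1 ^ n))"
    using weight_le_growth[of 1 w] w(2) pos by (intro mult_left_mono) auto
  finally have "ln (growth a ^ n) \<le> ln (125 * (a ^ ?c * growth 1 ^ n))"
    using pos by simp
  also have "\<dots> = ln 125 + (ln (a ^ ?c) + ln (growth 1 ^ n))"
    using pos by (simp only: ln_mult_pos mult_pos_pos)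
  finally have 1: "n * ln (growth a) \<le> ln 125 + ?c * ln a + n * ln (growth 1)"
    using a growth_pos[of 1] growth_pos[OF a] by (simp add: ln_realpow)
  have "(?c - freq a * n) * ln a \<le> \<bar>?c - freq a * n\<bar> * \<bar>ln a\<bar>"
    by (metis abs_ge_self abs_mult)
  also have "\<dots> \<le> 1 * \<bar>ln a\<bar>" using lang_freq[OF a w(1)] w(2) by (intro mult_right_mono) auto
  finally have "n * x \<le> ln 125 + \<bar>ln a\<bar>" using 1 by (simp add: x_def algebra_simps)
  with n show False by simp
qed

text \<open>Against the lower bound \<open>max 1 a\<close> of \<open>growth_ge\<close>, the estimate
  \<open>freq_growth_bound\<close> forces a small frequency for small \<open>a\<close> and a large
  one for large \<open>a\<close>; the values between follow by continuity.\<close>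

lemma freq_onto:
  assumes "0 < g" "g < 1"
  shows "\<exists>a>0. freq a = g"
proof -
  define R where "R = ln (growth 1)"
  have R: "R \<ge> 0" using growth_ge[of 1] by (simp add: R_def)
  \<comment> \<open>With \<open>ln a1 = - (R + 1) / g\<close> the two bounds on the growth give
    \<open>freq a1 \<le> g * R / (R + 1)\<close>; \<open>a2\<close> is the mirror image for
    \<open>1 - g\<close>. The summand 1 keeps the logarithms nonzero even if
    \<open>R = 0\<close>.\<close>
  define a1 where "a1 = exp (- ((R + 1) / g))"
  define a2 where "a2 = exp ((R + 1) / (1 - g))"
  have "freq a1 \<le> g"
  proof -
    have "growth a1 \<ge> 1" using growth_ge[of a1] by (simp add: a1_def)
    hence "0 \<le> R + freq a1 * ln a1" using freq_growth_bound[of a1] unfolding R_def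
      by (smt (verit) a1_def exp_gt_zero ln_ge_zero)
    hence "freq a1 * ((R + 1) / g) \<le> R" by (simp add: a1_def)
    hence "freq a1 * (R + 1) \<le> g * R" using assms by (simp add: field_simps)
    also have "\<dots> \<le> g * (R + 1)" using assms by simp
    finally show ?thesis using R by simp
  qed
  moreover have "g \<le> freq a2"
  proof -
    have "growth a2 \<ge> a2" "a2 > 0" using growth_ge[of a2] by (simp_all add: a2_def)
    hence "ln a2 \<le> ln (growth a2)" by simp
    hence "ln a2 \<le> R + freq a2 * ln a2" using freq_growth_bound[of a2] \<open>a2 > 0\<close> unfolding R_def by simp
    hence "(1 - freq a2) * ((R + 1) / (1 - g)) \<le> R" by (simp add: a2_def algebra_simps)
    hence "(1 - freq a2) * (R + 1) \<le> (1 - g) * R" using assms by (simp add: field_simps)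
    also have "\<dots> \<le> (1 - g) * (R + 1)" using assms by simp
    finally show ?thesis using R by simp
  qed
  moreover have "a1 \<le> a2"
  proof -
    have "- ((R + 1) / g) \<le> 0" "0 \<le> (R + 1) / (1 - g)" using assms R by simp_all
    thus ?thesis unfolding a1_def a2_def by (subst exp_le_cancel_iff) linarith
  qed
  moreover have "\<forall>x. a1 \<le> x \<and> x \<le> a2 \<longrightarrow> isCont freq x"
  proof (intro allI impI isCont_freq)
    fix x assume "a1 \<le> x \<and> x \<le> a2"
    hence "a1 \<le> x" by simp
    thus "x > 0" by (rule less_le_trans[rotated]) (simp add: a1_def)
  qed
  ultimately obtain x where x: "a1 \<le> x" "freq x = g" using IVT[of freq a1 g a2] by blast
  have "x > 0" by (rule less_le_trans[OF _ x(1)]) (simp add: a1_def)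
  thus ?thesis using x by blast
qed

section \<open>Sturmian tuples\<close>

text \<open>Turns the arbitrarily long jointly optimal factors of an extremal sequence into one
  infinite sequence. The path keeps the property of having arbitrarily long extensions in
  \<open>T\<close>, which by finiteness of \<open>A\<close> passes to some next letter.\<close>

lemma konig_infinite_path:
  fixes T :: "'a list set"
  assumes fin: "finite A" and T: "T \<subseteq> lists A"
    and pre: "\<And>u v. u @ v \<in> T \<Longrightarrow> u \<in> T" and ex: "\<And>n. \<exists>w\<in>T. length w = n"
  shows "\<exists>y. \<forall>n. map y [0..<n] \<in> T"
proof -
  define good where "good u \<longleftrightarrow> (\<forall>n. \<exists>v. u @ v \<in> T \<and> n \<le> length v)" for u
  have good0: "good []" using ex unfolding good_def by (metis append_Nil order_refl)
  have step: "\<exists>a. good (u @ [a])" if u: "good u" for u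
  proof (rule ccontr)
    assume "\<not> ?thesis"
    hence "\<forall>a. \<exists>n. \<forall>v. (u @ [a]) @ v \<in> T \<longrightarrow> length v < n" by (simp add: good_def not_le)
    then obtain N where N: "\<And>a v. (u @ [a]) @ v \<in> T \<Longrightarrow> length v < N a" by metis
    obtain v where v: "u @ v \<in> T" "Suc (Max (insert 0 (N ` A))) \<le> length v"
      using u unfolding good_def by blast
    then obtain a v' where av: "v = a # v'" by (cases v) auto
    have "a \<in> A" using T v av by auto
    hence "N a \<le> Max (insert 0 (N ` A))" using fin by (intro Max_ge) auto
    moreover have "length v' < N a" using N[of a v'] v av by simp
    ultimately show False using v av by simp
  qed
  define nxt where "nxt u = (SOME a. good (u @ [a]))" for u
  have nxt: "good (u @ [nxt u])" if "good u" for u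
    unfolding nxt_def by (rule someI_ex[OF step[OF that]])
  define pth where "pth n = ((\<lambda>u. u @ [nxt u]) ^^ n) []" for n
  have pth: "pth 0 = []" "pth (Suc n) = pth n @ [nxt (pth n)]" for n by (simp_all add: pth_def)
  have "map (\<lambda>n. nxt (pth n)) [0..<n] = pth n \<and> good (pth n)" for n
    by (induction n) (simp_all add: pth good0 nxt)
  moreover have "u \<in> T" if "good u" for u using that pre unfolding good_def by blast
  ultimately show ?thesis by metis
qed

text \<open>The exceptional position, at which the discrepancy attains its least possible value, is unique
  because \<open>g\<close> is irrational; this is why the formula is only claimed from some index on.\<close>

lemma balanced_sequence_floor:
  fixes y :: "nat \<Rightarrow> bool" and g :: real
  assumes bal: "\<And>k n. \<bar>real (ones_count (map y [k..<k+n])) - g * n\<bar> \<le> 1" and g: "g \<notin> \<rat>"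
  shows "\<exists>b N. \<forall>n\<ge>N. int (ones_count (map y [0..<n])) = \<lfloor>g * n + b\<rfloor>"
proof -
  define d where "d n = real (ones_count (map y [0..<n])) - g * n" for n
  have step: "\<bar>d (k + n) - d k\<bar> \<le> 1" for k n
  proof -
    have "[0..<k+n] = [0..<k] @ [k..<k+n]" using upt_add_eq_append[of 0 k n] by simp
    hence "d (k + n) - d k = real (ones_count (map y [k..<k+n])) - g * n"
      by (simp add: d_def algebra_simps)
    thus ?thesis using bal by simp
  qed
  have close: "d m \<le> d n + 1" for m n
    using step[of m "n - m"] step[of n "m - n"] by (cases "m \<le> n") auto
  \<comment> \<open>Any two discrepancies differ by at most 1, so all of them lie between
    \<open>b - 1\<close> and \<open>b\<close>; above \<open>b - 1\<close> the count is exactly the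
    floor of \<open>g * n + b\<close>.\<close>
  define b where "b = (SUP n. d n)"
  have bdd: "bdd_above (range d)" using close[of _ 0] by (intro bdd_aboveI2)
  have up: "d n \<le> b" for n unfolding b_def by (intro cSUP_upper bdd) auto
  have low: "b - 1 \<le> d n" for n 
  proof -
    have "b \<le> d n + 1" unfolding b_def using close[of _ n] by (intro cSUP_least) auto
    thus ?thesis by simp
  qed
  have inj: "m = n" if "d m = d n" for m n
  proof (rule ccontr)
    assume "m \<noteq> n"
    hence "g = (real (ones_count (map y [0..<m])) - real (ones_count (map y [0..<n]))) / (real m - real n)"
      using that by (simp add: d_def field_simps)
    also have "\<dots> \<in> \<rat>" by simp
    finally show False using g by simp
  qed
  have fl: "int (ones_count (map y [0..<n])) = \<lfloor>g * n + b\<rfloor>" if "d n \<noteq> b - 1" for n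
    using that up[of n] low[of n] by (intro floor_unique[symmetric]) (auto simp: d_def)
  show ?thesis
  proof (cases "\<exists>m. d m = b - 1")
    case True
    then obtain m where "d m = b - 1" by blast
    hence "d n \<noteq> b - 1" if "n \<ge> Suc m" for n using inj[of m n] that by auto
    thus ?thesis using fl by blast
  next
    case False
    thus ?thesis using fl by blast
  qed
qed

lemma finite_real_gap:
  fixes F :: "real set"
  assumes "finite F"
  shows "\<exists>d>0. \<forall>x\<in>F. \<forall>y\<in>F. x < y \<longrightarrow> x + d \<le> y"
proof -
  let ?D = "insert 1 ((\<lambda>(x, y). y - x) ` {(x, y) \<in> F \<times> F. x < y})"
  have fin: "finite ?D" using assms by (auto intro: finite_subset[of _ "F \<times> F"])
  have "Min ?D > 0" using fin by (subst Min_gr_iff) auto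
  moreover have "x + Min ?D \<le> y" if "x \<in> F" "y \<in> F" "x < y" for x y
  proof -
    have "Min ?D \<le> y - x" using fin that by (intro Min_le) (auto intro!: image_eqI[of _ _ "(x, y)"])
    thus ?thesis by simp
  qed
  ultimately show ?thesis by blast
qed

text \<open>For a phase in the unit interval, the floors at \<open>0, ..., n\<close> jump only as
  the phase passes the points \<open>s i = 1 - frac (g * i)\<close>, or 0 for \<open>i = 0\<close>.
  These are distinct because \<open>g\<close> is irrational, so they cut the interval into
  \<open>n + 1\<close> pieces with different floor patterns; \<open>t e\<close> marks a window at
  the left end of the piece starting at \<open>s e\<close>.\<close>

lemma rotation_words_separated:
  fixes g :: real
  assumes g: "g \<notin> \<rat>"
  shows "\<exists>t \<epsilon>. \<epsilon> > 0 \<and> (\<forall>e\<le>n. \<epsilon> \<le> t e \<and> t e + \<epsilon> \<le> 1) \<and>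
    (\<forall>e\<le>n. \<forall>e'\<le>n. \<forall>\<theta> \<theta>'. e \<noteq> e' \<longrightarrow> \<bar>\<theta> - t e\<bar> < \<epsilon> \<longrightarrow> \<bar>\<theta>' - t e'\<bar> < \<epsilon> \<longrightarrow>
       (\<exists>i\<le>n. \<lfloor>\<theta> + g * real i\<rfloor> \<noteq> \<lfloor>\<theta>' + g * real i\<rfloor>))"
proof -
  define s where "s i = (if i = 0 then 0 else 1 - frac (g * real i))" for i :: nat
  have gi: "g * real i \<notin> \<int>" if "i > 0" for i :: nat
  proof
    assume "g * real i \<in> \<int>"
    hence "g * real i / real i \<in> \<rat>" using Ints_subset_Rats by (intro Rats_divide) auto
    thus False using that g by simp
  qed
  have s01: "0 \<le> s i" "s i < 1" for i
    using gi[of i] frac_lt_1[of "g * real i"] frac_gt_0_iff[of "g * real i"] by (auto simp: s_def less_imp_le)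
  have spos: "0 < s i" if "i > 0" for i
    using that frac_lt_1[of "g * real i"] by (auto simp: s_def)
  have inj: "inj s"
  proof (rule injI)
    fix i k assume eq: "s i = s k"
    show "i = k"
    proof (cases "i = 0 \<or> k = 0")
      case True
      moreover have "s 0 = 0" by (simp add: s_def)
      ultimately show ?thesis using eq spos[of i] spos[of k] by (metis less_irrefl not_gr_zero)
    next
      case False
      hence "frac (g * real i) = frac (g * real k)" using eq by (simp add: s_def)
      hence 1: "g * (real i - real k) = real_of_int (\<lfloor>g * real i\<rfloor> - \<lfloor>g * real k\<rfloor>)"
        by (simp add: frac_def algebra_simps)
      show ?thesis
      proof (rule ccontr)
        assume "i \<noteq> k"
        hence "g = real_of_int (\<lfloor>g * real i\<rfloor> - \<lfloor>g * real k\<rfloor>) / (real i - real k)"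
          using 1 by (simp add: field_simps)
        also have "\<dots> \<in> \<rat>" by simp
        finally show False using g by simp
      qed
    qed
  qed
  \<comment> \<open>The end point 1 is included so that the window right of the largest
    \<open>s e\<close> stays inside the unit interval.\<close>
  obtain d where d: "d > 0" "\<And>x y. x \<in> insert 1 (s ` {..n}) \<Longrightarrow> y \<in> insert 1 (s ` {..n}) \<Longrightarrow> x < y \<Longrightarrow> x + d \<le> y"
    using finite_real_gap[of "insert 1 (s ` {..n})"] by auto
  have sep: "\<exists>i\<le>n. \<lfloor>\<theta> + g * real i\<rfloor> \<noteq> \<lfloor>\<theta>' + g * real i\<rfloor>"
    if "k \<le> n" "k' \<le> n" "s k < s k'" "\<bar>\<theta> - (s k + d / 2)\<bar> < d / 2" "\<bar>\<theta>' - (s k' + d / 2)\<bar> < d / 2" for k k' \<theta> \<theta>'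
  proof -
    have "s k + d \<le> s k'" using that by (intro d) auto
    have k': "k' > 0" using that s01(1)[of k] by (cases k') (auto simp: s_def)
    \<comment> \<open>The larger left end \<open>s k'\<close> lies between the two phases, so the
      floors differ at the index \<open>k'\<close>.\<close>
    have "\<theta> < s k'" "s k' < \<theta>'" using that \<open>s k + d \<le> s k'\<close> by linarith+
    hence "\<theta> + g * real k' < 1 + \<lfloor>g * real k'\<rfloor>" "1 + \<lfloor>g * real k'\<rfloor> < \<theta>' + g * real k'"
      using k' by (simp_all add: s_def frac_def)
    hence "\<lfloor>\<theta> + g * real k'\<rfloor> < 1 + \<lfloor>g * real k'\<rfloor>" "1 + \<lfloor>g * real k'\<rfloor> \<le> \<lfloor>\<theta>' + g * real k'\<rfloor>"
      by (simp_all add: floor_less_iff le_floor_iff)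
    thus ?thesis using that(2) by (intro exI[of _ k']) auto
  qed
  show ?thesis
  proof (rule exI[of _ "\<lambda>e. s e + d / 2"], rule exI[of _ "d / 2"], intro conjI allI impI)
    fix e assume "e \<le> n"
    thus "d / 2 \<le> s e + d / 2" "s e + d / 2 + d / 2 \<le> 1" using s01[of e] d(2)[of "s e" 1] by auto
  next
    fix e e' \<theta> \<theta>' assume *: "e \<le> n" "e' \<le> n" "e \<noteq> e'" "\<bar>\<theta> - (s e + d / 2)\<bar> < d / 2" "\<bar>\<theta>' - (s e' + d / 2)\<bar> < d / 2"
    have "s e \<noteq> s e'" using * inj by (auto dest: injD)
    thus "\<exists>i\<le>n. \<lfloor>\<theta> + g * real i\<rfloor> \<noteq> \<lfloor>\<theta>' + g * real i\<rfloor>"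
      using sep[of e e' \<theta> \<theta>'] sep[of e' e \<theta>' \<theta>] * by (metis linorder_neq_iff)
  qed (use d in auto)
qed

section \<open>Rational independence and simultaneous approximation\<close>

text \<open>Linear independence of 1 and the \<open>g j\<close> over the rationals, with
  denominators cleared; \<open>d\<close> vanishes once all \<open>c j\<close> do.\<close>

definition rationally_independent :: "nat \<Rightarrow> (nat \<Rightarrow> real) \<Rightarrow> bool" where
  "rationally_independent p g \<longleftrightarrow>
     (\<forall>(c :: nat \<Rightarrow> int) (d :: int). (\<Sum>j<p. of_int (c j) * g j) = of_int d \<longrightarrow> (\<forall>j<p. c j = 0))"

lemma rationally_independentD:
  assumes "rationally_independent p g" "(\<Sum>j<p. of_int (c j) * g j) = of_int d" "j < p"
  shows "c j = 0"
  by (rule assms(1)[unfolded rationally_independent_def, rule_format, OF assms(2,3)])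

text \<open>Given the earlier numbers, a new one in a relation with nonzero coefficient is a value
  of a formula with integer parameters. Such values are countable, the open unit interval is
  not.\<close>

lemma rationally_independent_exists:
  "\<exists>g. rationally_independent p g \<and> (\<forall>j<p. 0 < g j \<and> g j < 1)"
proof (induction p)
  case 0
  show ?case by (simp add: rationally_independent_def)
next
  case (Suc p)
  then obtain g where g: "rationally_independent p g" "\<And>j. j < p \<Longrightarrow> 0 < g j \<and> g j < 1" by blast
  \<comment> \<open>The coefficients are stored in a list because integer lists, unlike functions on
    \<open>nat\<close>, form a countable type.\<close>
  define S where "S = range (\<lambda>(cs :: int list, d :: int, e :: int). (of_int d - (\<Sum>j<p. of_int (cs ! j) * g j)) / of_int e)"
  have "countable S" unfolding S_def by simp
  hence "\<not> {0<..<1} \<subseteq> S" using uncountable_open_interval[of 0 "1::real"] countable_subset by auto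
  then obtain x where "x \<in> {0<..<1}" "x \<notin> S" by blast
  hence x: "0 < x" "x < 1" "x \<notin> S" by auto
  have "rationally_independent (Suc p) (g(p := x))"
    unfolding rationally_independent_def
  proof (intro allI impI)
    fix c :: "nat \<Rightarrow> int" and d :: int and j
    assume eq: "(\<Sum>j<Suc p. of_int (c j) * (g(p := x)) j) = of_int d" and j: "j < Suc p"
    have eq': "(\<Sum>j<p. of_int (c j) * g j) + of_int (c p) * x = of_int d"
      using eq by simp
    have cp: "c p = 0"
    proof (rule ccontr)
      assume "c p \<noteq> 0"
      have "(\<Sum>j<p. of_int (map c [0..<p] ! j) * g j) = (\<Sum>j<p. of_int (c j) * g j)"
        by (intro sum.cong) auto
      hence "x = (of_int d - (\<Sum>j<p. of_int (map c [0..<p] ! j) * g j)) / of_int (c p)"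
        using eq' \<open>c p \<noteq> 0\<close> by (simp add: field_simps)
      hence "x \<in> S" unfolding S_def by (intro image_eqI[of _ _ "(map c [0..<p], d, c p)"]) auto
      thus False using x by simp
    qed
    hence "(\<Sum>j<p. of_int (c j) * g j) = of_int d" using eq' by simp
    thus "c j = 0" using rationally_independentD[OF g(1)] cp j by (cases "j = p") auto
  qed
  moreover have "\<forall>j<Suc p. 0 < (g(p := x)) j \<and> (g(p := x)) j < 1"
    using x g(2) by (auto simp: less_Suc_eq)
  ultimately show ?case by blast
qed

lemma rationally_independent_irrational:
  assumes "rationally_independent p g" "j < p"
  shows "g j \<notin> \<rat>"
proof
  assume "g j \<in> \<rat>"
  then obtain a b where ab: "b > 0" "g j = of_int a / of_int b" by (metis Rats_cases')
  let ?c = "\<lambda>i. if i = j then b else 0"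
  have "(\<Sum>i<p. of_int (?c i) * g i) = (\<Sum>i<p. if i = j then of_int b * g j else 0)"
    by (intro sum.cong) auto
  also have "\<dots> = of_int a" using assms(2) ab by simp
  finally have "?c j = 0" by (rule rationally_independentD[OF assms(1) _ assms(2)])
  thus False using ab by simp
qed

text \<open>Kronecker's theorem supplies an integer \<open>k\<close>, possibly negative. Adding
  \<open>T\<close> times a Dirichlet denominator \<open>q\<close>, for which every
  \<open>q * g j\<close> is within \<open>1 / N\<close> of an integer, lifts it above
  \<open>K\<close> while disturbing each coordinate by at most \<open>\<epsilon> / 2\<close>. The
  bound \<open>K\<close> skips the initial indices excluded in
  \<open>balanced_sequence_floor\<close>.\<close>

lemma kronecker_natural:
  assumes ind: "rationally_independent p g" and "\<epsilon> > 0"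
  shows "\<exists>k\<ge>K::nat. \<exists>m :: nat \<Rightarrow> int. \<forall>j<p. \<bar>real k * g j - of_int (m j) - \<alpha> j\<bar> < \<epsilon>"
proof -
  interpret Modules.module "\<lambda>r x :: real. of_int r * x"
    by (simp add: Modules.module.intro distrib_left mult.commute)
  \<comment> \<open>The number 1 is appended as entry \<open>p\<close>, since Kronecker's theorem is
    applied to a family whose last member is 1.\<close>
  define \<theta> where "\<theta> i = (if i < p then g i else 1)" for i
  have key: "\<forall>i\<le>p. c i = 0" if "(\<Sum>i\<le>p. of_int (c i) * \<theta> i) = 0" for c :: "nat \<Rightarrow> int"
  proof -
    have "(\<Sum>i\<le>p. of_int (c i) * \<theta> i) = (\<Sum>i<p. of_int (c i) * g i) + of_int (c p)"
      by (simp add: \<theta>_def flip: lessThan_Suc_atMost)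
    hence *: "(\<Sum>i<p. of_int (c i) * g i) = of_int (- c p)" using that by simp
    have "\<forall>i<p. c i = 0" using rationally_independentD[OF ind *] by blast
    with * show ?thesis by (auto simp: le_less)
  qed
  have inj: "inj_on \<theta> {..p}"
  proof (rule inj_onI, rule ccontr)
    fix i k assume ik: "i \<in> {..p}" "k \<in> {..p}" "\<theta> i = \<theta> k" "i \<noteq> k"
    define c :: "nat \<Rightarrow> int" where "c l = (if l = i then 1 else if l = k then -1 else 0)" for l
    have "(\<Sum>l\<le>p. of_int (c l) * \<theta> l) = (\<Sum>l\<le>p. (if l = i then \<theta> i else 0) + (if l = k then - \<theta> k else 0))"
      by (intro sum.cong) (use ik in \<open>auto simp: c_def\<close>)
    also have "\<dots> = 0" using ik by (simp add: sum.distrib)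
    finally have "c i = 0" using key ik by blast
    thus False by (simp add: c_def)
  qed
  have "independent (\<theta> ` {..p})"
  proof (subst dependent_finite)
    show "\<not> (\<exists>u. (\<exists>v\<in>\<theta> ` {..p}. u v \<noteq> 0) \<and> (\<Sum>v\<in>\<theta> ` {..p}. of_int (u v) * v) = 0)"
    proof (intro notI, elim exE conjE bexE)
      fix u :: "real \<Rightarrow> int" and v assume *: "v \<in> \<theta> ` {..p}" "u v \<noteq> 0" "(\<Sum>v\<in>\<theta> ` {..p}. of_int (u v) * v) = 0"
      have "(\<Sum>i\<le>p. of_int (u (\<theta> i)) * \<theta> i) = 0"
        using *(3) by (simp add: sum.reindex[OF inj])
      from key[OF this] * show False by auto
    qed
  qed simp
  then obtain k m where km: "\<And>i. i < p \<Longrightarrow> \<bar>of_int k * \<theta> i - of_int (m i) - \<alpha> i\<bar> < \<epsilon> / 2"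
    using Kronecker_thm_2[of \<theta> p "\<epsilon> / 2" \<alpha>] inj \<open>\<epsilon> > 0\<close> by (auto simp: \<theta>_def)
  define T where "T = nat \<bar>k\<bar> + K + 1"
  obtain N :: nat where N: "N > 2 * T / \<epsilon>" using reals_Archimedean2 by blast
  have "2 * T / \<epsilon> \<ge> 0" using \<open>\<epsilon> > 0\<close> by simp
  hence N0: "N > 0" using N by (metis le_less_trans of_nat_0_less_iff)
  obtain q r where q: "0 < q" and r: "\<And>i. i < p \<Longrightarrow> \<bar>of_int q * g i - of_int (r i)\<bar> < 1 / N"
    using Dirichlet_approx_simult[OF N0, of p g] by metis
  define k' where "k' = nat (k + int T * q)"
  have "int T * q \<ge> int T" using q by (simp add: mult_le_cancel_left1)
  hence kT: "k + int T * q \<ge> int K" by (simp add: T_def)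
  have "\<bar>real k' * g j - of_int (m j + int T * r j) - \<alpha> j\<bar> < \<epsilon>" if j: "j < p" for j
  proof -
    have "real k' = of_int k + T * of_int q" using kT by (simp add: k'_def)
    hence "real k' * g j - of_int (m j + int T * r j) - \<alpha> j =
      (of_int k * g j - of_int (m j) - \<alpha> j) + T * (of_int q * g j - of_int (r j))"
      by (simp add: algebra_simps)
    also have "\<bar>\<dots>\<bar> \<le> \<bar>of_int k * g j - of_int (m j) - \<alpha> j\<bar> + T * \<bar>of_int q * g j - of_int (r j)\<bar>"
      by (rule order_trans[OF abs_triangle_ineq]) (simp add: abs_mult)
    also have "\<dots> < \<epsilon> / 2 + \<epsilon> / 2"
    proof (rule add_less_le_mono)
      show "\<bar>of_int k * g j - of_int (m j) - \<alpha> j\<bar> < \<epsilon> / 2" using km[OF j] j by (simp add: \<theta>_def)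
      have "T * \<bar>of_int q * g j - of_int (r j)\<bar> \<le> T * (1 / N)"
        using r[OF j] by (intro mult_left_mono) auto
      also have "\<dots> \<le> \<epsilon> / 2" using N N0 \<open>\<epsilon> > 0\<close> by (simp add: field_simps)
      finally show "T * \<bar>of_int q * g j - of_int (r j)\<bar> \<le> \<epsilon> / 2" .
    qed
    finally show ?thesis by simp
  qed
  moreover have "k' \<ge> K" using kT by (simp add: k'_def)
  ultimately show ?thesis by (intro exI[of _ k'] conjI exI[of _ "\<lambda>j. m j + int T * r j"]) auto
qed

text \<open>From some index on each coordinate codes a rotation by \<open>g j\<close>, with
  \<open>n + 1\<close> phase windows that give different words. Kronecker's theorem reaches every
  choice \<open>e\<close> of one window per coordinate at a common index, and different choices show
  different words.\<close>

lemma balanced_tuple_complexity: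
  fixes y :: "nat \<Rightarrow> 'a" and f :: "nat \<Rightarrow> 'a \<Rightarrow> bool"
  assumes ind: "rationally_independent p g" and fin: "finite (range y)"
    and bal: "\<And>j k n. j < p \<Longrightarrow> \<bar>real (ones_count (map (\<lambda>i. f j (y i)) [k..<k+n])) - g j * n\<bar> \<le> 1"
  shows "(n + 1) ^ p \<le> card (range (\<lambda>k. map y [k..<k+n]))"
proof -
  define c where "c j k = ones_count (map (\<lambda>i. f j (y i)) [0..<k])" for j k
  have irr: "g j \<notin> \<rat>" if "j < p" for j by (rule rationally_independent_irrational[OF ind that])
  have "\<forall>j\<in>{..<p}. \<exists>bN. \<forall>n\<ge>snd bN. int (c j n) = \<lfloor>g j * n + fst bN\<rfloor>"
    using balanced_sequence_floor[OF bal irr] unfolding c_def by (metis lessThan_iff fst_conv snd_conv)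
  then obtain bN where bN: "\<And>j n. j < p \<Longrightarrow> n \<ge> snd (bN j) \<Longrightarrow> int (c j n) = \<lfloor>g j * n + fst (bN j)\<rfloor>"
    by (metis lessThan_iff)
  define K where "K = Max (insert 0 ((\<lambda>j. snd (bN j)) ` {..<p}))"
  have K: "snd (bN j) \<le> K" if "j < p" for j unfolding K_def using that by (intro Max_ge) auto
  define Q where "Q j te \<longleftrightarrow> snd te > 0 \<and> (\<forall>e\<le>n. snd te \<le> fst te e \<and> fst te e + snd te \<le> 1) \<and>
    (\<forall>e\<le>n. \<forall>e'\<le>n. \<forall>\<theta> \<theta>'. e \<noteq> e' \<longrightarrow> \<bar>\<theta> - fst te e\<bar> < snd te \<longrightarrow> \<bar>\<theta>' - fst te e'\<bar> < snd te \<longrightarrow>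
       (\<exists>i\<le>n. \<lfloor>\<theta> + g j * real i\<rfloor> \<noteq> \<lfloor>\<theta>' + g j * real i\<rfloor>))" for j and te :: "(nat \<Rightarrow> real) \<times> real"
  have "\<exists>te. Q j te" if "j < p" for j
  proof -
    from rotation_words_separated[OF irr[OF that], of n] obtain t \<epsilon> where "Q j (t, \<epsilon>)"
      unfolding Q_def fst_conv snd_conv by blast
    thus ?thesis by blast
  qed
  then obtain te where Q: "\<And>j. j < p \<Longrightarrow> Q j (te j)" by metis
  have te: "snd (te j) > 0" "e \<le> n \<Longrightarrow> snd (te j) \<le> fst (te j) e \<and> fst (te j) e + snd (te j) \<le> 1"
    "e \<le> n \<Longrightarrow> e' \<le> n \<Longrightarrow> e \<noteq> e' \<Longrightarrow> \<bar>\<theta> - fst (te j) e\<bar> < snd (te j) \<Longrightarrow>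
       \<bar>\<theta>' - fst (te j) e'\<bar> < snd (te j) \<Longrightarrow> \<exists>i\<le>n. \<lfloor>\<theta> + g j * real i\<rfloor> \<noteq> \<lfloor>\<theta>' + g j * real i\<rfloor>"
    if "j < p" for j e e' \<theta> \<theta>'
    using Q[OF that] unfolding Q_def by blast+
  define t where "t j = fst (te j)" for j
  define \<epsilon> where "\<epsilon> = Min (insert 1 ((\<lambda>j. snd (te j)) ` {..<p}))"
  have \<epsilon>: "\<epsilon> > 0" unfolding \<epsilon>_def using te(1) by (subst Min_gr_iff) auto
  have \<epsilon>_le: "\<epsilon> \<le> snd (te j)" if "j < p" for j unfolding \<epsilon>_def using that by (intro Min_le) auto
  let ?E = "PiE {..<p} (\<lambda>_. {..n})"
  have "\<exists>k\<ge>K. \<exists>m :: nat \<Rightarrow> int. \<forall>j<p. \<bar>real k * g j - of_int (m j) - (t j (e j) - fst (bN j))\<bar> < \<epsilon>" for e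
    by (rule kronecker_natural[OF ind \<epsilon>])
  then obtain k m where k: "\<And>e. k e \<ge> K"
    and km: "\<And>e j. j < p \<Longrightarrow> \<bar>real (k e) * g j - of_int (m e j :: int) - (t j (e j) - fst (bN j))\<bar> < \<epsilon>"
    by metis
  define th where "th e j = real (k e) * g j + fst (bN j) - of_int (m e j)" for e j
  have th: "\<bar>th e j - t j (e j)\<bar> < snd (te j)" if "j < p" for e j
    using km[OF that, of e] \<epsilon>_le[OF that] by (simp add: th_def algebra_simps)
  have word: "int (ones_count (map (\<lambda>i. f j (y i)) [k e..<k e+i])) = \<lfloor>th e j + g j * i\<rfloor> - \<lfloor>th e j\<rfloor>" if j: "j < p" for e j i
  proof -
    have "[0..<k e+i] = [0..<k e] @ [k e..<k e+i]" using upt_add_eq_append[of 0 "k e" i] by simp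
    hence "int (ones_count (map (\<lambda>i. f j (y i)) [k e..<k e+i])) = int (c j (k e + i)) - int (c j (k e))"
      by (simp add: c_def)
    also have "\<dots> = \<lfloor>g j * real (k e + i) + fst (bN j)\<rfloor> - \<lfloor>g j * real (k e) + fst (bN j)\<rfloor>"
      using bN[OF j] K[OF j] k[of e] by simp
    also have "g j * real (k e + i) + fst (bN j) = (th e j + g j * i) + of_int (m e j)"
      by (simp add: th_def algebra_simps)
    also have "g j * real (k e) + fst (bN j) = th e j + of_int (m e j)"
      by (simp add: th_def algebra_simps)
    finally show ?thesis by simp
  qed
  \<comment> \<open>The windows lie inside the unit interval. Counts of ones give only increments of
    the floor, and the initial value 0 makes them the floors themselves.\<close>
  have th0: "\<lfloor>th e j\<rfloor> = 0" if "j < p" "e j \<le> n" for e j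
    using th[OF that(1), of e] te(2)[OF that] by (intro floor_unique) (auto simp: t_def)
  have "inj_on (\<lambda>e. map y [k e..<k e+n]) ?E"
  proof (rule inj_onI, rule ccontr)
    fix e e' assume e: "e \<in> ?E" "e' \<in> ?E" "map y [k e..<k e+n] = map y [k e'..<k e'+n]" "e \<noteq> e'"
    then obtain j where j: "j < p" "e j \<noteq> e' j" using PiE_ext[OF e(1,2)] by auto
    have en: "e j \<le> n" "e' j \<le> n" using e j by auto
    obtain i where i: "i \<le> n" "\<lfloor>th e j + g j * real i\<rfloor> \<noteq> \<lfloor>th e' j + g j * real i\<rfloor>"
      using te(3)[OF j(1) en j(2) th[OF j(1), of e, unfolded t_def] th[OF j(1), of e', unfolded t_def]] by blast
    have tk: "take i (map (f j) (map y [k e..<k e+n])) = map (\<lambda>i. f j (y i)) [k e..<k e+i]" for e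
      using i by (simp add: take_map o_def)
    have "map (\<lambda>i. f j (y i)) [k e..<k e+i] = map (\<lambda>i. f j (y i)) [k e'..<k e'+i]"
      unfolding tk[symmetric] e(3) ..
    hence "\<lfloor>th e j + g j * i\<rfloor> - \<lfloor>th e j\<rfloor> = \<lfloor>th e' j + g j * i\<rfloor> - \<lfloor>th e' j\<rfloor>"
      unfolding word[OF j(1), symmetric] by simp
    thus False using i th0[of j e] th0[of j e'] j en by simp
  qed
  moreover have "finite (range (\<lambda>k. map y [k..<k+n]))"
    by (rule finite_subset[OF _ finite_lists_length_eq[OF fin, of n]]) auto
  ultimately have "card ?E \<le> card (range (\<lambda>k. map y [k..<k+n]))"
    by (intro card_inj_on_le) auto
  thus ?thesis by (simp add: card_PiE)
qed

section \<open>The coded tensor product\<close>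

text \<open>Comparable to the operator norm on nonnegative matrices, but additive over start
  vectors, so that it can be computed exactly state by state.\<close>

definition entry_sum :: "real mat \<Rightarrow> real" where
  "entry_sum M = (\<Sum>i<dim_row M. \<Sum>j<dim_col M. M $$ (i, j))"

definition nonneg_mat :: "real mat \<Rightarrow> bool" where
  "nonneg_mat M \<longleftrightarrow> (\<forall>i<dim_row M. \<forall>j<dim_col M. 0 \<le> M $$ (i, j))"

lemma vec_norm_L2: "vec_norm v = L2_set (\<lambda>i. vec_index v i) {..<dim_vec v}"
  by (simp add: vec_norm_def L2_set_def)

lemma mult_mat_vec_index:
  "i < dim_row M \<Longrightarrow> dim_vec v = dim_col M \<Longrightarrow>
    vec_index (M *\<^sub>v v) i = (\<Sum>j<dim_col M. M $$ (i, j) * vec_index v j)"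
  by (simp add: scalar_prod_def lessThan_atLeast0)

lemma vec_norm_mult_le:
  assumes M: "nonneg_mat M" and v: "dim_vec v = dim_col M" "vec_norm v \<le> 1"
  shows "vec_norm (M *\<^sub>v v) \<le> entry_sum M"
proof -
  have v1: "\<bar>vec_index v j\<bar> \<le> 1" if "j < dim_col M" for j
  proof -
    have "L2_set (\<lambda>i. \<bar>vec_index v i\<bar>) {..<dim_vec v} = vec_norm v" by (simp add: vec_norm_L2 L2_set_def)
    moreover have "\<bar>vec_index v j\<bar> \<le> L2_set (\<lambda>i. \<bar>vec_index v i\<bar>) {..<dim_vec v}"
      using that v by (intro member_le_L2_set) auto
    ultimately show ?thesis using v(2) by linarith
  qed
  have "vec_norm (M *\<^sub>v v) \<le> (\<Sum>i<dim_row M. \<bar>vec_index (M *\<^sub>v v) i\<bar>)"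
    unfolding vec_norm_L2 using L2_set_le_sum_abs[of "\<lambda>i. vec_index (M *\<^sub>v v) i" "{..<dim_row M}"] by simp
  also have "\<dots> \<le> (\<Sum>i<dim_row M. \<Sum>j<dim_col M. M $$ (i, j))"
  proof (rule sum_mono)
    fix i assume "i \<in> {..<dim_row M}"
    hence i: "i < dim_row M" by simp
    have "\<bar>vec_index (M *\<^sub>v v) i\<bar> \<le> (\<Sum>j<dim_col M. \<bar>M $$ (i, j) * vec_index v j\<bar>)"
      unfolding mult_mat_vec_index[OF i v(1)] by (rule sum_abs)
    also have "\<dots> \<le> (\<Sum>j<dim_col M. M $$ (i, j))"
    proof (rule sum_mono)
      fix j assume "j \<in> {..<dim_col M}"
      hence j: "j < dim_col M" by simp
      have "M $$ (i, j) \<ge> 0" using M i j by (simp add: nonneg_mat_def)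
      thus "\<bar>M $$ (i, j) * vec_index v j\<bar> \<le> M $$ (i, j)"
        using v1[OF j] mult_left_mono[of "\<bar>vec_index v j\<bar>" 1 "M $$ (i, j)"] by (simp add: abs_mult)
    qed
    finally show "\<bar>vec_index (M *\<^sub>v v) i\<bar> \<le> (\<Sum>j<dim_col M. M $$ (i, j))" .
  qed
  finally show ?thesis by (simp add: entry_sum_def)
qed

lemma op_norm_le_entry_sum:
  assumes "nonneg_mat M"
  shows "op_norm M \<le> entry_sum M"
  unfolding op_norm_def
proof (rule cSup_least)
  have "dim_vec (0\<^sub>v (dim_col M) :: real vec) = dim_col M \<and> vec_norm (0\<^sub>v (dim_col M)) \<le> 1"
    by (simp add: vec_norm_def)
  thus "{vec_norm (M *\<^sub>v v) |v. dim_vec v = dim_col M \<and> vec_norm v \<le> 1} \<noteq> {}" by blast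
qed (use vec_norm_mult_le[OF assms] in auto)

text \<open>The test vector is the normalised all-ones vector: its image lists the row sums divided
  by \<open>sqrt d\<close>, and Cauchy-Schwarz bounds their sum by the norm.\<close>

lemma entry_sum_le_op_norm:
  assumes M: "nonneg_mat M" "M \<in> carrier_mat d d" and d: "d > 0"
  shows "entry_sum M \<le> d * op_norm M"
proof -
  have dim: "dim_row M = d" "dim_col M = d" using M(2) by auto
  define v :: "real vec" where "v = vec d (\<lambda>_. 1 / sqrt d)"
  have v: "dim_vec v = d" "vec_norm v = 1"
    using d by (simp_all add: v_def vec_norm_def power_divide)
  define s where "s i = (\<Sum>j<d. M $$ (i, j))" for i
  have s: "s i \<ge> 0" if "i < d" for i
    unfolding s_def using that M by (intro sum_nonneg) (auto simp: nonneg_mat_def)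
  have idx: "vec_index (M *\<^sub>v v) i = s i * (1 / sqrt d)" if "i < d" for i
    using that dim v by (subst mult_mat_vec_index) (auto simp: v_def s_def sum_divide_distrib)
  have "entry_sum M = (\<Sum>i<d. s i)" by (simp add: entry_sum_def dim s_def)
  also have "\<dots> = d * (\<Sum>i<d. \<bar>vec_index (M *\<^sub>v v) i\<bar> * \<bar>1 / sqrt d\<bar>)"
  proof -
    have "s i = d * (\<bar>vec_index (M *\<^sub>v v) i\<bar> * \<bar>1 / sqrt d\<bar>)" if "i < d" for i
      using d s[OF that] by (simp add: idx[OF that] abs_mult)
    thus ?thesis unfolding sum_distrib_left by (intro sum.cong) auto
  qed
  also have "\<dots> \<le> d * (L2_set (\<lambda>i. vec_index (M *\<^sub>v v) i) {..<d} * L2_set (\<lambda>_. 1 / sqrt d) {..<d})"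
    by (intro mult_left_mono L2_set_mult_ineq) simp
  also have "L2_set (\<lambda>_. 1 / sqrt d) {..<d} = 1" using d by (simp add: L2_set_def power_divide)
  also have "L2_set (\<lambda>i. vec_index (M *\<^sub>v v) i) {..<d} = vec_norm (M *\<^sub>v v)"
    by (simp add: vec_norm_L2 dim)
  also have "d * (vec_norm (M *\<^sub>v v) * 1) \<le> d * op_norm M"
  proof -
    have "bdd_above {vec_norm (M *\<^sub>v v) |v. dim_vec v = dim_col M \<and> vec_norm v \<le> 1}"
      using vec_norm_mult_le[OF M(1)] by (intro bdd_aboveI) auto
    hence "vec_norm (M *\<^sub>v v) \<le> op_norm M"
      unfolding op_norm_def by (rule cSup_upper[rotated]) (use v dim in auto)
    thus ?thesis by (simp add: mult_left_mono)
  qed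
  finally show ?thesis .
qed

lemma word_prod_append_single:
  assumes "\<And>i. A i \<in> carrier_mat d d"
  shows "word_prod d A w \<in> carrier_mat d d" "word_prod d A (w @ [i]) = word_prod d A w * A i"
proof -
  show c: "word_prod d A w \<in> carrier_mat d d" for w
    by (induction w) (auto intro!: mult_carrier_mat[OF assms])
  show "word_prod d A (w @ [i]) = word_prod d A w * A i"
  proof (induction w)
    case Nil
    thus ?case using assms[of i] by simp
  next
    case (Cons k w)
    thus ?case using assoc_mult_mat[OF assms[of k] c[of w] assms[of i]] by simp
  qed
qed

lemma nonneg_mat_mult:
  assumes "nonneg_mat A" "nonneg_mat B" "A \<in> carrier_mat d d" "B \<in> carrier_mat d d"
  shows "nonneg_mat (A * B)"
proof -
  have "0 \<le> (A * B) $$ (i, j)" if "i < d" "j < d" for i j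
  proof -
    have "(A * B) $$ (i, j) = (\<Sum>k<d. A $$ (i, k) * B $$ (k, j))"
      using assms that by (simp add: scalar_prod_def lessThan_atLeast0)
    also have "\<dots> \<ge> 0" using assms that by (intro sum_nonneg mult_nonneg_nonneg) (auto simp: nonneg_mat_def)
    finally show ?thesis .
  qed
  thus ?thesis using assms by (simp add: nonneg_mat_def)
qed

lemma nonneg_word_prod:
  assumes "\<And>i. A i \<in> carrier_mat d d" "\<And>i. nonneg_mat (A i)"
  shows "nonneg_mat (word_prod d A w)"
proof (induction w)
  case (Cons k w)
  thus ?case
    using nonneg_mat_mult[OF assms(2) _ assms(1) word_prod_append_single(1)[of A d, OF assms(1)]] by simp
qed (simp add: nonneg_mat_def)

section \<open>Tensor products indexed by binary digits\<close>

lemma sum_even_odd: "(\<Sum>c<2 * n. f c) = (\<Sum>c<n. f (2 * c) + f (2 * c + 1))" for f :: "nat \<Rightarrow> real"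
  by (induction n) simp_all

text \<open>Expanding the product picks one summand from each bracket, and the bits of
  \<open>c\<close> enumerate the choices. This makes numbers below \<open>2^p\<close> usable as
  multi-indices of a \<open>p\<close>-fold tensor product.\<close>

lemma sum_prod_bits:
  fixes f :: "nat \<Rightarrow> bool \<Rightarrow> real"
  shows "(\<Sum>c<(2::nat)^p. \<Prod>j<p. f j (bit c j)) = (\<Prod>j<p. f j False + f j True)"
proof (induction p arbitrary: f)
  case (Suc p)
  have "(\<Sum>c<(2::nat)^Suc p. \<Prod>j<Suc p. f j (bit c j)) =
    (\<Sum>c<(2::nat)^p. f 0 False * (\<Prod>j<p. f (Suc j) (bit c j)) + f 0 True * (\<Prod>j<p. f (Suc j) (bit c j)))"
    by (simp add: sum_even_odd prod.lessThan_Suc_shift bit_Suc bit_0 del: prod.lessThan_Suc)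
  also have "\<dots> = (f 0 False + f 0 True) * (\<Sum>c<(2::nat)^p. \<Prod>j<p. f (Suc j) (bit c j))"
    by (simp add: sum.distrib sum_distrib_left distrib_right)
  also have "\<dots> = (\<Prod>j<Suc p. f j False + f j True)"
    by (simp add: Suc[of "\<lambda>j. f (Suc j)"] prod.lessThan_Suc_shift del: prod.lessThan_Suc)
  finally show ?case .
qed simp

definition coord :: "real \<times> real \<Rightarrow> bool \<Rightarrow> real" where
  "coord v r = (if r then snd v else fst v)"

definition entry :: "real \<Rightarrow> bool \<Rightarrow> bool \<Rightarrow> bool \<Rightarrow> real" where
  "entry a b r c = coord (act a b (if c then (0, 1) else (1, 0))) r"

lemma coord_ones [simp]: "coord (1, 1) b = 1"
  by (simp add: coord_def)

lemma coord_act: "coord (act a b v) r = entry a b r False * coord v False + entry a b r True * coord v True"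
  by (simp add: coord_def entry_def act_def algebra_simps)

text \<open>Entry of the Kronecker product of \<open>p\<close> two by two matrices; bit
  \<open>j\<close> of \<open>k\<close> selects the matrix of the \<open>j\<close>-th factor, and
  bits of \<open>r\<close> and \<open>c\<close> its row and column.\<close>

definition tensor_entry :: "nat \<Rightarrow> (nat \<Rightarrow> real) \<Rightarrow> nat \<Rightarrow> nat \<Rightarrow> nat \<Rightarrow> real" where
  "tensor_entry p \<alpha> k r c = (\<Prod>j<p. entry (\<alpha> j) (bit k j) (bit r j) (bit c j))"

lemma tensor_entry_apply:
  "(\<Sum>c<2^p. tensor_entry p \<alpha> k r c * (\<Prod>j<p. coord (F j) (bit c j))) =
    (\<Prod>j<p. coord (act (\<alpha> j) (bit k j) (F j)) (bit r j))"
  by (simp add: tensor_entry_def coord_act flip: prod.distrib)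
    (rule sum_prod_bits[where p = p and f = "\<lambda>j b. entry (\<alpha> j) (bit k j) (bit r j) b * coord (F j) b"])

text \<open>The symbol \<open>k < m\<close> is coded by the binary word of length \<open>m\<close> whose only \<open>1\<close> has index \<open>k\<close>.
  State \<open>i < m\<close> of the decoder: \<open>i\<close> letters of the current block have been read, all of them \<open>0\<close>;
  state \<open>m + i - 1\<close> for \<open>0 < i < m\<close>: \<open>i\<close> letters have been read, one of them being \<open>1\<close>.\<close>

definition decode_step :: "nat \<Rightarrow> nat \<Rightarrow> nat \<Rightarrow> nat option" where
  "decode_step m e s =
     (if s < m
      then if e = 0 then if s + 1 < m then Some (s + 1) else None
           else Some (if s + 1 < m then m + s else 0)
      else if e = 0 then Some (if s + 2 < 2 * m then s + 1 else 0) else None)"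

definition decode_emit :: "nat \<Rightarrow> nat \<Rightarrow> nat \<Rightarrow> nat list" where
  "decode_emit m e s = (if s < m \<and> e \<noteq> 0 then [s] else [])"

fun decode :: "nat \<Rightarrow> nat \<Rightarrow> nat list \<Rightarrow> (nat \<times> nat list) option" where
  "decode m s [] = Some (s, [])"
| "decode m s (e # w) = (case decode_step m e s of None \<Rightarrow> None
     | Some t \<Rightarrow> map_option (\<lambda>(r, y). (r, decode_emit m e s @ y)) (decode m t w))"

text \<open>Blocks are indexed by decoder states, the column by the current one and the row by the
  next. The tensor matrix of a symbol acts once, at the letter 1 of its code word; the other letters
  only move the decoder.\<close>

definition coding_mat :: "nat \<Rightarrow> (nat \<Rightarrow> real) \<Rightarrow> nat \<Rightarrow> real mat" where
  "coding_mat p \<alpha> e = mat (2^p * (2^(p+1) - 1)) (2^p * (2^(p+1) - 1)) (\<lambda>(i, j).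
     if decode_step (2^p) e (j div 2^p) = Some (i div 2^p)
     then if j div 2^p < 2^p \<and> e \<noteq> 0 then tensor_entry p \<alpha> (j div 2^p) (i mod 2^p) (j mod 2^p)
          else if i mod 2^p = j mod 2^p then 1 else 0
     else 0)"

text \<open>The pure tensor of the vectors \<open>F j\<close>, placed in the block of state
  \<open>s\<close>.\<close>

definition block_vec :: "nat \<Rightarrow> nat \<Rightarrow> (nat \<Rightarrow> real \<times> real) \<Rightarrow> real vec" where
  "block_vec p s F = vec (2^p * (2^(p+1) - 1)) (\<lambda>i.
     if i div 2^p = s then \<Prod>j<p. coord (F j) (bit (i mod 2^p) j) else 0)"

definition path_weight :: "nat \<Rightarrow> (nat \<Rightarrow> real) \<Rightarrow> nat \<Rightarrow> nat list \<Rightarrow> real" where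
  "path_weight p \<alpha> s w = (case decode (2^p) s w of None \<Rightarrow> 0
     | Some (t, y) \<Rightarrow> \<Prod>j<p. weight (\<alpha> j) (map (\<lambda>k. bit k j) y))"

lemma sum_block:
  fixes f :: "nat \<Rightarrow> real"
  assumes "s < n"
  shows "(\<Sum>j<m * n. if j div m = s then f (j mod m) else 0) = (\<Sum>c<m. f c)"
proof -
  have "(\<Sum>j<m * n. if j div m = s then f (j mod m) else 0) = (\<Sum>j\<in>{j. j < m * n \<and> j div m = s}. f (j mod m))"
    by (subst sum.inter_filter[symmetric]) auto
  also have "\<dots> = (\<Sum>c<m. f c)"
  proof (rule sum.reindex_bij_witness[of _ "\<lambda>c. s * m + c" "\<lambda>j. j mod m"])
    fix j assume "j \<in> {j. j < m * n \<and> j div m = s}"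
    moreover from this have "m > 0" by (cases m) auto
    ultimately show "s * m + j mod m = j" "j mod m \<in> {..<m}" by auto
  next
    fix c assume c: "c \<in> {..<m}"
    have "s * m + c < (s + 1) * m" using c by simp
    also have "\<dots> \<le> n * m" using assms by (intro mult_right_mono) auto
    finally show "s * m + c \<in> {j. j < m * n \<and> j div m = s}" using c by (auto simp: mult.commute)
  qed auto
  finally show ?thesis .
qed

lemma coding_mat_carrier: "coding_mat p \<alpha> e \<in> carrier_mat (2^p * (2^(p+1) - 1)) (2^p * (2^(p+1) - 1))"
  by (simp add: coding_mat_def)

lemma entry_nonneg: "a > 0 \<Longrightarrow> entry a b r c \<ge> 0"
  by (simp add: entry_def coord_def act_def)

lemma nonneg_coding_mat: 
  assumes "\<And>j. j < p \<Longrightarrow> \<alpha> j > 0" shows "nonneg_mat (coding_mat p \<alpha> e)"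
proof -
  have t: "0 \<le> tensor_entry p \<alpha> k r c" for k r c
    unfolding tensor_entry_def by (intro prod_nonneg entry_nonneg assms) auto
  show ?thesis unfolding nonneg_mat_def by (simp add: coding_mat_def t)
qed

lemma decode_step_less: "m > 0 \<Longrightarrow> s < 2 * m - 1 \<Longrightarrow> decode_step m e s = Some t \<Longrightarrow> t < 2 * m - 1"
  by (auto simp: decode_step_def split: if_splits)

lemma decode_less:
  assumes "m > 0"
  shows "s < 2 * m - 1 \<Longrightarrow> decode m s w = Some (t, y) \<Longrightarrow> t < 2 * m - 1"
proof (induction w arbitrary: s y)
  case (Cons e w)
  then obtain r y' where "decode_step m e s = Some r" "decode m r w = Some (t, y')"
    by (auto split: option.splits)
  thus ?case using Cons decode_step_less[OF assms] by blast
qed simp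

lemma coding_mat_block_vec:
  assumes "s < 2 * 2^p - 1"
  shows "coding_mat p \<alpha> e *\<^sub>v block_vec p s F = (case decode_step (2^p) e s of
      None \<Rightarrow> 0\<^sub>v (2^p * (2^(p+1) - 1))
    | Some t \<Rightarrow> block_vec p t (\<lambda>j. orb (\<alpha> j) (map (\<lambda>k. bit k j) (decode_emit (2^p) e s)) (F j)))"
    (is "?l = ?r")
proof (rule eq_vecI)
  let ?m = "2^p :: nat" and ?D = "2^p * (2^(p+1) - 1) :: nat"
  show dim: "dim_vec ?l = dim_vec ?r"
    by (simp add: coding_mat_def block_vec_def split: option.split)
  fix i assume "i < dim_vec ?r"
  hence i: "i < ?D" using dim by (simp add: coding_mat_def)
  let ?q = "\<lambda>c. if decode_step ?m e s = Some (i div ?m)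
     then if s < ?m \<and> e \<noteq> 0 then tensor_entry p \<alpha> s (i mod ?m) c
          else if i mod ?m = c then 1 else 0 else 0"
  let ?P = "\<lambda>c. \<Prod>j<p. coord (F j) (bit c j)"
  have "vec_index ?l i = (\<Sum>j<?D. coding_mat p \<alpha> e $$ (i, j) * vec_index (block_vec p s F) j)"
    using i by (subst mult_mat_vec_index) (auto simp: coding_mat_def block_vec_def)
  also have "\<dots> = (\<Sum>j<?D. if j div ?m = s then ?q (j mod ?m) * ?P (j mod ?m) else 0)"
    using i by (intro sum.cong) (auto simp: coding_mat_def block_vec_def)
  also have "\<dots> = (\<Sum>c<?m. ?q c * ?P c)" by (rule sum_block) (use assms in simp)
  also have "\<dots> = vec_index ?r i"
  proof (cases "decode_step ?m e s = Some (i div ?m)")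
    case False
    thus ?thesis using i by (auto simp: block_vec_def split: option.split)
  next
    case True
    show ?thesis
    proof (cases "s < ?m \<and> e \<noteq> 0")
      case 1: True
      thus ?thesis using True i by (simp add: tensor_entry_apply block_vec_def decode_emit_def)
    next
      case False
      have "(\<Sum>c<?m. ?q c * ?P c) = (\<Sum>c<?m. if c = i mod ?m then ?P c else 0)"
        using True False by (intro sum.cong) auto
      also have "\<dots> = ?P (i mod ?m)" by simp
      finally show ?thesis using True False i by (auto simp: block_vec_def decode_emit_def)
    qed
  qed
  finally show "vec_index ?l i = vec_index ?r i" .
qed

text \<open>A pure tensor in one block is sent to a pure tensor in one block or to zero, so a
  product of coding matrices is evaluated by running the decoder. The word is reversed because its
  first letter acts first.\<close>

lemma word_prod_block_vec:
  assumes "s < 2 * 2^p - 1"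
  shows "word_prod (2^p * (2^(p+1) - 1)) (coding_mat p \<alpha>) (rev w) *\<^sub>v block_vec p s F =
    (case decode (2^p) s w of None \<Rightarrow> 0\<^sub>v (2^p * (2^(p+1) - 1))
    | Some (t, y) \<Rightarrow> block_vec p t (\<lambda>j. orb (\<alpha> j) (map (\<lambda>k. bit k j) y) (F j)))"
  using assms
proof (induction w arbitrary: s F)
  case Nil
  have "block_vec p s F \<in> carrier_vec (2^p * (2^(p+1) - 1))" by (simp add: block_vec_def)
  thus ?case by simp
next
  case (Cons e w)
  let ?D = "2^p * (2^(p+1) - 1) :: nat" and ?W = "word_prod (2^p * (2^(p+1) - 1)) (coding_mat p \<alpha>) (rev w)"
  have W: "?W \<in> carrier_mat ?D ?D" by (rule word_prod_append_single(1)[of "coding_mat p \<alpha>", OF coding_mat_carrier])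
  have "block_vec p s F \<in> carrier_vec ?D" by (simp add: block_vec_def)
  hence "word_prod ?D (coding_mat p \<alpha>) (rev (e # w)) *\<^sub>v block_vec p s F =
    ?W *\<^sub>v (coding_mat p \<alpha> e *\<^sub>v block_vec p s F)"
    using assoc_mult_mat_vec[OF W coding_mat_carrier] word_prod_append_single(2)[of "coding_mat p \<alpha>", OF coding_mat_carrier] by simp
  also have "\<dots> = (case decode (2^p) s (e # w) of None \<Rightarrow> 0\<^sub>v ?D
    | Some (t, y) \<Rightarrow> block_vec p t (\<lambda>j. orb (\<alpha> j) (map (\<lambda>k. bit k j) y) (F j)))"
  proof (cases "decode_step (2^p) e s")
    case None
    have "?W *\<^sub>v 0\<^sub>v ?D = 0\<^sub>v ?D" using W by (intro eq_vecI) (auto simp: scalar_prod_def)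
    thus ?thesis using None by (simp add: coding_mat_block_vec[OF Cons.prems])
  next
    case (Some t)
    have "t < 2 * 2^p - 1" by (rule decode_step_less[OF _ Cons.prems Some]) simp
    from Cons.IH[OF this] show ?thesis using Some
      by (simp add: coding_mat_block_vec[OF Cons.prems] split: option.splits prod.splits)
  qed
  finally show ?case .
qed

lemma sum_block_vec:
  assumes "s < 2 * 2^p - 1"
  shows "(\<Sum>i<2^p * (2^(p+1) - 1). vec_index (block_vec p s F) i) = (\<Prod>j<p. mass (F j))"
proof -
  have "(\<Sum>i<2^p * (2^(p+1) - 1). vec_index (block_vec p s F) i) =
    (\<Sum>i<2^p * (2^(p+1) - 1). if i div 2^p = s then \<Prod>j<p. coord (F j) (bit (i mod 2^p) j) else 0)"
    by (intro sum.cong) (auto simp: block_vec_def)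
  also have "\<dots> = (\<Sum>c<(2::nat)^p. \<Prod>j<p. coord (F j) (bit c j))"
    by (rule sum_block[where f = "\<lambda>c. \<Prod>j<p. coord (F j) (bit c j)"]) (use assms in simp)
  also have "\<dots> = (\<Prod>j<p. coord (F j) False + coord (F j) True)" by (rule sum_prod_bits)
  finally show ?thesis by (simp add: coord_def mass_def)
qed

text \<open>The all-ones vector is the sum over the states of the block vectors with all factors
  \<open>(1, 1)\<close>, and each of these is followed by
  \<open>word_prod_block_vec\<close>.\<close>

lemma entry_sum_word_prod:
  "entry_sum (word_prod (2^p * (2^(p+1) - 1)) (coding_mat p \<alpha>) (rev w)) =
     (\<Sum>s<2 * 2^p - 1. path_weight p \<alpha> s w)"
proof -
  let ?D = "2^p * (2^(p+1) - 1) :: nat" and ?W = "word_prod (2^p * (2^(p+1) - 1)) (coding_mat p \<alpha>) (rev w)"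
  let ?e = "\<lambda>s. block_vec p s (\<lambda>_. (1, 1))" and ?n = "2 * 2^p - 1 :: nat"
  have W: "dim_row ?W = ?D" "dim_col ?W = ?D"
    using word_prod_append_single(1)[of "coding_mat p \<alpha>", OF coding_mat_carrier, of "rev w"] by auto
  have one: "(\<Sum>s<?n. vec_index (?e s) j) = 1" if "j < ?D" for j
  proof -
    have "j div 2^p < ?n" using that by (simp add: less_mult_imp_div_less mult.commute)
    moreover have "(\<Sum>s<?n. vec_index (?e s) j) = (\<Sum>s<?n. if s = j div 2^p then 1 else 0)"
      using that by (intro sum.cong) (auto simp: block_vec_def)
    ultimately show ?thesis by simp
  qed
  have "entry_sum ?W = (\<Sum>i<?D. \<Sum>j<?D. ?W $$ (i, j) * (\<Sum>s<?n. vec_index (?e s) j))"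
    unfolding entry_sum_def W by (intro sum.cong refl, subst one) auto
  also have "\<dots> = (\<Sum>i<?D. \<Sum>s<?n. \<Sum>j<?D. ?W $$ (i, j) * vec_index (?e s) j)"
    unfolding sum_distrib_left by (intro sum.cong refl sum.swap)
  also have "\<dots> = (\<Sum>s<?n. \<Sum>i<?D. \<Sum>j<?D. ?W $$ (i, j) * vec_index (?e s) j)"
    by (rule sum.swap)
  also have "\<dots> = (\<Sum>s<?n. \<Sum>i<?D. vec_index (?W *\<^sub>v ?e s) i)"
    using W by (intro sum.cong refl, subst mult_mat_vec_index) (auto simp: block_vec_def)
  also have "\<dots> = (\<Sum>s<?n. path_weight p \<alpha> s w)"
  proof (rule sum.cong)
    fix s assume "s \<in> {..<?n}"
    hence s: "s < ?n" by simp
    show "(\<Sum>i<?D. vec_index (?W *\<^sub>v ?e s) i) = path_weight p \<alpha> s w"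
    proof (cases "decode (2^p) s w")
      case None
      thus ?thesis unfolding word_prod_block_vec[OF s] by (simp add: path_weight_def)
    next
      case (Some ty)
      obtain t y where ty: "ty = (t, y)" by (cases ty)
      have "t < ?n" by (rule decode_less[OF _ s]) (use Some ty in auto)
      thus ?thesis unfolding word_prod_block_vec[OF s] using Some ty
        by (simp add: path_weight_def sum_block_vec weight_def del: One_nat_def)
    qed
  qed simp
  finally show ?thesis .
qed

lemma decode_append:
  "decode m s (u @ w) = (case decode m s u of None \<Rightarrow> None
     | Some (t, y) \<Rightarrow> map_option (\<lambda>(r, z). (r, y @ z)) (decode m t w))"
proof (induction u arbitrary: s)
  case Nil
  show ?case by (cases "decode m s w") auto
next
  case (Cons e u)
  show ?case
    by (cases "decode_step m e s")
      (auto simp: Cons option.map_comp o_def case_prod_unfold split: option.splits)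
qed

text \<open>The phase grows by \<open>1\<close> with each letter read and drops by \<open>m\<close> with each symbol emitted, so it
  determines the number of emitted symbols.\<close>

definition phase :: "nat \<Rightarrow> nat \<Rightarrow> int" where
  "phase m s = (if s < m then int s else int s + 1 - 2 * int m)"

lemma phase_bounds:
  assumes "s < 2 * m - 1" shows "\<bar>phase m s\<bar> < int m"
  using assms by (auto simp: phase_def)

lemma phase_zero: "s < 2 * m - 1 \<Longrightarrow> phase m s = 0 \<Longrightarrow> s = 0"
  by (auto simp: phase_def split: if_splits)

lemma phase_step:
  assumes "m > 0" "s < 2 * m - 1" "decode_step m e s = Some t"
  shows "phase m t = phase m s + 1 - int m * int (length (decode_emit m e s))"
  using assms by (auto simp: phase_def decode_step_def decode_emit_def split: if_splits)

lemma decode_phase: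
  assumes "m > 0"
  shows "s < 2 * m - 1 \<Longrightarrow> decode m s w = Some (t, y) \<Longrightarrow>
    phase m t = phase m s + int (length w) - int m * int (length y)"
proof (induction w arbitrary: s y)
  case (Cons e w)
  then obtain r y' where r: "decode_step m e s = Some r" "decode m r w = Some (t, y')"
    and y: "y = decode_emit m e s @ y'"
    by (auto split: option.splits)
  have "phase m t = phase m r + int (length w) - int m * int (length y')"
    using Cons.IH r decode_step_less[OF assms] Cons.prems by blast
  thus ?case using phase_step[OF assms Cons.prems(1) r(1)] by (simp add: y algebra_simps)
qed simp

text \<open>The phases at the two ends are below \<open>m\<close> in absolute value, so
  \<open>m * length y\<close> and \<open>length w\<close> differ by less than
  \<open>2 * m\<close>.\<close>

lemma decode_length:
  assumes "m > 0" "s < 2 * m - 1" "decode m s w = Some (t, y)"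
  shows "m * length y \<le> length w + 2 * m" "length w \<le> m * length y + 2 * m"
proof -
  have "t < 2 * m - 1" by (rule decode_less[OF assms])
  note * = phase_bounds[OF this] phase_bounds[OF assms(2)] decode_phase[OF assms]
  have "int (m * length y) \<le> int (length w + 2 * m)" "int (length w) \<le> int (m * length y + 2 * m)"
    using * by (simp_all add: abs_less_iff)
  thus "m * length y \<le> length w + 2 * m" "length w \<le> m * length y + 2 * m" by linarith+
qed

lemma decode_set: "decode m s w = Some (t, y) \<Longrightarrow> set y \<subseteq> {..<m}"
proof (induction w arbitrary: s y)
  case (Cons e w)
  then obtain r y' where "decode m r w = Some (t, y')" "y = decode_emit m e s @ y'"
    by (auto split: option.splits)
  thus ?case using Cons.IH[of r y'] by (auto simp: decode_emit_def)
qed simp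

section \<open>Coded sequences and their complexity\<close>

text \<open>Right inverse of the decoder in state 0. Indices start at 0, hence the shift
  \<open>i - 1\<close> where it is used as a sequence starting at index 1.\<close>

definition code_seq :: "nat \<Rightarrow> (nat \<Rightarrow> nat) \<Rightarrow> nat \<Rightarrow> nat" where
  "code_seq m y i = (if i mod m = y (i div m) then 1 else 0)"

text \<open>The cases tell whether the letter 1 of the unfinished block is still to come or has been
  read; in the latter case its symbol is already emitted, hence
  \<open>Suc (n div m)\<close>.\<close>

lemma decode_code_seq:
  assumes "m > 0" "\<And>i. y i < m"
  shows "decode m 0 (map (code_seq m y) [0..<n]) =
    (if n mod m \<le> y (n div m) then Some (n mod m, map y [0..<n div m])
     else Some (m + n mod m - 1, map y [0..<Suc (n div m)]))"
proof (induction n)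
  case (Suc n)
  define q where "q = n div m"
  define r where "r = n mod m"
  have r: "r < m" using assms by (simp add: r_def)
  have div_mod: "Suc n mod m = (if Suc r = m then 0 else Suc r)" "Suc n div m = (if Suc r = m then Suc q else q)"
    by (simp_all add: mod_Suc div_Suc r_def q_def)
  have y: "y q < m" by (rule assms)
  have code: "code_seq m y n = (if r = y q then 1 else 0)" by (simp add: code_seq_def r_def q_def)
  show ?case
    using r y Suc[folded q_def r_def]
    by (simp add: decode_append div_mod code, cases r "y q" rule: linorder_cases)
      (auto simp: decode_step_def decode_emit_def)
qed simp

lemma symbol_eqI:
  assumes "k < 2 ^ p" "l < 2 ^ p" "\<And>j. j < p \<Longrightarrow> bit k j \<longleftrightarrow> bit (l :: nat) j"
  shows "k = l"
proof -
  have "take_bit p k = take_bit p l" by (rule bit_eqI) (use assms(3) in \<open>auto simp: bit_take_bit_iff\<close>)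
  thus ?thesis using assms(1,2) by (simp add: take_bit_nat_eq_self)
qed

lemma symbol_exists: "\<exists>k<2 ^ p. \<forall>j<p. bit (k :: nat) j \<longleftrightarrow> f j"
proof (intro exI conjI allI impI)
  let ?k = "horner_sum of_bool 2 (map f [0..<p]) :: nat"
  show "?k < 2 ^ p" using horner_sum_of_bool_2_less[of "map f [0..<p]"] by simp
  show "bit ?k j \<longleftrightarrow> f j" if "j < p" for j using that by (simp add: bit_horner_sum_bit_iff)
qed

text \<open>A symbol below \<open>2^p\<close> is determined by its first \<open>p\<close> bits, so
  words of symbols embed into the product of the sets of coordinate words.\<close>

lemma symbol_words_card:
  fixes y :: "nat \<Rightarrow> nat"
  assumes "\<And>i. y i < 2 ^ p"
    and "\<And>j. j < p \<Longrightarrow> card (range (\<lambda>k. map (\<lambda>i. bit (y i) j) [k..<k+n])) \<le> n + 1"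
  shows "card (range (\<lambda>k. map y [k..<k+n])) \<le> (n + 1) ^ p" "finite (range (\<lambda>k. map y [k..<k+n]))"
proof -
  let ?Y = "range (\<lambda>k. map y [k..<k+n])"
  let ?F = "\<lambda>j. range (\<lambda>k. map (\<lambda>i. bit (y i) j) [k..<k+n])"
  have finF: "finite (?F j)" for j
    by (rule finite_subset[OF _ finite_bool_lists[of n]]) auto
  let ?\<phi> = "\<lambda>w. \<lambda>j\<in>{..<p}. map (\<lambda>k. bit k j) w"
  have inj: "inj_on ?\<phi> ?Y"
  proof (rule inj_onI)
    fix u w assume u: "u \<in> ?Y" and w: "w \<in> ?Y" and eq: "?\<phi> u = ?\<phi> w"
    have len: "length u = n" "length w = n" using u w by auto
    show "u = w"
    proof (rule nth_equalityI)
      fix i assume i: "i < length u"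
      show "u ! i = w ! i"
      proof (rule symbol_eqI[of _ p])
        have "set u \<subseteq> range y" "set w \<subseteq> range y" using u w by auto
        moreover have "u ! i \<in> set u" "w ! i \<in> set w" using i len by simp_all
        ultimately show "u ! i < 2 ^ p" "w ! i < 2 ^ p" using assms(1) by auto
        fix j assume j: "j < p"
        have "map (\<lambda>k. bit k j) u = map (\<lambda>k. bit k j) w" using fun_cong[OF eq, of j] j by simp
        thus "bit (u ! i) j \<longleftrightarrow> bit (w ! i) j" using i len by (metis nth_map)
      qed
    qed (simp add: len)
  qed
  have sub: "?\<phi> ` ?Y \<subseteq> PiE {..<p} ?F"
  proof clarify
    fix k
    show "?\<phi> (map y [k..<k+n]) \<in> PiE {..<p} ?F" by (simp add: restrict_PiE_iff o_def)
  qed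
  have finP: "finite (PiE {..<p} ?F)" by (intro finite_PiE finF) auto
  show "finite ?Y" by (rule finite_imageD[OF finite_subset[OF sub finP] inj])
  have "card ?Y \<le> card (PiE {..<p} ?F)" by (rule card_inj_on_le[OF inj sub finP])
  also have "\<dots> = (\<Prod>j<p. card (?F j))" by (simp add: card_PiE)
  also have "\<dots> \<le> (\<Prod>j<p. n + 1)" by (intro prod_mono) (use assms(2) in auto)
  finally show "card ?Y \<le> (n + 1) ^ p" by simp
qed

text \<open>A window of length at most \<open>m * q\<close> meets at most \<open>q + 1\<close>
  consecutive blocks; it is determined by its offset in the first one, \<open>m\<close> choices, and
  by their symbols.\<close>

lemma code_seq_complexity:
  assumes m: "m > 0" and n: "n \<le> m * q"
    and fin: "finite (range (\<lambda>k. map y [k..<k+(q+1)]))"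
  shows "complexity (\<lambda>i. code_seq m y (i - 1)) n \<le> m * card (range (\<lambda>k. map y [k..<k+(q+1)]))"
proof -
  let ?Y = "range (\<lambda>k. map y [k..<k+(q+1)])"
  define G where "G = (\<lambda>(r, w). map (\<lambda>i. if (r + i) mod m = w ! ((r + i) div m) then 1 else 0 :: nat) [0..<n])"
  have "{subword (\<lambda>i. code_seq m y (i - 1)) k n |k. True} \<subseteq> G ` ({..<m} \<times> ?Y)"
  proof clarify
    fix k
    let ?r = "k mod m" and ?Q = "k div m"
    have "subword (\<lambda>i. code_seq m y (i - 1)) k n = G (?r, map y [?Q..<?Q+(q+1)])"
      unfolding subword_def G_def prod.case
    proof (rule map_cong[OF refl])
      fix i assume "i \<in> set [0..<n]"
      hence i: "i < n" by simp
      have r: "?r < m" using m by simp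
      have "?r + i < m * (q + 1)" using r i n by (simp add: algebra_simps)
      hence lt: "(?r + i) div m < q + 1" using m by (simp add: less_mult_imp_div_less mult.commute)
      have "k + i = ?r + i + m * ?Q" by simp
      hence "(k + i) mod m = (?r + i) mod m" "(k + i) div m = ?Q + (?r + i) div m"
        using m by (simp_all only: mod_mult_self2 div_mult_self2)
      thus "code_seq m y (k + 1 + i - 1) = (if (?r + i) mod m = map y [?Q..<?Q+(q+1)] ! ((?r + i) div m) then 1 else 0)"
        using lt by (simp add: code_seq_def del: upt_Suc)
    qed
    thus "subword (\<lambda>i. code_seq m y (i - 1)) k n \<in> G ` ({..<m} \<times> ?Y)" using m by auto
  qed
  hence "complexity (\<lambda>i. code_seq m y (i - 1)) n \<le> card (G ` ({..<m} \<times> ?Y))"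
    unfolding complexity_def by (intro card_mono) (use fin in auto)
  also have "\<dots> \<le> card ({..<m} \<times> ?Y)" by (intro card_image_le) (use fin in auto)
  finally show ?thesis by (simp only: card_cartesian_product card_lessThan)
qed

section \<open>Growth rate of the coded pair\<close>

locale tensor_coding =
  fixes p :: nat and \<alpha> :: "nat \<Rightarrow> real"
  assumes \<alpha>: "\<And>j. \<alpha> j > 0"
begin

definition m :: nat where "m = 2 ^ p"
definition states :: nat where "states = 2 * 2 ^ p - 1"
definition d :: nat where "d = 2 ^ p * (2 ^ (p + 1) - 1)"
abbreviation B :: "nat \<Rightarrow> real mat" where "B \<equiv> coding_mat p \<alpha>"

lemma m_pos: "m > 0"
  by (simp add: m_def)

lemma states_eq: "states = 2 * m - 1"
  by (simp add: states_def m_def)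

lemma states_pos: "states > 0"
  using m_pos by (simp add: states_eq)

lemma d_pos: "d > 0"
proof -
  have "d = m * states" by (simp add: d_def m_def states_def)
  thus ?thesis using m_pos states_pos by simp
qed

lemma B_carrier: "B e \<in> carrier_mat d d"
  unfolding d_def by (rule coding_mat_carrier)

lemma entry_sum_path: "entry_sum (word_prod d B (rev w)) = (\<Sum>s<states. path_weight p \<alpha> s w)"
  unfolding d_def states_def by (rule entry_sum_word_prod)

definition base :: real where "base = (\<Prod>j<p. growth (\<alpha> j))"
text \<open>Growth per letter: a symbol is worth \<open>base\<close> and is spread over
  \<open>m\<close> letters.\<close>

definition rate :: real where "rate = root m base"

definition symbol_weight :: "nat list \<Rightarrow> real" where
  "symbol_weight y = (\<Prod>j<p. weight (\<alpha> j) (map (\<lambda>k. bit k j) y))"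

lemma base_ge_1: "base \<ge> 1"
  unfolding base_def by (intro prod_ge_1) (use growth_ge[OF \<alpha>] in auto)

lemma rate_ge_1: "rate \<ge> 1"
  unfolding rate_def using base_ge_1 m_pos by (simp add: real_root_ge_1_iff)

lemma rate_power: "rate ^ (m * n) = base ^ n"
  using base_ge_1 m_pos by (simp add: rate_def power_mult)

lemma symbol_weight_le: "symbol_weight y \<le> 5 ^ p * base ^ length y"
proof -
  have "symbol_weight y \<le> (\<Prod>j<p. 5 * growth (\<alpha> j) ^ length y)"
    unfolding symbol_weight_def
    using weight_le_growth[OF \<alpha>, of _ "map (\<lambda>k. bit k _) y"] weight_pos[OF \<alpha>]
    by (intro prod_mono) (auto intro: less_imp_le)
  thus ?thesis by (simp add: prod.distrib base_def prod_power_distrib)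
qed

lemma symbol_weight_pos: "symbol_weight y > 0"
  unfolding symbol_weight_def by (intro prod_pos) (use weight_pos[OF \<alpha>] in auto)

lemma path_weight_eq:
  "path_weight p \<alpha> s w = (case decode m s w of None \<Rightarrow> 0 | Some (t, y) \<Rightarrow> symbol_weight y)"
  by (simp add: path_weight_def symbol_weight_def m_def split: option.split)

lemma path_weight_nonneg: "path_weight p \<alpha> s w \<ge> 0"
  using symbol_weight_pos by (auto simp: path_weight_eq less_imp_le split: option.split)

lemma path_weight_le:
  assumes "s < states"
  shows "path_weight p \<alpha> s w \<le> 5 ^ p * rate ^ (2 * m) * rate ^ length w"
proof (cases "decode m s w")
  case None
  thus ?thesis using rate_ge_1 by (simp add: path_weight_eq)
next
  case (Some ty)
  obtain t y where ty: "ty = (t, y)" by (cases ty)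
  have "path_weight p \<alpha> s w \<le> 5 ^ p * base ^ length y"
    using Some ty symbol_weight_le by (simp add: path_weight_eq)
  also have "base ^ length y = rate ^ (m * length y)" by (simp add: rate_power)
  also have "\<dots> \<le> rate ^ (2 * m + length w)"
    using decode_length(1)[OF m_pos assms[unfolded states_eq], of w t y] Some ty rate_ge_1 by (intro power_increasing) auto
  finally show ?thesis by (simp add: power_add mult_ac)
qed

definition upper_const :: real where
  "upper_const = real (states) * (5 ^ p * rate ^ (2 * m))"

lemma upper_const_pos: "upper_const > 0"
proof -
  have "real states > 0" using states_pos by simp
  moreover have "5 ^ p * rate ^ (2 * m) > 0" using rate_ge_1 by simp
  ultimately show ?thesis unfolding upper_const_def by (rule mult_pos_pos)
qed

lemma nonneg_B: "nonneg_mat (word_prod d B w)"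
  by (intro nonneg_word_prod B_carrier nonneg_coding_mat \<alpha>)

lemma op_norm_le_path:
  "op_norm (word_prod d B (rev w)) \<le> (\<Sum>s<states. path_weight p \<alpha> s w)"
  using op_norm_le_entry_sum[OF nonneg_B] by (simp flip: entry_sum_path)

lemma op_norm_ge_path:
  assumes "s < states"
  shows "path_weight p \<alpha> s w / d \<le> op_norm (word_prod d B (rev w))"
proof -
  have "path_weight p \<alpha> s w \<le> (\<Sum>s<states. path_weight p \<alpha> s w)"
    using assms path_weight_nonneg by (intro member_le_sum) auto
  also have "\<dots> \<le> d * op_norm (word_prod d B (rev w))"
    using entry_sum_le_op_norm[OF nonneg_B word_prod_append_single(1)[of B, OF B_carrier] d_pos]
    by (simp flip: entry_sum_path)
  finally show ?thesis using d_pos by (simp add: pos_divide_le_eq mult.commute)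
qed

lemma op_norm_le: "op_norm (word_prod d B w) \<le> upper_const * rate ^ length w"
proof -
  have "op_norm (word_prod d B w) \<le> (\<Sum>s<states. path_weight p \<alpha> s (rev w))"
    using op_norm_le_path[of "rev w"] by simp
  also have "\<dots> \<le> (\<Sum>s<states. 5 ^ p * rate ^ (2 * m) * rate ^ length w)"
    using path_weight_le[of _ "rev w"] by (intro sum_mono) auto
  finally show ?thesis by (simp add: upper_const_def mult_ac)
qed

text \<open>\<open>jsr\<close> is a \<open>lim\<close>, so convergence has to be shown along with
  the value: \<open>op_norm_le\<close> bounds all words from above, the hypothesis one word per
  length from below, and both constants disappear under the \<open>n\<close>-th root.\<close>

lemma jsr_eq:
  assumes c: "c > 0" and low: "\<And>n. \<exists>w. length w = n \<and> set w \<subseteq> {..<2} \<and> c * rate ^ n \<le> op_norm (word_prod d B w)"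
  shows "jsr d 2 B = rate"
proof -
  let ?S = "\<lambda>n. {root n (op_norm (word_prod d B w)) |w. length w = n \<and> set w \<subseteq> {..<2}}"
  have fin: "finite (?S n)" for n
  proof -
    have "?S n = (\<lambda>w. root n (op_norm (word_prod d B w))) ` {w. set w \<subseteq> {..<2} \<and> length w = n}" by auto
    thus ?thesis using finite_lists_length_eq[of "{..<2::nat}" n] by simp
  qed
  have rt: "root n (k * rate ^ n) = root n k * rate" if "n > 0" for n k
    using that rate_ge_1 by (simp add: real_root_mult real_root_power_cancel)
  have bounds: "root n c * rate \<le> Max (?S n) \<and> Max (?S n) \<le> root n upper_const * rate" if "n > 0" for n
  proof
    obtain w where w: "length w = n" "set w \<subseteq> {..<2}" "c * rate ^ n \<le> op_norm (word_prod d B w)"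
      using low by blast
    have "root n c * rate \<le> root n (op_norm (word_prod d B w))"
      unfolding rt[OF that, symmetric] using w that by (simp add: real_root_le_iff)
    also have "\<dots> \<le> Max (?S n)" by (intro Max_ge fin) (use w in auto)
    finally show "root n c * rate \<le> Max (?S n)" .
    show "Max (?S n) \<le> root n upper_const * rate"
      unfolding rt[OF that, symmetric]
    proof (intro Max.boundedI fin)
      show "?S n \<noteq> {}" using w by blast
      fix a assume "a \<in> ?S n"
      then obtain u where "a = root n (op_norm (word_prod d B u))" "length u = n" by blast
      thus "a \<le> root n (upper_const * rate ^ n)" using op_norm_le[of u] that by (simp add: real_root_le_iff)
    qed
  qed
  have "(\<lambda>n. Max (?S n)) \<longlonglongrightarrow> rate"
  proof (rule tendsto_sandwich)
    show "\<forall>\<^sub>F n in sequentially. root n c * rate \<le> Max (?S n)"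
      "\<forall>\<^sub>F n in sequentially. Max (?S n) \<le> root n upper_const * rate"
      by (rule eventually_mono[OF eventually_gt_at_top[of 0]], use bounds in blast)+
    show "(\<lambda>n. root n c * rate) \<longlonglongrightarrow> rate" "(\<lambda>n. root n upper_const * rate) \<longlonglongrightarrow> rate"
      using tendsto_mult_right[OF LIMSEQ_root_const[OF c], of rate]
        tendsto_mult_right[OF LIMSEQ_root_const[OF upper_const_pos], of rate] by simp_all
  qed
  thus ?thesis unfolding jsr_def by (rule limI)
qed

lemma seq_prod_eq: "seq_prod d B x n = word_prod d B (rev (map (\<lambda>i. x (Suc i)) [0..<n]))"
proof -
  have "map x [1..<n+1] = map (\<lambda>i. x (Suc i)) [0..<n]"
    using map_Suc_upt[of 0 n] by (metis (no_types, lifting) One_nat_def Suc_eq_plus1 map_map o_apply map_cong)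
  thus ?thesis by (simp only: seq_prod_def)
qed

text \<open>The coordinates of \<open>y\<close> run through optimal words, so
  \<open>lang_weight\<close> loses at most 25 in each, and the decoder started in state 0 never
  blocks. Incomplete blocks cost at most \<open>rate ^ (2 * m)\<close>.\<close>

lemma extremal_code:
  assumes "\<And>j n. j < p \<Longrightarrow> map (x j) [0..<n] \<in> lang (\<alpha> j)"
    and y: "\<And>i. y i < m" "\<And>i j. j < p \<Longrightarrow> bit (y i) j \<longleftrightarrow> x j i"
  shows "\<exists>c>0. \<forall>n. c * rate ^ n \<le> op_norm (seq_prod d B (\<lambda>i. code_seq m y (i - 1)) n)"
proof -
  define c where "c = 1 / (25 ^ p * rate ^ (2 * m) * d)"
  have c: "c > 0" unfolding c_def using rate_ge_1 d_pos by (intro divide_pos_pos mult_pos_pos) auto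
  have "c * rate ^ n \<le> op_norm (seq_prod d B (\<lambda>i. code_seq m y (i - 1)) n)" for n
  proof -
    let ?w = "map (code_seq m y) [0..<n]"
    obtain t q where dec: "decode m 0 ?w = Some (t, map y [0..<q])"
      using decode_code_seq[of m y n] y(1) m_pos by metis
    have "symbol_weight (map y [0..<q]) = (\<Prod>j<p. weight (\<alpha> j) (map (x j) [0..<q]))"
      unfolding symbol_weight_def by (intro prod.cong refl) (simp add: y(2) o_def)
    also have "\<dots> \<ge> (\<Prod>j<p. growth (\<alpha> j) ^ q / 25)"
    proof (rule prod_mono)
      fix j assume "j \<in> {..<p}"
      thus "0 \<le> growth (\<alpha> j) ^ q / 25 \<and> growth (\<alpha> j) ^ q / 25 \<le> weight (\<alpha> j) (map (x j) [0..<q])"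
        using lang_weight[OF \<alpha> assms(1), of j q] growth_pos[OF \<alpha>] by (auto simp: less_imp_le)
    qed
    also have "(\<Prod>j<p. growth (\<alpha> j) ^ q / 25) = base ^ q / 25 ^ p"
      by (simp add: prod_dividef base_def prod_power_distrib)
    finally have 1: "base ^ q / 25 ^ p \<le> path_weight p \<alpha> 0 ?w"
      using dec by (simp add: path_weight_eq)
    have "n \<le> m * q + 2 * m" using decode_length(2)[OF m_pos states_pos[unfolded states_eq] dec] by simp
    hence "rate ^ n \<le> rate ^ (m * q + 2 * m)" using rate_ge_1 by (rule power_increasing)
    also have "\<dots> = base ^ q * rate ^ (2 * m)" by (simp only: power_add rate_power)
    finally have "rate ^ n / rate ^ (2 * m) \<le> base ^ q" using rate_ge_1 by (simp add: pos_divide_le_eq)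
    hence "rate ^ n / rate ^ (2 * m) / 25 ^ p / d \<le> base ^ q / 25 ^ p / d"
      by (intro divide_right_mono) auto
    also have "\<dots> \<le> path_weight p \<alpha> 0 ?w / d" using 1 by (intro divide_right_mono) auto
    also have "\<dots> \<le> op_norm (word_prod d B (rev ?w))" by (rule op_norm_ge_path[OF states_pos])
    also have "word_prod d B (rev ?w) = seq_prod d B (\<lambda>i. code_seq m y (i - 1)) n"
      by (simp add: seq_prod_eq)
    finally show ?thesis by (simp add: c_def mult_ac)
  qed
  thus ?thesis using c by blast
qed

end

section \<open>Extremal sequences of the coded product\<close>

context tensor_coding
begin

text \<open>Later emissions extend earlier ones, so they fit together into one infinite sequence of
  symbols.\<close>

lemma emission_sequence:
  assumes s: "s < states" and alive: "\<And>n. decode m s (map e [0..<n]) \<noteq> None"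
  obtains Y c where "\<And>i. Y i < m"
    "\<And>n. \<exists>t<states. decode m s (map e [0..<n]) = Some (t, map Y [0..<c n]) \<and>
       phase m t = phase m s + int n - int m * int (c n)"
proof -
  have s': "s < 2 * m - 1" using s by (simp add: states_eq)
  define st where "st n = fst (the (decode m s (map e [0..<n])))" for n
  define em where "em n = snd (the (decode m s (map e [0..<n])))" for n
  have dec: "decode m s (map e [0..<n]) = Some (st n, em n)" for n
    using alive[of n] by (auto simp: st_def em_def)
  have pre: "\<exists>z. em (n + k) = em n @ z" for n k
  proof -
    have "map e [0..<n+k] = map e [0..<n] @ map e [n..<n+k]"
      using upt_add_eq_append[of 0 n k] by simp
    then obtain z where "em n @ z = em (n + k)"
      using dec[of "n + k"] dec[of n] by (auto simp: decode_append)
    thus ?thesis by metis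
  qed
  have nth_eq: "em n ! i = em k ! i" if "i < length (em n)" "i < length (em k)" for n k i
    using that pre[of n "k - n"] pre[of k "n - k"] by (cases "n \<le> k") (auto simp: nth_append)
  \<comment> \<open>After \<open>m * (i + 3)\<close> letters at least \<open>i + 1\<close> symbols
    have been emitted, since \<open>decode_length\<close> allows for \<open>2 * m\<close> letters
    without a symbol.\<close>
  define Y where "Y i = em (m * (i + 3)) ! i" for i
  have long: "i < length (em (m * (i + 3)))" for i
  proof -
    have "m * (i + 3) \<le> m * (length (em (m * (i + 3))) + 2)"
      using decode_length(2)[OF m_pos s' dec[of "m * (i + 3)"]] by (simp add: algebra_simps)
    hence "i + 3 \<le> length (em (m * (i + 3))) + 2" using m_pos by (simp only: mult_le_cancel1)
    thus ?thesis by simp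
  qed
  have em: "em n = map Y [0..<length (em n)]" for n
    by (intro nth_equalityI) (auto simp: Y_def intro!: nth_eq long)
  have "Y i < m" for i
    using decode_set[OF dec[of "m * (i + 3)"]] nth_mem[OF long[of i]] by (auto simp: Y_def)
  moreover have "\<exists>t<states. decode m s (map e [0..<n]) = Some (t, map Y [0..<length (em n)]) \<and>
       phase m t = phase m s + int n - int m * int (length (em n))" for n
    using dec[of n] em[of n] decode_less[OF m_pos s' dec] decode_phase[OF m_pos s' dec[of n]]
    by (auto simp: states_eq)
  ultimately show ?thesis by (rule that)
qed

text \<open>Exponential loss against \<open>rate\<close> along the path from state \<open>s\<close>.
  A very weakly extremal sequence cannot have it from every state.\<close>

definition decays :: "nat \<Rightarrow> (nat \<Rightarrow> nat) \<Rightarrow> real \<Rightarrow> real \<Rightarrow> bool" where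
  "decays s e K q \<longleftrightarrow> K > 0 \<and> 0 < q \<and> q < 1 \<and> (\<forall>n. path_weight p \<alpha> s (map e [0..<n]) \<le> K * (q * rate) ^ n)"

lemma decays_dead:
  assumes s: "s < states" and dead: "decode m s (map e [0..<N]) = None"
  shows "\<exists>K q. decays s e K q"
proof -
  have pos: "rate > 0" using rate_ge_1 by linarith
  \<comment> \<open>The factor \<open>2 ^ N\<close> pays for the lengths below \<open>N\<close>;
    from \<open>N\<close> on the weight is 0.\<close>
  have "path_weight p \<alpha> s (map e [0..<n]) \<le> (5 ^ p * rate ^ (2 * m) * 2 ^ N) * (1/2 * rate) ^ n" for n
  proof (cases "n \<ge> N")
    case True
    have "map e [0..<n] = map e [0..<N] @ map e [N..<n]"
      using upt_add_eq_append[of 0 N "n - N"] True by simp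
    hence "path_weight p \<alpha> s (map e [0..<n]) = 0" using dead by (simp add: path_weight_eq decode_append)
    thus ?thesis using pos by simp
  next
    case False
    have "(1::real) \<le> 2 ^ N * (1/2) ^ n"
    proof -
      have "(2::real) ^ n \<le> 2 ^ N" using False by (intro power_increasing) auto
      thus ?thesis by (simp add: power_divide)
    qed
    hence "5 ^ p * rate ^ (2 * m) * rate ^ n * 1 \<le> 5 ^ p * rate ^ (2 * m) * rate ^ n * (2 ^ N * (1/2) ^ n)"
      using pos by (intro mult_left_mono) auto
    moreover have "path_weight p \<alpha> s (map e [0..<n]) \<le> 5 ^ p * rate ^ (2 * m) * rate ^ n"
      using path_weight_le[OF s, of "map e [0..<n]"] by simp
    ultimately show ?thesis unfolding power_mult_distrib[of "1/2" rate] by (simp add: mult_ac)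
  qed
  thus ?thesis unfolding decays_def using pos
    by (intro exI[of _ "5 ^ p * rate ^ (2 * m) * 2 ^ N"] exI[of _ "1/2"]) auto
qed

text \<open>Each block is non-optimal in some coordinate, so the numbers of bad blocks add up over
  the coordinates to at least \<open>c div l\<close>, and each costs a factor at most
  \<open>T\<close>. Per coordinate the constant is \<open>250 = 50 * 5\<close>, the 5 for the
  incomplete last block.\<close>

lemma symbol_weight_blocks:
  assumes l: "l > 0" and bad: "\<And>k. \<exists>j<p. map (\<lambda>i. bit (Y i) j) [k*l..<k*l+l] \<notin> lang (\<alpha> j)"
  shows "\<exists>T. 0 < T \<and> T < 1 \<and> (\<forall>c. symbol_weight (map Y [0..<c]) \<le> 250 ^ p * T ^ (c div l) * base ^ c)"
proof -
  have "\<forall>j. \<exists>\<theta>. 0 < \<theta> \<and> \<theta> < 1 \<and> (\<forall>x N. weight (\<alpha> j) (map x [0..<N*l]) \<le>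
     50 * \<theta> ^ card {k. k < N \<and> map x [k*l..<k*l+l] \<notin> lang (\<alpha> j)} * growth (\<alpha> j) ^ (N * l))"
    using uncalibrated_blocks[OF \<alpha>] by blast
  then obtain \<theta> where \<theta>: "\<And>j. 0 < \<theta> j" "\<And>j. \<theta> j < 1" and
    W: "\<And>j x N. weight (\<alpha> j) (map x [0..<N*l]) \<le>
     50 * \<theta> j ^ card {k. k < N \<and> map x [k*l..<k*l+l] \<notin> lang (\<alpha> j)} * growth (\<alpha> j) ^ (N * l)"
    by (elim choice[THEN exE]) blast
  define T where "T = Max (insert (1/2) (\<theta> ` {..<p}))"
  have T: "0 < T" "T < 1" unfolding T_def using \<theta> by (auto simp: less_max_iff_disj Max_gr_iff Max_less_iff)
  have \<theta>T: "\<theta> j \<le> T" if "j < p" for j unfolding T_def using that by (intro Max_ge) auto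
  have "symbol_weight (map Y [0..<c]) \<le> 250 ^ p * T ^ (c div l) * base ^ c" for c
  proof -
    let ?N = "c div l" and ?u = "c mod l"
    define K where "K j = {k. k < ?N \<and> map (\<lambda>i. bit (Y i) j) [k*l..<k*l+l] \<notin> lang (\<alpha> j)}" for j
    have wj: "weight (\<alpha> j) (map (\<lambda>k. bit k j) (map Y [0..<c])) \<le> 250 * T ^ card (K j) * growth (\<alpha> j) ^ c"
      if j: "j < p" for j
    proof -
      let ?x = "\<lambda>i. bit (Y i) j"
      have gp: "growth (\<alpha> j) ^ k > 0" for k using growth_pos[OF \<alpha>] by simp
      have "[0..<c] = [0..<?N*l] @ [?N*l..<?N*l+?u]"
        using upt_add_eq_append[of 0 "?N*l" ?u] by simp
      hence "map (\<lambda>k. bit k j) (map Y [0..<c]) = map ?x [0..<?N*l] @ map ?x [?N*l..<?N*l+?u]"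
        by (simp add: o_def flip: map_append)
      hence "weight (\<alpha> j) (map (\<lambda>k. bit k j) (map Y [0..<c])) \<le>
        weight (\<alpha> j) (map ?x [0..<?N*l]) * weight (\<alpha> j) (map ?x [?N*l..<?N*l+?u])"
        using weight_append_le[OF \<alpha>] by metis
      also have "\<dots> \<le> (50 * \<theta> j ^ card (K j) * growth (\<alpha> j) ^ (?N * l)) * (5 * growth (\<alpha> j) ^ ?u)"
      proof (rule mult_mono)
        show "weight (\<alpha> j) (map ?x [0..<?N*l]) \<le> 50 * \<theta> j ^ card (K j) * growth (\<alpha> j) ^ (?N * l)"
          unfolding K_def by (rule W)
        show "weight (\<alpha> j) (map ?x [?N*l..<?N*l+?u]) \<le> 5 * growth (\<alpha> j) ^ ?u"
          using weight_le_growth[OF \<alpha>, of j "map ?x [?N*l..<?N*l+?u]"]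
          by (simp only: length_map length_upt diff_add_inverse)
        show "0 \<le> 50 * \<theta> j ^ card (K j) * growth (\<alpha> j) ^ (?N * l)"
          using \<theta>(1)[of j] gp by (intro mult_nonneg_nonneg) (auto intro: less_imp_le)
        show "0 \<le> weight (\<alpha> j) (map ?x [?N*l..<?N*l+?u])" by (rule less_imp_le[OF weight_pos[OF \<alpha>]])
      qed
      also have "\<dots> = 250 * \<theta> j ^ card (K j) * (growth (\<alpha> j) ^ (?N * l) * growth (\<alpha> j) ^ ?u)" by simp
      also have "growth (\<alpha> j) ^ (?N * l) * growth (\<alpha> j) ^ ?u = growth (\<alpha> j) ^ c"
        by (simp flip: power_add)
      also have "250 * \<theta> j ^ card (K j) * growth (\<alpha> j) ^ c \<le> 250 * T ^ card (K j) * growth (\<alpha> j) ^ c"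
        using \<theta>T[OF j] \<theta>(1)[of j] gp[of c] by (intro mult_right_mono mult_left_mono power_mono) auto
      finally show ?thesis .
    qed
    have "symbol_weight (map Y [0..<c]) \<le> (\<Prod>j<p. 250 * T ^ card (K j) * growth (\<alpha> j) ^ c)"
      unfolding symbol_weight_def using wj weight_pos[OF \<alpha>]
      by (intro prod_mono) (auto intro: less_imp_le)
    also have "\<dots> = 250 ^ p * T ^ (\<Sum>j<p. card (K j)) * base ^ c"
      by (simp add: prod.distrib base_def prod_power_distrib power_sum)
    also have "\<dots> \<le> 250 ^ p * T ^ ?N * base ^ c"
    proof (intro mult_right_mono mult_left_mono power_decreasing)
      have "{..<?N} \<subseteq> (\<Union>j\<in>{..<p}. K j)" using bad by (auto simp: K_def)
      hence "card {..<?N} \<le> card (\<Union>j\<in>{..<p}. K j)"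
        by (intro card_mono) (auto simp: K_def)
      also have "\<dots> \<le> (\<Sum>j<p. card (K j))" by (rule card_UN_le) simp
      finally show "?N \<le> (\<Sum>j<p. card (K j))" by simp
    qed (use T base_ge_1 in auto)
    finally show ?thesis .
  qed
  thus ?thesis using T by blast
qed

lemma decays_blocks:
  assumes s: "s < states" and l: "l > 0"
    and dec: "\<And>n. \<exists>t. decode m s (map e [0..<n]) = Some (t, map Y [0..<c n])"
    and bad: "\<And>k. \<exists>j<p. map (\<lambda>i. bit (Y i) j) [k*l..<k*l+l] \<notin> lang (\<alpha> j)"
  shows "\<exists>K q. decays s e K q"
proof -
  obtain T where T: "0 < T" "T < 1" and W: "\<And>c. symbol_weight (map Y [0..<c]) \<le> 250 ^ p * T ^ (c div l) * base ^ c"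
    using symbol_weight_blocks[OF l bad] by blast
  \<comment> \<open>\<open>T\<close> is lost per \<open>l\<close> symbols, that is per
    \<open>l * m\<close> letters.\<close>
  define q where "q = root (l * m) T"
  have lm: "l * m > 0" using l m_pos by simp
  have q: "0 < q" "q < 1" unfolding q_def using T lm by auto
  have qT: "q ^ (l * m) = T" unfolding q_def using T lm by simp
  \<comment> \<open>Letters not covered by complete groups of \<open>l\<close> symbols: at most
    \<open>m * l\<close> in the last group and \<open>2 * m\<close> for partial code words at the
    ends.\<close>
  define E where "E = m * l + 2 * m"
  have "path_weight p \<alpha> s (map e [0..<n]) \<le> (250 ^ p * rate ^ (2 * m) / q ^ E) * (q * rate) ^ n" for n
  proof -
    let ?c = "c n"
    obtain t where t: "decode m s (map e [0..<n]) = Some (t, map Y [0..<?c])" using dec by blast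
    have len: "m * ?c \<le> n + 2 * m" "n \<le> m * ?c + 2 * m"
      using decode_length[OF m_pos s[unfolded states_eq] t] by simp_all
    have "?c \<le> l * (?c div l) + l"
      using l mod_less_divisor[of l ?c] mult_div_mod_eq[of l ?c] by linarith
    hence "m * ?c \<le> m * (l * (?c div l) + l)" by (rule mult_le_mono2)
    hence "n \<le> l * m * (?c div l) + E" using len by (simp add: E_def algebra_simps)
    hence "q ^ (l * m * (?c div l) + E) \<le> q ^ n" using q by (intro power_decreasing) auto
    hence "T ^ (?c div l) * q ^ E \<le> q ^ n" by (simp only: power_add power_mult[of q "l * m"] qT)
    hence 1: "T ^ (?c div l) \<le> q ^ n / q ^ E" using q by (simp add: pos_le_divide_eq)
    have "base ^ ?c = rate ^ (m * ?c)" by (simp only: rate_power)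
    also have "\<dots> \<le> rate ^ (n + 2 * m)" using len rate_ge_1 by (intro power_increasing) auto
    finally have 2: "base ^ ?c \<le> rate ^ (2 * m) * rate ^ n" by (simp add: power_add mult_ac)
    have "path_weight p \<alpha> s (map e [0..<n]) \<le> 250 ^ p * T ^ (?c div l) * base ^ ?c"
      using W t by (simp add: path_weight_eq)
    also have "\<dots> \<le> 250 ^ p * (q ^ n / q ^ E) * (rate ^ (2 * m) * rate ^ n)"
      using 1 2 q T base_ge_1 by (intro mult_mono) auto
    finally show ?thesis by (simp add: power_mult_distrib mult_ac)
  qed
  moreover have "250 ^ p * rate ^ (2 * m) / q ^ E > 0" using rate_ge_1 q by simp
  ultimately show ?thesis unfolding decays_def using q by blast
qed

text \<open>If the paths from all of the finitely many states decayed, the largest ratio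
  \<open>R < 1\<close> would bound the limsup of the roots by \<open>R * rate\<close>, below the
  joint spectral radius.\<close>

lemma extremal_path:
  assumes jsr: "jsr d 2 B = rate" and x: "very_weakly_extremal d 2 B x"
  shows "\<exists>s<states. \<forall>K q. \<not> decays s (\<lambda>i. x (Suc i)) K q"
proof (rule ccontr)
  let ?e = "\<lambda>i. x (Suc i)"
  assume "\<not> ?thesis"
  hence "\<forall>s. \<exists>K q. s < states \<longrightarrow> decays s ?e K q" by blast
  then obtain K q where dk: "\<And>s. s < states \<Longrightarrow> decays s ?e (K s) (q s)" by metis
  define R where "R = Max (q ` {..<states})"
  define C where "C = (\<Sum>s<states. K s)"
  have ne: "{..<states} \<noteq> {}" using states_pos by auto
  have R: "0 < R" "R < 1" and qR: "\<And>s. s < states \<Longrightarrow> q s \<le> R"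
    using dk ne by (auto simp: R_def decays_def Max_gr_iff Max_less_iff)
  have C: "C > 0" unfolding C_def using dk ne by (intro sum_pos) (auto simp: decays_def)
  have pos: "rate > 0" using rate_ge_1 by linarith
  have le: "op_norm (seq_prod d B x n) \<le> C * (R * rate) ^ n" for n
  proof -
    have "op_norm (seq_prod d B x n) \<le> (\<Sum>s<states. path_weight p \<alpha> s (map ?e [0..<n]))"
      unfolding seq_prod_eq by (rule op_norm_le_path)
    also have "\<dots> \<le> (\<Sum>s<states. K s * (R * rate) ^ n)"
    proof (rule sum_mono)
      fix s assume "s \<in> {..<states}"
      hence s: "s < states" by simp
      have "path_weight p \<alpha> s (map ?e [0..<n]) \<le> K s * (q s * rate) ^ n"
        using dk[OF s] by (simp add: decays_def)
      also have "\<dots> \<le> K s * (R * rate) ^ n"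
        using dk[OF s] qR[OF s] pos by (intro mult_left_mono power_mono mult_right_mono) (auto simp: decays_def)
      finally show "path_weight p \<alpha> s (map ?e [0..<n]) \<le> K s * (R * rate) ^ n" .
    qed
    finally show ?thesis by (simp add: C_def sum_distrib_right)
  qed
  have "limsup (\<lambda>n. ereal (root n (op_norm (seq_prod d B x n)))) \<le> limsup (\<lambda>n. ereal (root n C * (R * rate)))"
  proof (rule Limsup_mono)
    have "root n (op_norm (seq_prod d B x n)) \<le> root n C * (R * rate)" if "n > 0" for n
    proof -
      have "root n (op_norm (seq_prod d B x n)) \<le> root n (C * (R * rate) ^ n)"
        using le that by (simp add: real_root_le_iff)
      also have "\<dots> = root n C * (R * rate)"
        using that R pos by (simp add: real_root_mult real_root_power_cancel)
      finally show ?thesis .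
    qed
    thus "\<forall>\<^sub>F n in sequentially. ereal (root n (op_norm (seq_prod d B x n))) \<le> ereal (root n C * (R * rate))"
      by (intro eventually_mono[OF eventually_gt_at_top[of 0]]) simp
  qed
  also have "limsup (\<lambda>n. ereal (root n C * (R * rate))) = ereal (R * rate)"
  proof (rule lim_imp_Limsup)
    have "(\<lambda>n. root n C * (R * rate)) \<longlonglongrightarrow> 1 * (R * rate)"
      by (intro tendsto_mult LIMSEQ_root_const C tendsto_const)
    thus "(\<lambda>n. ereal (root n C * (R * rate))) \<longlonglongrightarrow> ereal (R * rate)" by simp
  qed simp
  finally have "rate \<le> R * rate" using x jsr by (simp add: very_weakly_extremal_def)
  thus False using R pos by simp
qed

text \<open>A path without decay is never undecodable, by \<open>decays_dead\<close>, and for no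
  \<open>l\<close> are all its blocks of \<open>l\<close> symbols non-optimal in some coordinate, by
  \<open>decays_blocks\<close>.\<close>

lemma extremal_symbols:
  assumes jsr: "jsr d 2 B = rate" and x: "very_weakly_extremal d 2 B x"
  obtains s Y c where "s < states" "\<And>i. Y i < m"
    "\<And>n. \<exists>t<states. decode m s (map (\<lambda>i. x (Suc i)) [0..<n]) = Some (t, map Y [0..<c n]) \<and>
       phase m t = phase m s + int n - int m * int (c n)"
    "\<And>l. l > 0 \<Longrightarrow> \<exists>k. \<forall>j<p. map (\<lambda>i. bit (Y i) j) [k..<k+l] \<in> lang (\<alpha> j)"
proof -
  obtain s where s: "s < states" and nd: "\<And>K q. \<not> decays s (\<lambda>i. x (Suc i)) K q"
    using extremal_path[OF assms] by blast
  have alive: "decode m s (map (\<lambda>i. x (Suc i)) [0..<n]) \<noteq> None" for n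
    using decays_dead[OF s] nd by blast
  obtain Y c where Yc: "\<And>i. Y i < m"
    "\<And>n. \<exists>t<states. decode m s (map (\<lambda>i. x (Suc i)) [0..<n]) = Some (t, map Y [0..<c n]) \<and>
       phase m t = phase m s + int n - int m * int (c n)"
    using emission_sequence[OF s alive] by blast
  have "\<exists>k. \<forall>j<p. map (\<lambda>i. bit (Y i) j) [k..<k+l] \<in> lang (\<alpha> j)" if "l > 0" for l
  proof (rule ccontr)
    assume "\<not> ?thesis"
    hence "\<exists>j<p. map (\<lambda>i. bit (Y i) j) [k*l..<k*l+l] \<notin> lang (\<alpha> j)" for k by blast
    from decays_blocks[OF s that _ this] Yc(2) nd show False by blast
  qed
  thus ?thesis using that s Yc by blast
qed

text \<open>The phase determines when the decoder is back in state 0: symbol \<open>i\<close> starts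
  after \<open>m * i - phase m s\<close> letters. A window of \<open>x\<close> from there decodes on
  its own, so decoding maps the subwords of length \<open>n\<close> onto the factors of
  \<open>q\<close> symbols. The condition \<open>i \<ge> 1\<close> makes this time nonnegative
  whatever the start state.\<close>

lemma factor_in_complexity:
  assumes x: "in_shift 2 x" and s: "s < states" and Y: "\<And>i. Y i < m"
    and dec: "\<And>n. \<exists>t<states. decode m s (map (\<lambda>i. x (Suc i)) [0..<n]) = Some (t, map Y [0..<c n]) \<and>
       phase m t = phase m s + int n - int m * int (c n)"
    and q: "m * q \<le> n"
  shows "card {map Y [i..<i+q] |i. i \<ge> 1} \<le> complexity x n"
proof -
  let ?e = "\<lambda>i. x (Suc i)"
  have at_block: "decode m s (map ?e [0..<N]) = Some (0, map Y [0..<i])"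
    if N: "int N = int m * int i - phase m s" for N i
  proof -
    obtain t where t: "t < states" "decode m s (map ?e [0..<N]) = Some (t, map Y [0..<c N])"
      and ph: "phase m t = phase m s + int N - int m * int (c N)" using dec by blast
    have "phase m t = int m * (int i - int (c N))" using ph N by (simp add: algebra_simps)
    moreover have "\<bar>phase m t\<bar> < int m" using t by (intro phase_bounds) (simp add: states_eq)
    ultimately have "\<bar>int i - int (c N)\<bar> * int m < 1 * int m" by (simp add: abs_mult mult.commute)
    hence "int i = int (c N)" using m_pos by (subst (asm) mult_less_cancel_right) auto
    hence "c N = i" "phase m t = 0" using ph N by simp_all
    thus ?thesis using t phase_zero[of t m] by (simp add: states_eq)
  qed
  let ?S = "{subword x k n |k. True}"
  let ?G = "\<lambda>u. snd (the (decode m 0 (take (m * q) u)))"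
  have finS: "finite ?S"
  proof (rule finite_subset)
    show "?S \<subseteq> {w. set w \<subseteq> {..<2} \<and> length w = n}"
      using x by (auto simp: subword_def in_shift_def)
  qed (simp add: finite_lists_length_eq)
  have "{map Y [i..<i+q] |i. i \<ge> 1} \<subseteq> ?G ` ?S"
  proof clarify
    fix i :: nat assume i: "1 \<le> i"
    have "phase m s \<le> int m * int i"
    proof -
      have "phase m s \<le> int m * 1" using phase_bounds[of s m] s by (simp add: states_eq)
      also have "\<dots> \<le> int m * int i" using i by (intro mult_left_mono) auto
      finally show ?thesis .
    qed
    define N where "N = nat (int m * int i - phase m s)"
    have N: "int N = int m * int i - phase m s" using \<open>phase m s \<le> _\<close> by (simp add: N_def)
    have N': "int (N + m * q) = int m * int (i + q) - phase m s" using N by (simp add: algebra_simps)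
    have "map ?e [0..<N + m * q] = map ?e [0..<N] @ map ?e [N..<N + m * q]"
      using upt_add_eq_append[of 0 N "m * q"] by simp
    with at_block[OF N'] at_block[OF N] obtain z where z: "decode m 0 (map ?e [N..<N + m * q]) = Some (0, z)"
      "map Y [0..<i+q] = map Y [0..<i] @ z"
      by (auto simp: decode_append)
    have "z = map Y [i..<i+q]" using z(2) upt_add_eq_append[of 0 i q] by simp
    moreover have "take (m * q) (subword x N n) = map ?e [N..<N + m * q]"
    proof -
      have "subword x N n = map ?e [N..<N+n]"
        unfolding subword_def by (intro nth_equalityI) (auto simp: add.commute)
      thus ?thesis using q by (simp add: take_map)
    qed
    ultimately have "?G (subword x N n) = map Y [i..<i+q]" using z by simp
    thus "map Y [i..<i+q] \<in> ?G ` ?S" by (intro image_eqI[of _ _ "subword x N n"]) auto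
  qed
  hence "card {map Y [i..<i+q] |i. i \<ge> 1} \<le> card (?G ` ?S)" by (intro card_mono finite_imageI finS)
  also have "\<dots> \<le> card ?S" by (rule card_image_le[OF finS])
  finally show ?thesis by (simp add: complexity_def)
qed

text \<open>\<open>T\<close> collects the factors of \<open>Y\<close> that are optimal in all
  coordinates. An infinite sequence with all prefixes in \<open>T\<close> has exact coordinate
  frequencies, so \<open>balanced_tuple_complexity\<close> applies to it, and its factors of length
  \<open>n div m\<close> occur in \<open>Y\<close>.\<close>

lemma extremal_complexity:
  assumes ind: "rationally_independent p (\<lambda>j. freq (\<alpha> j))"
    and jsr: "jsr d 2 B = rate" and sh: "in_shift 2 x" and x: "very_weakly_extremal d 2 B x"
  shows "(n div m + 1) ^ p \<le> complexity x n"
proof -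
  obtain s Y c where s: "s < states" and Y: "\<And>i. Y i < m"
    and dec: "\<And>n. \<exists>t<states. decode m s (map (\<lambda>i. x (Suc i)) [0..<n]) = Some (t, map Y [0..<c n]) \<and>
       phase m t = phase m s + int n - int m * int (c n)"
    and good: "\<And>l. l > 0 \<Longrightarrow> \<exists>k. \<forall>j<p. map (\<lambda>i. bit (Y i) j) [k..<k+l] \<in> lang (\<alpha> j)"
    using extremal_symbols[OF jsr x] by metis
  define T where "T = {w. (\<exists>i\<ge>1. w = map Y [i..<i + length w]) \<and> (\<forall>j<p. map (\<lambda>k. bit k j) w \<in> lang (\<alpha> j))}"
  have fac: "w \<in> T" if "u @ w @ z \<in> T" for u w z
  proof -
    from that obtain i where i: "i \<ge> 1" "u @ w @ z = map Y [i..<i + length (u @ w @ z)]"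
      and L: "\<And>j. j < p \<Longrightarrow> map (\<lambda>k. bit k j) (u @ w @ z) \<in> lang (\<alpha> j)" unfolding T_def by blast
    define l where "l = length (u @ w @ z)"
    have "w = take (length w) (drop (length u) (u @ w @ z))" by simp
    also have "u @ w @ z = map Y [i..<i + l]" using i(2) unfolding l_def .
    also have "take (length w) (drop (length u) (map Y [i..<i + l])) = map Y [i + length u..<i + length u + length w]"
      by (simp add: take_map drop_map l_def)
    finally have "w = map Y [i + length u..<i + length u + length w]" .
    moreover have "map (\<lambda>k. bit k j) w \<in> lang (\<alpha> j)" if "j < p" for j
      using factor_closedD[OF lang_factor_closed[OF \<alpha>], of "map (\<lambda>k. bit k j) u" "map (\<lambda>k. bit k j) w" "map (\<lambda>k. bit k j) z"]
        L[OF that] by simp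
    ultimately show ?thesis unfolding T_def using i(1) by (intro CollectI conjI exI[of _ "i + length u"]) auto
  qed
  have ex: "\<exists>w\<in>T. length w = l" for l
  proof -
    \<comment> \<open>One symbol more than required: dropping the first moves the factor to a
      position of at least 1, as \<open>T\<close> demands.\<close>
    obtain k where k: "\<And>j. j < p \<Longrightarrow> map (\<lambda>i. bit (Y i) j) [k..<k+Suc l] \<in> lang (\<alpha> j)" using good[of "Suc l"] by blast
    have "map (\<lambda>i. bit (Y i) j) [Suc k..<Suc k+l] \<in> lang (\<alpha> j)" if "j < p" for j
      using factor_closed_dropD[OF lang_factor_closed[OF \<alpha>] k[OF that], of 1] by (simp add: drop_map del: upt_Suc)
    hence "map Y [Suc k..<Suc k+l] \<in> T" unfolding T_def by (auto simp: o_def intro!: exI[of _ "Suc k"])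
    thus ?thesis by (intro bexI) auto
  qed
  have "\<exists>y. \<forall>n. map y [0..<n] \<in> T"
  proof (rule konig_infinite_path[of "{..<m}"])
    show "T \<subseteq> lists {..<m}"
    proof
      fix w assume "w \<in> T"
      then obtain i l where "w = map Y [i..<i + l]" unfolding T_def by blast
      thus "w \<in> lists {..<m}" using Y by auto
    qed
    show "u \<in> T" if "u @ v \<in> T" for u v using fac[of "[]" u v] that by simp
  qed (use ex in auto)
  then obtain y where y: "\<And>n. map y [0..<n] \<in> T" by blast
  have yT: "map y [k..<k+n] \<in> T" for k n
    using fac[of "map y [0..<k]" "map y [k..<k+n]" "[]"] y[of "k + n"] upt_add_eq_append[of 0 k n] by simp
  have yY: "\<exists>i\<ge>1. map y [k..<k+n] = map Y [i..<i+n]" for k n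
    using yT[of k n] by (auto simp: T_def)
  let ?q = "n div m"
  have "(?q + 1) ^ p \<le> card (range (\<lambda>k. map y [k..<k+?q]))"
  proof (rule balanced_tuple_complexity[OF ind, where f = "\<lambda>j k. bit k j"])
    have "y i < m" for i
    proof -
      obtain i' where "map y [i..<i+1] = map Y [i'..<i'+1]" using yY[of i 1] by blast
      thus ?thesis using Y by simp
    qed
    thus "finite (range y)" by (auto intro!: finite_subset[of "range y" "{..<m}"])
    fix j k n assume "j < p"
    hence "map (\<lambda>i. bit (y i) j) [k..<k+n] \<in> lang (\<alpha> j)" using yT[of k n] by (auto simp: T_def o_def)
    from lang_freq[OF \<alpha> this]
    show "\<bar>real (ones_count (map (\<lambda>i. bit (y i) j) [k..<k+n])) - freq (\<alpha> j) * n\<bar> \<le> 1" by simp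
  qed
  also have "\<dots> \<le> card {map Y [i..<i+?q] |i. i \<ge> 1}"
  proof (rule card_mono)
    show "finite {map Y [i..<i+?q] |i. i \<ge> 1}"
      by (rule finite_subset[OF _ finite_lists_length_eq[of "{..<m}" ?q]]) (use Y in auto)
    show "range (\<lambda>k. map y [k..<k+?q]) \<subseteq> {map Y [i..<i+?q] |i. i \<ge> 1}" using yY by blast
  qed
  also have "\<dots> \<le> complexity x n" by (rule factor_in_complexity[OF sh s Y dec]) simp_all
  finally show ?thesis .
qed

end

theorem theorem2:
  fixes p :: nat
  assumes "p \<ge> 1"
  shows "\<exists>B :: nat \<Rightarrow> real mat.
     (\<forall>i<2. B i \<in> carrier_mat (2^p * (2^(p+1) - 1)) (2^p * (2^(p+1) - 1))) \<and>
     (\<forall>x. in_shift 2 x \<and> very_weakly_extremal (2^p * (2^(p+1) - 1)) 2 B x \<longrightarrow>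
        (\<forall>n\<ge>1. real (complexity x n) \<ge> (real (n div 2^p) + 1) ^ p \<and>
                (real (n div 2^p) + 1) ^ p > real n ^ p / 2 ^ (p^2))) \<and>
     (\<exists>z. in_shift 2 z \<and> strongly_extremal (2^p * (2^(p+1) - 1)) 2 B z \<and>
        (\<forall>n\<ge>1. real (complexity z n) \<le>
            2^p * (real_of_int \<lceil>real n / 2^p\<rceil> + 2) ^ p))"
proof -
  obtain g where g: "rationally_independent p g" "\<And>j. j < p \<Longrightarrow> 0 < g j \<and> g j < 1"
    using rationally_independent_exists by blast
  have "\<forall>j. \<exists>a>0. j < p \<longrightarrow> freq a = g j"
  proof
    fix j
    show "\<exists>a>0. j < p \<longrightarrow> freq a = g j"
      using freq_onto[of "g j"] g(2)[of j] by (cases "j < p") (auto intro: exI[of _ 1])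
  qed
  then obtain \<alpha> where al: "\<And>j. \<alpha> j > 0" "\<And>j. j < p \<Longrightarrow> freq (\<alpha> j) = g j" by metis
  interpret tensor_coding p \<alpha> by standard (rule al)
  have ind: "rationally_independent p (\<lambda>j. freq (\<alpha> j))"
    using g(1) al(2) unfolding rationally_independent_def by simp
  have "\<forall>j. \<exists>x. \<forall>k n. map x [k..<k+n] \<in> lang (\<alpha> j)"
    using calibrated_sequence[OF al(1)] calibrated_sequence_lang[OF al(1)] by metis
  then obtain x where x: "\<And>j k n. map (x j) [k..<k+n] \<in> lang (\<alpha> j)" by metis
  have "\<forall>i. \<exists>k<m. \<forall>j<p. bit k j \<longleftrightarrow> x j i" unfolding m_def by (intro allI symbol_exists)
  from choice[OF this] obtain y where y: "\<And>i. y i < m" "\<And>i j. j < p \<Longrightarrow> bit (y i) j \<longleftrightarrow> x j i"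
    by blast
  define z where "z i = code_seq m y (i - 1)" for i
  have z2: "z i < 2" for i by (simp add: z_def code_seq_def)
  \<comment> \<open>The same bound serves twice: as the lower bound that determines
    \<open>jsr\<close>, and as strong extremality of \<open>z\<close>.\<close>
  obtain c where c: "c > 0" "\<And>n. c * rate ^ n \<le> op_norm (seq_prod d B z n)"
  proof -
    have "map (x j) [0..<n] \<in> lang (\<alpha> j)" for j n using x[of j 0 n] by simp
    from extremal_code[OF this y] show ?thesis using that unfolding z_def by blast
  qed
  have jsr: "jsr d 2 B = rate"
  proof (rule jsr_eq[OF c(1)])
    fix n
    show "\<exists>w. length w = n \<and> set w \<subseteq> {..<2} \<and> c * rate ^ n \<le> op_norm (word_prod d B w)"
      using c(2)[of n] z2 unfolding seq_prod_def by (intro exI[of _ "rev (map z [1..<n+1])"]) auto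
  qed
  have i: "(real (n div 2^p) + 1) ^ p \<le> real (complexity u n)"
    if "in_shift 2 u" "very_weakly_extremal d 2 B u" for u n
  proof -
    have "real ((n div m + 1) ^ p) \<le> real (complexity u n)"
      using extremal_complexity[OF ind jsr that] by (rule of_nat_mono)
    thus ?thesis by (simp add: m_def add.commute)
  qed
  have i': "real n ^ p / 2 ^ (p^2) < (real (n div 2^p) + 1) ^ p" for n
  proof -
    have "real n / 2 ^ p < real (n div 2^p) + 1"
    proof -
      have "n mod 2 ^ p < 2 ^ p" by simp
      hence "n < 2 ^ p * (n div 2 ^ p) + 2 ^ p" using mult_div_mod_eq[of "2 ^ p" n] by linarith
      hence "real n < real (2 ^ p * (n div 2 ^ p) + 2 ^ p)" by (rule of_nat_less_iff[THEN iffD2])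
      thus ?thesis by (simp add: pos_divide_less_eq algebra_simps)
    qed
    hence "(real n / 2 ^ p) ^ p < (real (n div 2^p) + 1) ^ p"
      using assms by (intro power_strict_mono) auto
    thus ?thesis by (simp add: power_divide power2_eq_square flip: power_mult)
  qed
  have ii: "real (complexity z n) \<le> 2^p * (real_of_int \<lceil>real n / 2^p\<rceil> + 2) ^ p" for n
  proof -
    define q where "q = nat \<lceil>real n / 2^p\<rceil>"
    have q: "real q = real_of_int \<lceil>real n / 2^p\<rceil>" by (simp add: q_def)
    have "real n / 2^p \<le> real q" unfolding q by (rule le_of_int_ceiling)
    hence "real n \<le> real (m * q)" by (simp add: m_def field_simps)
    hence nq: "n \<le> m * q" by linarith
    \<comment> \<open>The \<open>q + 1\<close> symbols met by a window allow at most
      \<open>q + 2\<close> words in each coordinate; this is the summand 2 next to the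
      ceiling.\<close>
    have cx: "card (range (\<lambda>k. map (\<lambda>i. bit (y i) j) [k..<k+(q+1)])) \<le> (q + 1) + 1" if "j < p" for j
      unfolding y(2)[OF that]
      by (rule crossing_free_complexity[OF lang_factor_closed[OF al(1)] lang_crossing_free[OF al(1)] x])
    note Y = symbol_words_card[of y p "q + 1", OF y(1)[unfolded m_def] cx]
    have "complexity z n \<le> m * card (range (\<lambda>k. map y [k..<k+(q+1)]))"
      unfolding z_def by (rule code_seq_complexity[OF m_pos nq Y(2)])
    also have "\<dots> \<le> m * ((q + 1) + 1) ^ p" by (intro mult_le_mono2 Y(1))
    finally have "real (complexity z n) \<le> real (m * ((q + 1) + 1) ^ p)" by (rule of_nat_mono)
    also have "\<dots> = 2^p * (real q + 2) ^ p" by (simp add: m_def add.commute)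
    finally show ?thesis unfolding q .
  qed
  have strong: "strongly_extremal d 2 B z"
    unfolding strongly_extremal_def jsr using c by blast
  have "in_shift 2 z" by (simp add: in_shift_def z2)
  with i i' ii strong show ?thesis unfolding d_def[symmetric]
    by (intro exI[of _ B] conjI allI impI exI[of _ z]) (auto simp: B_carrier)
qed

end
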